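(* Let $\Omega=0$ and $\alpha\in(0,1)$, let $\Phi_g=(\phi_1^g,\phi_2^g)^\top$ be a real-valued ground state (with component masses $\alpha$ and $1-\alpha$), and let $\mathcal H_\pm$ and $\mathcal H=\begin{bmatrix}\mathcal O&\mathcal H_-\\ \mathcal H_+&\mathcal O\end{bmatrix}$ be the associated operators (see context). Put $\Phi_1=\Phi_g$ and $\Phi_2=\Big(-\big(\tfrac{1-\alpha}{\alpha}\big)^{1/2}\phi_1^g,\ \big(\tfrac{\alpha}{1-\alpha}\big)^{1/2}\phi_2^g\Big)^\top$. Assume that $\mathcal H_+$ is positive definite and $\operatorname{null}(\mathcal H_-)=\operatorname{span}\{\Phi_1,\Phi_2\}$. Then $$\operatorname{null}(\mathcal H^3)=\operatorname{null}(\mathcal H^2)=\operatorname{null}(\mathcal H)\oplus\operatorname{span}\left\{\begin{bmatrix}\widehat\Phi_1\\ \mathbf 0\end{bmatrix},\begin{bmatrix}\widehat\Phi_2\\ \mathbf 0\end{bmatrix}\right\},$$ where $\widehat\Phi_j=\mathcal H_+^{-1}\Phi_j$, $j=1,2$, and $\operatorname{null}(\mathcal H)=\operatorname{span}\left\{\begin{bmatrix}\mathbf 0\\ \Phi_1\end{bmatrix},\begin{bmatrix}\mathbf 0\\ \Phi_2\end{bmatrix}\right\}$.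
   Context: Let $d\in\{1,2,3\}$, $V:\mathbb R^d\to[0,\infty)$ locally integrable with $\lim_{|\boldsymbol x|\to\infty}V(\boldsymbol x)=\infty$, $\delta\in\mathbb R$, $\beta_{jl}\in\mathbb R$ ($j,l=1,2$) with $\beta_{12}=\beta_{21}$. Let $X=\{\boldsymbol f\in H^1(\mathbb R^d;\mathbb C^2):\int V|\boldsymbol f|^2<\infty\}$. A ground state is a minimizer $\Phi_g=(\phi_1^g,\phi_2^g)^\top$, over $\Phi=(\phi_1,\phi_2)^\top\in X$ with $\|\phi_1\|_{L^2}^2=\alpha$ and $\|\phi_2\|_{L^2}^2=1-\alpha$, of $$\mathcal E_0(\Phi)=\int_{\mathbb R^d}\sum_j\Big(\tfrac12|\nabla\phi_j|^2+V|\phi_j|^2\Big)+\sum_{j,l}\tfrac{\beta_{jl}}2|\phi_j|^2|\phi_l|^2+\tfrac\delta2(|\phi_1|^2-|\phi_2|^2)\,d\boldsymbol x .$$ Its chemical potentials $\mu_1,\mu_2\in\mathbb R$ are the Lagrange multipliers in the Euler–Lagrange equations $$\mu_1\phi_1^g=[-\tfrac12\nabla^2+V+\tfrac\delta2+\beta_{11}|\phi_1^g|^2+\beta_{12}|\phi_2^g|^2]\phi_1^g,\qquad \mu_2\phi_2^g=[-\tfrac12\nabla^2+V-\tfrac\delta2+\beta_{21}|\phi_1^g|^2+\beta_{22}|\phi_2^g|^2]\phi_2^g.$$ Put $$\mathcal A=\begin{bmatrix}L_1&\beta_{12}\phi_1^g\phi_2^g\\ \beta_{21}\phi_1^g\phi_2^g&L_2\end{bmatrix},\qquad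 \mathcal B=\begin{bmatrix}\beta_{11}(\phi_1^g)^2&\beta_{12}\phi_1^g\phi_2^g\\ \beta_{21}\phi_1^g\phi_2^g&\beta_{22}(\phi_2^g)^2\end{bmatrix},$$ $$L_1=-\tfrac12\nabla^2+V+\tfrac\delta2+2\beta_{11}(\phi_1^g)^2+\beta_{12}(\phi_2^g)^2-\mu_1,\qquad L_2=-\tfrac12\nabla^2+V-\tfrac\delta2+\beta_{21}(\phi_1^g)^2+2\beta_{22}(\phi_2^g)^2-\mu_2,$$ $\mathcal H_+=\mathcal A+\mathcal B$, $\mathcal H_-=\mathcal A-\mathcal B$. These are understood as the self-adjoint operators on $L^2(\mathbb R^d;\mathbb C^2)$ associated with the corresponding Hermitian forms on $X$ (closed and bounded below, with compact resolvent since $V\to\infty$). Positive definite means $\langle\mathcal H_+\boldsymbol f,\boldsymbol f\rangle>0$ (as a form) for all $0\ne\boldsymbol f\in X$; then $\mathcal H_+$ is invertible. The operator $\mathcal H$ acts on pairs $(\boldsymbol f,\boldsymbol g)$ with $\boldsymbol f\in\operatorname{dom}(\mathcal H_+)$, $\boldsymbol g\in\operatorname{dom}(\mathcal H_-)$ by $\mathcal H(\boldsymbol f,\boldsymbol g)=(\mathcal H_-\boldsymbol g,\mathcal H_+\boldsymbol f)$, and its powers have their natural domains. *)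

theory Defs
  imports "HOL-Analysis.Analysis" "HOL-Library.Set_Algebras"
begin

section \<open>Complex vector spaces\<close>

class complex_vector = ab_group_add +
  fixes scaleC :: "complex \<Rightarrow> 'a \<Rightarrow> 'a"  (infixr \<open>*\<^sub>C\<close> 75)
  assumes scaleC_add_right: "c *\<^sub>C (x + y) = c *\<^sub>C x + c *\<^sub>C y"
    and scaleC_add_left: "(c + d) *\<^sub>C x = c *\<^sub>C x + d *\<^sub>C x"
    and scaleC_scaleC: "c *\<^sub>C d *\<^sub>C x = (c * d) *\<^sub>C x"
    and scaleC_one: "1 *\<^sub>C x = x"

lemma vector_space_scaleC:
  "vector_space (scaleC :: complex \<Rightarrow> 'a \<Rightarrow> 'a :: complex_vector)"
  by standard (simp_all add: scaleC_add_right scaleC_add_left scaleC_scaleC scaleC_one)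

definition cspan :: "'a :: complex_vector set \<Rightarrow> 'a set" where
  "cspan S = module.span scaleC S"

instantiation prod :: (complex_vector, complex_vector) complex_vector
begin

definition scaleC_prod :: "complex \<Rightarrow> 'a \<times> 'b \<Rightarrow> 'a \<times> 'b" where
  "scaleC_prod c p = (c *\<^sub>C fst p, c *\<^sub>C snd p)"

instance
  by standard
    (simp_all add: scaleC_prod_def scaleC_add_right scaleC_add_left scaleC_scaleC scaleC_one)

end

definition is_direct_sum :: "'a :: complex_vector set \<Rightarrow> 'a set \<Rightarrow> 'a set \<Rightarrow> bool" where
  "is_direct_sum U A B \<longleftrightarrow> U = A + B \<and> A \<inter> B = {0}"


section \<open>The Hilbert space of square integrable functions\<close>

definition sq_integrable :: "('a :: euclidean_space \<Rightarrow> complex) \<Rightarrow> bool" where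
  "sq_integrable f \<longleftrightarrow>
     f \<in> borel_measurable lebesgue \<and> integrable lebesgue (\<lambda>x. (cmod (f x))\<^sup>2)"

lemma sq_integrable_zero: "sq_integrable (\<lambda>x. 0)"
  by (simp add: sq_integrable_def)

lemma sq_integrable_add:
  assumes "sq_integrable f" "sq_integrable g"
  shows "sq_integrable (\<lambda>x. f x + g x)"
proof -
  have f: "f \<in> borel_measurable lebesgue" "integrable lebesgue (\<lambda>x. (cmod (f x))\<^sup>2)"
    and g: "g \<in> borel_measurable lebesgue" "integrable lebesgue (\<lambda>x. (cmod (g x))\<^sup>2)"
    using assms by (auto simp: sq_integrable_def)
  have le: "(cmod (a + b))\<^sup>2 \<le> 2 * (cmod a)\<^sup>2 + 2 * (cmod b)\<^sup>2" for a b :: complex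
  proof -
    have "(cmod (a + b))\<^sup>2 \<le> (cmod a + cmod b)\<^sup>2"
      by (intro power_mono norm_triangle_ineq norm_ge_zero)
    also have "\<dots> \<le> 2 * (cmod a)\<^sup>2 + 2 * (cmod b)\<^sup>2"
      using zero_le_power2[of "cmod a - cmod b"] by (simp add: power2_eq_square algebra_simps)
    finally show ?thesis .
  qed
  have "integrable lebesgue (\<lambda>x. (cmod (f x + g x))\<^sup>2)"
  proof (rule Bochner_Integration.integrable_bound)
    show "integrable lebesgue (\<lambda>x. 2 * (cmod (f x))\<^sup>2 + 2 * (cmod (g x))\<^sup>2)"
      using f g by auto
    show "(\<lambda>x. (cmod (f x + g x))\<^sup>2) \<in> borel_measurable lebesgue"
      using f(1) g(1) by measurable
    show "AE x in lebesgue. norm ((cmod (f x + g x))\<^sup>2)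
            \<le> norm (2 * (cmod (f x))\<^sup>2 + 2 * (cmod (g x))\<^sup>2)"
      using le by (intro AE_I2) simp
  qed
  with f(1) g(1) show ?thesis
    by (auto simp: sq_integrable_def)
qed

lemma sq_integrable_mult: "sq_integrable f \<Longrightarrow> sq_integrable (\<lambda>x. c * f x)"
  by (auto simp: sq_integrable_def norm_mult power_mult_distrib)

definition L2_rel ::
    "('a :: euclidean_space \<Rightarrow> complex) \<Rightarrow> ('a \<Rightarrow> complex) \<Rightarrow> bool" where
  "L2_rel f g \<longleftrightarrow> sq_integrable f \<and> sq_integrable g \<and> (AE x in lebesgue. f x = g x)"

text \<open>
  Elements are classes of functions modulo equality almost everywhere; \<open>rep_L2 f\<close> is some
  representative of the class \<open>f\<close>.
\<close>

quotient_type (overloaded) 'a L2 = "'a :: euclidean_space \<Rightarrow> complex" / partial: L2_rel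
proof (rule part_equivpI)
  show "\<exists>f :: 'a \<Rightarrow> complex. L2_rel f f"
    using sq_integrable_zero by (auto simp: L2_rel_def)
  show "symp (L2_rel :: ('a \<Rightarrow> complex) \<Rightarrow> _)"
    by (rule sympI) (auto simp: L2_rel_def elim: AE_mp)
  show "transp (L2_rel :: ('a \<Rightarrow> complex) \<Rightarrow> _)"
  proof (rule transpI)
    fix f g h :: "'a \<Rightarrow> complex"
    assume "L2_rel f g" "L2_rel g h"
    moreover from this have "AE x in lebesgue. f x = g x" "AE x in lebesgue. g x = h x"
      by (auto simp: L2_rel_def)
    then have "AE x in lebesgue. f x = h x" by eventually_elim simp
    ultimately show "L2_rel f h" by (auto simp: L2_rel_def)
  qed
qed

instantiation L2 :: (euclidean_space) complex_vector
begin

lift_definition zero_L2 :: "'a L2" is "\<lambda>x. 0"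
  by (simp add: L2_rel_def sq_integrable_zero)

lift_definition plus_L2 :: "'a L2 \<Rightarrow> 'a L2 \<Rightarrow> 'a L2" is "\<lambda>f g x. f x + g x"
  by (auto simp: L2_rel_def intro: sq_integrable_add)

lift_definition scaleC_L2 :: "complex \<Rightarrow> 'a L2 \<Rightarrow> 'a L2" is "\<lambda>c f x. c * f x"
  by (auto simp: L2_rel_def intro: sq_integrable_mult)

lift_definition uminus_L2 :: "'a L2 \<Rightarrow> 'a L2" is "\<lambda>f x. - f x"
  by (auto simp: L2_rel_def sq_integrable_def)

definition minus_L2 :: "'a L2 \<Rightarrow> 'a L2 \<Rightarrow> 'a L2" where
  "minus_L2 f g = f + - g"

instance
proof
  fix f g h :: "'a L2" and c d :: complex
  show "f + g + h = f + (g + h)"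
    by transfer (auto simp: L2_rel_def add.assoc intro!: sq_integrable_add)
  show "f + g = g + f"
    by transfer (auto simp: L2_rel_def add.commute intro!: sq_integrable_add)
  show "0 + f = f"
    by transfer (auto simp: L2_rel_def)
  show "- f + f = 0"
    by transfer (auto simp: L2_rel_def sq_integrable_zero)
  show "f - g = f + - g"
    by (fact minus_L2_def)
  show "c *\<^sub>C (f + g) = c *\<^sub>C f + c *\<^sub>C g"
    by transfer
      (auto simp: L2_rel_def distrib_left intro!: sq_integrable_add sq_integrable_mult)
  show "(c + d) *\<^sub>C f = c *\<^sub>C f + d *\<^sub>C f"
    by transfer
      (auto simp: L2_rel_def distrib_right intro!: sq_integrable_add sq_integrable_mult)
  show "c *\<^sub>C d *\<^sub>C f = (c * d) *\<^sub>C f"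
    by transfer (auto simp: L2_rel_def mult.assoc intro!: sq_integrable_mult)
  show "1 *\<^sub>C f = f"
    by transfer (auto simp: L2_rel_def)
qed

end

definition real_valued :: "'a :: euclidean_space L2 \<Rightarrow> bool" where
  "real_valued f \<longleftrightarrow> (AE x in lebesgue. rep_L2 f x \<in> \<real>)"

definition L2_inner :: "'a :: euclidean_space L2 \<Rightarrow> 'a L2 \<Rightarrow> complex" where
  "L2_inner f g = (LINT x|lebesgue. rep_L2 f x * cnj (rep_L2 g x))"

definition L2_norm :: "'a :: euclidean_space L2 \<Rightarrow> real" where
  "L2_norm f = sqrt (LINT x|lebesgue. (cmod (rep_L2 f x))\<^sup>2)"

text \<open>The space \<open>L\<^sup>2(\<real>\<^sup>d; \<complex>\<^sup>2)\<close> is represented by the product \<open>'a L2 \<times> 'a L2\<close>.\<close>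

definition L2_inner2 ::
    "'a :: euclidean_space L2 \<times> 'a L2 \<Rightarrow> 'a L2 \<times> 'a L2 \<Rightarrow> complex" where
  "L2_inner2 f g = L2_inner (fst f) (fst g) + L2_inner (snd f) (snd g)"


section \<open>Weak derivatives\<close>

definition partial_deriv ::
    "'a :: euclidean_space \<Rightarrow> ('a \<Rightarrow> real) \<Rightarrow> 'a \<Rightarrow> real" where
  "partial_deriv b \<psi> x = frechet_derivative \<psi> (at x) b"

primrec C_k :: "nat \<Rightarrow> ('a :: euclidean_space \<Rightarrow> real) \<Rightarrow> bool" where
  "C_k 0 \<psi> \<longleftrightarrow> continuous_on UNIV \<psi>"
| "C_k (Suc k) \<psi> \<longleftrightarrow> \<psi> differentiable_on UNIV \<and> (\<forall>b\<in>Basis. C_k k (partial_deriv b \<psi>))"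

definition test_function :: "('a :: euclidean_space \<Rightarrow> real) \<Rightarrow> bool" where
  "test_function \<psi> \<longleftrightarrow> (\<forall>k. C_k k \<psi>) \<and> compact (closure {x. \<psi> x \<noteq> 0})"

definition is_weak_deriv ::
    "'a :: euclidean_space \<Rightarrow> 'a L2 \<Rightarrow> 'a L2 \<Rightarrow> bool" where
  "is_weak_deriv b f g \<longleftrightarrow> (\<forall>\<psi>. test_function \<psi> \<longrightarrow>
     (LINT x|lebesgue. rep_L2 f x * of_real (partial_deriv b \<psi> x)) =
     - (LINT x|lebesgue. rep_L2 g x * of_real (\<psi> x)))"

definition H1 :: "'a :: euclidean_space L2 set" where
  "H1 = {f. \<forall>b\<in>Basis. \<exists>g. is_weak_deriv b f g}"

definition weak_deriv :: "'a :: euclidean_space \<Rightarrow> 'a L2 \<Rightarrow> 'a L2" where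
  "weak_deriv b f = (THE g. is_weak_deriv b f g)"


section \<open>Unbounded operators\<close>

text \<open>
  An unbounded operator is identified with its graph. The operations \<open>O\<close>, \<open>^^\<close> and converse on
  relations then give products, powers and inverses with their natural domains.
\<close>

definition op_null :: "('v :: zero \<times> 'w :: zero) set \<Rightarrow> 'v set" where
  "op_null T = {v. (v, 0) \<in> T}"

text \<open>Meaningful only for single-valued \<open>T\<close> and \<open>v\<close> in its domain.\<close>

definition op_app :: "('v \<times> 'w) set \<Rightarrow> 'v \<Rightarrow> 'w" where
  "op_app T v = (THE w. (v, w) \<in> T)"

text \<open>
  The operator associated with a sesquilinear form \<open>a\<close> with form domain \<open>D\<close>, with respect to
  the inner product \<open>ip\<close>.
\<close>

definition associated_operator ::
    "('v \<Rightarrow> 'v \<Rightarrow> complex) \<Rightarrow> 'v set \<Rightarrow> ('v \<Rightarrow> 'v \<Rightarrow> complex) \<Rightarrow> ('v \<times> 'v) set" where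
  "associated_operator ip D a = {(f, h). f \<in> D \<and> (\<forall>g\<in>D. a f g = ip h g)}"

definition positive_definite :: "'v :: zero set \<Rightarrow> ('v \<Rightarrow> 'v \<Rightarrow> complex) \<Rightarrow> bool" where
  "positive_definite D a \<longleftrightarrow> (\<forall>f\<in>D. f \<noteq> 0 \<longrightarrow> a f f \<in> \<real> \<and> Re (a f f) > 0)"


section \<open>The two-component condensate\<close>

definition locally_integrable :: "('a :: euclidean_space \<Rightarrow> real) \<Rightarrow> bool" where
  "locally_integrable V \<longleftrightarrow> (\<forall>K. compact K \<longrightarrow> set_integrable lebesgue K V)"

definition X1 :: "('a :: euclidean_space \<Rightarrow> real) \<Rightarrow> 'a L2 set" where
  "X1 V = {f \<in> H1. integrable lebesgue (\<lambda>x. V x * (cmod (rep_L2 f x))\<^sup>2)}"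

definition X :: "('a :: euclidean_space \<Rightarrow> real) \<Rightarrow> ('a L2 \<times> 'a L2) set" where
  "X V = X1 V \<times> X1 V"

text \<open>
  The integrals below are Bochner integrals, which are \<open>0\<close> by convention for a non-integrable
  integrand. On \<open>X\<close> every integrand is integrable, since \<open>H\<^sup>1 \<subseteq> L\<^sup>4\<close> in dimension at most 3.
\<close>

definition grad_sq :: "'a :: euclidean_space L2 \<Rightarrow> 'a \<Rightarrow> real" where
  "grad_sq f x = (\<Sum>b\<in>Basis. (cmod (rep_L2 (weak_deriv b f) x))\<^sup>2)"

definition energy :: "('a :: euclidean_space \<Rightarrow> real) \<Rightarrow> real \<Rightarrow> real^2^2 \<Rightarrow>
    'a L2 \<times> 'a L2 \<Rightarrow> real" where
  "energy V \<delta> \<beta> \<Phi> =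
    (let \<phi>1 = fst \<Phi>; \<phi>2 = snd \<Phi>;
         n1 = (\<lambda>x. (cmod (rep_L2 \<phi>1 x))\<^sup>2); n2 = (\<lambda>x. (cmod (rep_L2 \<phi>2 x))\<^sup>2)
     in LINT x|lebesgue.
          (1/2 * grad_sq \<phi>1 x + V x * n1 x) + (1/2 * grad_sq \<phi>2 x + V x * n2 x)
          + (\<beta>$1$1 / 2 * n1 x * n1 x + \<beta>$1$2 / 2 * n1 x * n2 x
             + \<beta>$2$1 / 2 * n2 x * n1 x + \<beta>$2$2 / 2 * n2 x * n2 x)
          + \<delta> / 2 * (n1 x - n2 x))"

definition ground_state :: "('a :: euclidean_space \<Rightarrow> real) \<Rightarrow> real \<Rightarrow> real^2^2 \<Rightarrow> real \<Rightarrow>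
    'a L2 \<times> 'a L2 \<Rightarrow> bool" where
  "ground_state V \<delta> \<beta> \<alpha> \<Phi> \<longleftrightarrow>
     is_arg_min (energy V \<delta> \<beta>)
       (\<lambda>\<Psi>. \<Psi> \<in> X V \<and> (L2_norm (fst \<Psi>))\<^sup>2 = \<alpha> \<and> (L2_norm (snd \<Psi>))\<^sup>2 = 1 - \<alpha>) \<Phi>"

definition mult_form ::
    "('a :: euclidean_space \<Rightarrow> complex) \<Rightarrow> 'a L2 \<Rightarrow> 'a L2 \<Rightarrow> complex" where
  "mult_form W f g = (LINT x|lebesgue. W x * rep_L2 f x * cnj (rep_L2 g x))"

text \<open>The form of the differential expression \<open>-\<nabla>\<^sup>2/2 + W\<close>.\<close>

definition schroedinger_form ::
    "('a :: euclidean_space \<Rightarrow> complex) \<Rightarrow> 'a L2 \<Rightarrow> 'a L2 \<Rightarrow> complex" where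
  "schroedinger_form W f g =
     1/2 * (\<Sum>b\<in>Basis. L2_inner (weak_deriv b f) (weak_deriv b g)) + mult_form W f g"

text \<open>
  The Euler--Lagrange equations \<open>\<mu>\<^sub>j \<phi>\<^sub>j = [\<dots>] \<phi>\<^sub>j\<close>, the bracket being understood
  as the operator associated with its form.
\<close>

definition chemical_potentials :: "('a :: euclidean_space \<Rightarrow> real) \<Rightarrow> real \<Rightarrow> real^2^2 \<Rightarrow>
    'a L2 \<times> 'a L2 \<Rightarrow> real \<Rightarrow> real \<Rightarrow> bool" where
  "chemical_potentials V \<delta> \<beta> \<Phi> \<mu>1 \<mu>2 \<longleftrightarrow>
    (let \<phi>1 = fst \<Phi>; \<phi>2 = snd \<Phi>;
         n1 = (\<lambda>x. (cmod (rep_L2 \<phi>1 x))\<^sup>2); n2 = (\<lambda>x. (cmod (rep_L2 \<phi>2 x))\<^sup>2)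
     in (\<phi>1, of_real \<mu>1 *\<^sub>C \<phi>1) \<in> associated_operator L2_inner (X1 V) (schroedinger_form
           (\<lambda>x. of_real (V x + \<delta> / 2 + \<beta>$1$1 * n1 x + \<beta>$1$2 * n2 x))) \<and>
        (\<phi>2, of_real \<mu>2 *\<^sub>C \<phi>2) \<in> associated_operator L2_inner (X1 V) (schroedinger_form
           (\<lambda>x. of_real (V x - \<delta> / 2 + \<beta>$2$1 * n1 x + \<beta>$2$2 * n2 x))))"

definition form_A :: "('a :: euclidean_space \<Rightarrow> real) \<Rightarrow> real \<Rightarrow> real^2^2 \<Rightarrow> real \<Rightarrow> real \<Rightarrow>
    'a L2 \<times> 'a L2 \<Rightarrow> 'a L2 \<times> 'a L2 \<Rightarrow> 'a L2 \<times> 'a L2 \<Rightarrow> complex" where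
  "form_A V \<delta> \<beta> \<mu>1 \<mu>2 \<Phi> f g =
    (let \<phi>1 = rep_L2 (fst \<Phi>); \<phi>2 = rep_L2 (snd \<Phi>);
         L1 = schroedinger_form (\<lambda>x. of_real (V x + \<delta> / 2)
                + of_real (2 * \<beta>$1$1) * (\<phi>1 x)\<^sup>2 + of_real (\<beta>$1$2) * (\<phi>2 x)\<^sup>2 - of_real \<mu>1);
         L2 = schroedinger_form (\<lambda>x. of_real (V x - \<delta> / 2)
                + of_real (\<beta>$2$1) * (\<phi>1 x)\<^sup>2 + of_real (2 * \<beta>$2$2) * (\<phi>2 x)\<^sup>2 - of_real \<mu>2)
     in L1 (fst f) (fst g)
        + mult_form (\<lambda>x. of_real (\<beta>$1$2) * \<phi>1 x * \<phi>2 x) (snd f) (fst g)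
        + mult_form (\<lambda>x. of_real (\<beta>$2$1) * \<phi>1 x * \<phi>2 x) (fst f) (snd g)
        + L2 (snd f) (snd g))"

definition form_B :: "real^2^2 \<Rightarrow> 'a :: euclidean_space L2 \<times> 'a L2 \<Rightarrow>
    'a L2 \<times> 'a L2 \<Rightarrow> 'a L2 \<times> 'a L2 \<Rightarrow> complex" where
  "form_B \<beta> \<Phi> f g =
    (let \<phi>1 = rep_L2 (fst \<Phi>); \<phi>2 = rep_L2 (snd \<Phi>)
     in mult_form (\<lambda>x. of_real (\<beta>$1$1) * (\<phi>1 x)\<^sup>2) (fst f) (fst g)
        + mult_form (\<lambda>x. of_real (\<beta>$1$2) * \<phi>1 x * \<phi>2 x) (snd f) (fst g)
        + mult_form (\<lambda>x. of_real (\<beta>$2$1) * \<phi>1 x * \<phi>2 x) (fst f) (snd g)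
        + mult_form (\<lambda>x. of_real (\<beta>$2$2) * (\<phi>2 x)\<^sup>2) (snd f) (snd g))"

definition form_plus :: "('a :: euclidean_space \<Rightarrow> real) \<Rightarrow> real \<Rightarrow> real^2^2 \<Rightarrow> real \<Rightarrow> real \<Rightarrow>
    'a L2 \<times> 'a L2 \<Rightarrow> 'a L2 \<times> 'a L2 \<Rightarrow> 'a L2 \<times> 'a L2 \<Rightarrow> complex" where
  "form_plus V \<delta> \<beta> \<mu>1 \<mu>2 \<Phi> f g = form_A V \<delta> \<beta> \<mu>1 \<mu>2 \<Phi> f g + form_B \<beta> \<Phi> f g"

definition form_minus :: "('a :: euclidean_space \<Rightarrow> real) \<Rightarrow> real \<Rightarrow> real^2^2 \<Rightarrow> real \<Rightarrow> real \<Rightarrow>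
    'a L2 \<times> 'a L2 \<Rightarrow> 'a L2 \<times> 'a L2 \<Rightarrow> 'a L2 \<times> 'a L2 \<Rightarrow> complex" where
  "form_minus V \<delta> \<beta> \<mu>1 \<mu>2 \<Phi> f g = form_A V \<delta> \<beta> \<mu>1 \<mu>2 \<Phi> f g - form_B \<beta> \<Phi> f g"

definition H_plus :: "('a :: euclidean_space \<Rightarrow> real) \<Rightarrow> real \<Rightarrow> real^2^2 \<Rightarrow> real \<Rightarrow> real \<Rightarrow>
    'a L2 \<times> 'a L2 \<Rightarrow> (('a L2 \<times> 'a L2) \<times> ('a L2 \<times> 'a L2)) set" where
  "H_plus V \<delta> \<beta> \<mu>1 \<mu>2 \<Phi> =
     associated_operator L2_inner2 (X V) (form_plus V \<delta> \<beta> \<mu>1 \<mu>2 \<Phi>)"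

definition H_minus :: "('a :: euclidean_space \<Rightarrow> real) \<Rightarrow> real \<Rightarrow> real^2^2 \<Rightarrow> real \<Rightarrow> real \<Rightarrow>
    'a L2 \<times> 'a L2 \<Rightarrow> (('a L2 \<times> 'a L2) \<times> ('a L2 \<times> 'a L2)) set" where
  "H_minus V \<delta> \<beta> \<mu>1 \<mu>2 \<Phi> =
     associated_operator L2_inner2 (X V) (form_minus V \<delta> \<beta> \<mu>1 \<mu>2 \<Phi>)"

definition off_diagonal :: "('v \<times> 'v) set \<Rightarrow> ('v \<times> 'v) set \<Rightarrow> (('v \<times> 'v) \<times> ('v \<times> 'v)) set" where
  "off_diagonal S T = {((f, g), (u, v)). (g, u) \<in> S \<and> (f, v) \<in> T}"

end

theory Submission
  imports Defs "HOL-Complex_Analysis.Great_Picard" "HOL-Computational_Algebra.Polynomial"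
begin

text \<open>
  The algebra is short. Since \<open>H\<^sub>+\<close> is injective, \<open>null(H\<^sup>2)\<close> consists of the pairs \<open>(f, g)\<close> with
  \<open>g \<in> null(H\<^sub>-)\<close> and \<open>H\<^sub>+ f \<in> null(H\<^sub>-)\<close>. A pair in \<open>null(H\<^sup>3)\<close> gives \<open>u = H\<^sub>- g\<close> with
  \<open>H\<^sub>+ u \<in> null(H\<^sub>-)\<close>, so \<open>\<langle>H\<^sub>+ u, u\<rangle> = 0\<close> because \<open>H\<^sub>-\<close> is symmetric, and \<open>u = 0\<close>.

  The substance is the solvability of \<open>H\<^sub>+ f = \<Phi>\<^sub>j\<close>. A positive form with compact form domain is
  coercive: along a normalised sequence with \<open>a(f\<^sub>n, f\<^sub>n) \<rightarrow> 0\<close> the parallelogram law turns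
  convergence in \<open>L\<^sup>2\<close> into convergence in the form norm. Minimisation of \<open>a(f, f) - 2 Re \<langle>\<Phi>\<^sub>j, f\<rangle>\<close>
  then yields the solution. Compactness of the embedding and the bound of the terms
  \<open>\<beta>\<^sub>j\<^sub>l \<phi>\<^sub>j \<phi>\<^sub>l\<close> by the gradient both rest on the averages \<open>E\<^sub>k f\<close> over dyadic cubes of side
  \<open>2\<^sup>-\<^sup>k\<close>, for which \<open>|E\<^sub>k\<^sub>+\<^sub>1 f - E\<^sub>k f|\<^sup>2 \<le> C 4\<^sup>-\<^sup>k E\<^sub>k |\<nabla>f|\<^sup>2\<close> pointwise. The increments are therefore
  summable in \<open>L\<^sup>2\<close>, and also in \<open>L\<^sup>4\<close> as long as \<open>d < 4\<close>.
\<close>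

section \<open>The Hilbert space structure of square integrable functions\<close>

text \<open>All analysis starts from the bare definition of a weak derivative as an identity against
  test functions. Cube averages suit it because they involve \<open>f\<close> only through integrals
  over boxes: test functions close to indicators of boxes turn the identity into a bound for the
  difference of the integrals over two translated boxes, and \<open>f\<close> itself is never
  approximated by smooth functions. The dimension enters through |D|^4 = |D|^2 |D|^2 for an
  increment D. One factor is bounded by its supremum, at the price 2^(kd) of the inverse cube
  volume, the other in L2; each brings 4^(-k), and 2^(k(d-4)) remains. The numbers \<beta> may have
  either sign, so a bound of the L4 norm by the H1 norm with some constant is too weak: the gradient
  must come with an arbitrarily small constant for the kinetic energy to absorb the interaction.
  Starting the telescoping sum at a high level provides it. The variational argument is real: it
  uses the real parts of the form and of the inner product. Testing with
  \<open>\<i> *\<^sub>C g\<close> and hermiticity of the form recover the complex identity.\<close>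

lemma L2_rel_rep: "L2_rel (rep_L2 f) (rep_L2 f)"
  using Quotient3_rep_reflp[OF Quotient3_L2] .

lemma sq_integrable_rep: "sq_integrable (rep_L2 f)"
  using L2_rel_rep[of f] by (simp add: L2_rel_def)

lemma rep_measurable [measurable]: "rep_L2 f \<in> borel_measurable lebesgue"
  using sq_integrable_rep[of f] by (simp add: sq_integrable_def)

lemma integrable_rep_sq: "integrable lebesgue (\<lambda>x. (cmod (rep_L2 f x))\<^sup>2)"
  using sq_integrable_rep[of f] by (simp add: sq_integrable_def)

lemma rep_abs_L2: "sq_integrable F \<Longrightarrow> AE x in lebesgue. rep_L2 (abs_L2 F) x = F x"
  using Quotient3_rep_abs[OF Quotient3_L2, of F] by (simp add: L2_rel_def)

lemma L2_eqI: "AE x in lebesgue. rep_L2 f x = rep_L2 g x \<Longrightarrow> f = g"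
  using Quotient3_rel_rep[OF Quotient3_L2, of f g] sq_integrable_rep unfolding L2_rel_def by blast

lemma rep_zero: "AE x in lebesgue. rep_L2 0 x = 0"
  using rep_abs_L2[OF sq_integrable_zero] by (simp add: zero_L2_def)

lemma rep_plus: "AE x in lebesgue. rep_L2 (f + g) x = rep_L2 f x + rep_L2 g x"
  using rep_abs_L2[OF sq_integrable_add[OF sq_integrable_rep[of f] sq_integrable_rep[of g]]]
  by (simp add: plus_L2_def)

lemma rep_scaleC: "AE x in lebesgue. rep_L2 (c *\<^sub>C f) x = c * rep_L2 f x"
  using rep_abs_L2[OF sq_integrable_mult[OF sq_integrable_rep[of f]]]
  by (simp add: scaleC_L2_def)

lemma scaleC_minus_one: "(-1) *\<^sub>C f = - (f :: 'a :: complex_vector)"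
proof -
  have "(-1) *\<^sub>C f + f = ((-1) + 1) *\<^sub>C f" by (simp only: scaleC_add_left scaleC_one)
  moreover have "(0::complex) *\<^sub>C f + 0 *\<^sub>C f = 0 *\<^sub>C f"
    by (metis scaleC_add_left add.right_neutral)
  ultimately show ?thesis by (simp add: eq_neg_iff_add_eq_0)
qed

lemma rep_uminus: "AE x in lebesgue. rep_L2 (- f) x = - rep_L2 f x"
  using rep_scaleC[of "-1" f] by (simp add: scaleC_minus_one)

lemma rep_minus: "AE x in lebesgue. rep_L2 (f - g) x = rep_L2 f x - rep_L2 g x"
  using rep_plus[of f "-g"] rep_uminus[of g] by eventually_elim simp

lemma sq_integrable_mult_integrable:
  assumes "sq_integrable f" "sq_integrable g"
  shows "integrable lebesgue (\<lambda>x. f x * g x)"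
proof (rule Bochner_Integration.integrable_bound)
  show "integrable lebesgue (\<lambda>x. (cmod (f x))\<^sup>2 + (cmod (g x))\<^sup>2)"
    using assms by (simp add: sq_integrable_def)
  show "(\<lambda>x. f x * g x) \<in> borel_measurable lebesgue"
    using assms by (auto simp: sq_integrable_def)
  show "AE x in lebesgue. norm (f x * g x) \<le> norm ((cmod (f x))\<^sup>2 + (cmod (g x))\<^sup>2)"
  proof (intro AE_I2)
    fix x
    have "2 * (cmod (f x) * cmod (g x)) \<le> (cmod (f x))\<^sup>2 + (cmod (g x))\<^sup>2"
      using zero_le_power2[of "cmod (f x) - cmod (g x)"] by (simp add: power2_eq_square algebra_simps)
    then show "norm (f x * g x) \<le> norm ((cmod (f x))\<^sup>2 + (cmod (g x))\<^sup>2)"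
      by (simp add: norm_mult) (smt (verit) mult_nonneg_nonneg norm_ge_zero)
  qed
qed

lemma measurable_cnj [measurable (raw)]:
  "f \<in> borel_measurable M \<Longrightarrow> (\<lambda>x. cnj (f x)) \<in> borel_measurable M"
  by (rule borel_measurable_continuous_on[where f=cnj]) (intro continuous_intros, simp_all)

lemma sq_integrable_cnj: "sq_integrable f \<Longrightarrow> sq_integrable (\<lambda>x. cnj (f x))"
proof -
  assume f: "sq_integrable f"
  have "(\<lambda>x. cnj (f x)) \<in> borel_measurable lebesgue"
    using f by (intro borel_measurable_continuous_on[where f=cnj] continuous_intros)
      (auto simp: sq_integrable_def)
  with f show ?thesis by (simp add: sq_integrable_def)
qed

lemma sq_integrable_bound:
  assumes "sq_integrable g" "f \<in> borel_measurable lebesgue"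
    and "AE x in lebesgue. cmod (f x) \<le> cmod (g x)"
  shows "sq_integrable f"
  unfolding sq_integrable_def
proof
  show "integrable lebesgue (\<lambda>x. (cmod (f x))\<^sup>2)"
  proof (rule Bochner_Integration.integrable_bound)
    show "integrable lebesgue (\<lambda>x. (cmod (g x))\<^sup>2)" using assms by (simp add: sq_integrable_def)
    show "(\<lambda>x. (cmod (f x))\<^sup>2) \<in> borel_measurable lebesgue" using assms by measurable
    show "AE x in lebesgue. norm ((cmod (f x))\<^sup>2) \<le> norm ((cmod (g x))\<^sup>2)"
      using assms(3) by eventually_elim (simp add: power_mono)
  qed
qed fact

lemma integrable_inner_rep: "integrable lebesgue (\<lambda>x. rep_L2 f x * cnj (rep_L2 g x))"
  by (intro sq_integrable_mult_integrable sq_integrable_cnj sq_integrable_rep)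

lemma L2_inner_add_left: "L2_inner (f + g) h = L2_inner f h + L2_inner g h"
proof -
  have "L2_inner (f + g) h
      = (LINT x|lebesgue. rep_L2 f x * cnj (rep_L2 h x) + rep_L2 g x * cnj (rep_L2 h x))"
    unfolding L2_inner_def
  proof (rule integral_cong_AE)
    show "AE x in lebesgue. rep_L2 (f + g) x * cnj (rep_L2 h x)
        = rep_L2 f x * cnj (rep_L2 h x) + rep_L2 g x * cnj (rep_L2 h x)"
      using rep_plus[of f g] by eventually_elim (simp add: algebra_simps)
  qed (auto intro!: borel_measurable_integrable integrable_inner_rep Bochner_Integration.integrable_add)
  then show ?thesis
    by (simp add: L2_inner_def integrable_inner_rep)
qed

lemma L2_inner_scaleC_left: "L2_inner (c *\<^sub>C f) h = c * L2_inner f h"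
proof -
  have "L2_inner (c *\<^sub>C f) h = (LINT x|lebesgue. c * (rep_L2 f x * cnj (rep_L2 h x)))"
    unfolding L2_inner_def
  proof (rule integral_cong_AE)
    show "AE x in lebesgue. rep_L2 (c *\<^sub>C f) x * cnj (rep_L2 h x)
        = c * (rep_L2 f x * cnj (rep_L2 h x))"
      using rep_scaleC[of c f] by eventually_elim (simp add: algebra_simps)
  qed (auto intro!: borel_measurable_integrable integrable_inner_rep integrable_mult_right)
  then show ?thesis
    by (simp add: L2_inner_def)
qed

lemma L2_inner_commute: "L2_inner g f = cnj (L2_inner f g)"
proof -
  have "cnj (L2_inner f g) = (LINT x|lebesgue. cnj (rep_L2 f x * cnj (rep_L2 g x)))"
    unfolding L2_inner_def by (rule Bochner_Integration.integral_cnj[symmetric])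
  then show ?thesis by (simp add: L2_inner_def mult.commute)
qed

lemma L2_inner_self: "L2_inner f f = of_real (LINT x|lebesgue. (cmod (rep_L2 f x))\<^sup>2)"
proof -
  have "L2_inner f f = (LINT x|lebesgue. complex_of_real ((cmod (rep_L2 f x))\<^sup>2))"
    unfolding L2_inner_def by (simp only: complex_norm_square)
  then show ?thesis by (simp del: of_real_power)
qed

instantiation L2 :: (euclidean_space) real_vector
begin

definition scaleR_L2 :: "real \<Rightarrow> 'a L2 \<Rightarrow> 'a L2" where
  "scaleR_L2 r f = of_real r *\<^sub>C f"

instance
  by standard
    (simp_all add: scaleR_L2_def scaleC_add_right scaleC_add_left scaleC_scaleC scaleC_one)

end

text \<open>The real part of the Hermitian product induces the same norm and makes the classes a
  \<open>real_inner\<close> type, so that limits, Cauchy sequences and the abstract variational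
  argument apply to them. The complex product survives as \<open>L2_inner\<close>.\<close>

instantiation L2 :: (euclidean_space) real_inner
begin

definition inner_L2 :: "'a L2 \<Rightarrow> 'a L2 \<Rightarrow> real" where
  "inner_L2 f g = Re (L2_inner f g)"

definition norm_L2 :: "'a L2 \<Rightarrow> real" where
  "norm_L2 f = L2_norm f"

definition dist_L2 :: "'a L2 \<Rightarrow> 'a L2 \<Rightarrow> real" where
  "dist_L2 f g = norm (f - g)"

definition sgn_L2 :: "'a L2 \<Rightarrow> 'a L2" where
  "sgn_L2 f = f /\<^sub>R norm f"

definition uniformity_L2 :: "('a L2 \<times> 'a L2) filter" where
  "uniformity_L2 = (INF e\<in>{0<..}. principal {(x, y). dist x y < e})"

definition open_L2 :: "'a L2 set \<Rightarrow> bool" where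
  "open_L2 U = (\<forall>x\<in>U. eventually (\<lambda>(x', y). x' = x \<longrightarrow> y \<in> U) uniformity)"

instance
proof
  fix f g h :: "'a L2" and r :: real and U :: "'a L2 set"
  show "dist f g = norm (f - g)" "sgn f = f /\<^sub>R norm f"
    "uniformity = (INF e\<in>{0<..}. principal {(x::'a L2, y). dist x y < e})"
    "open U = (\<forall>x\<in>U. eventually (\<lambda>(x', y). x' = x \<longrightarrow> y \<in> U) uniformity)"
    by (simp_all only: dist_L2_def sgn_L2_def uniformity_L2_def open_L2_def)
  show "inner f g = inner g f"
    using L2_inner_commute[of g f] by (simp add: inner_L2_def)
  show "inner (f + g) h = inner f h + inner g h" "inner (r *\<^sub>R f) g = r * inner f g"
    by (simp_all add: inner_L2_def scaleR_L2_def L2_inner_add_left L2_inner_scaleC_left)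
  show "0 \<le> inner f f" by (simp add: inner_L2_def L2_inner_self)
  have "inner f f = 0 \<longleftrightarrow> (AE x in lebesgue. rep_L2 f x = 0)"
    by (simp add: inner_L2_def L2_inner_self integral_nonneg_eq_0_iff_AE integrable_rep_sq)
  also have "\<dots> \<longleftrightarrow> f = 0"
  proof
    assume "AE x in lebesgue. rep_L2 f x = 0"
    with rep_zero have "AE x in lebesgue. rep_L2 f x = rep_L2 0 x"
      by eventually_elim simp
    then show "f = 0" by (rule L2_eqI)
  qed (use rep_zero in simp)
  finally show "inner f f = 0 \<longleftrightarrow> f = 0" .
  show "norm f = sqrt (inner f f)"
    by (simp add: norm_L2_def L2_norm_def inner_L2_def L2_inner_self)
qed

end

lemma norm_L2_sq: "(norm f)\<^sup>2 = (LINT x|lebesgue. (cmod (rep_L2 f x))\<^sup>2)"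
  by (simp add: norm_L2_def L2_norm_def)

lemma norm_abs_L2_sq:
  assumes "sq_integrable F"
  shows "(norm (abs_L2 F))\<^sup>2 = (LINT x|lebesgue. (cmod (F x))\<^sup>2)"
  unfolding norm_L2_sq
proof (rule integral_cong_AE)
  show "AE x in lebesgue. (cmod (rep_L2 (abs_L2 F) x))\<^sup>2 = (cmod (F x))\<^sup>2"
    using rep_abs_L2[OF assms] by eventually_elim simp
qed (use assms in \<open>auto simp: sq_integrable_def\<close>)

text \<open>The moduli of \<open>f\<close> and \<open>g\<close> are themselves passed to the
  quotient, so that the abstract inequality bounds the integral of |f||g| and not merely the modulus
  of an integral.\<close>

lemma sq_integrable_Cauchy_Schwarz:
  fixes f g :: "'a :: euclidean_space \<Rightarrow> complex"
  assumes "sq_integrable f" "sq_integrable g"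
  shows "(LINT x|lebesgue. cmod (f x) * cmod (g x))
    \<le> sqrt (LINT x|lebesgue. (cmod (f x))\<^sup>2) * sqrt (LINT x|lebesgue. (cmod (g x))\<^sup>2)"
proof -
  let ?a = "\<lambda>h. abs_L2 (\<lambda>x. complex_of_real (cmod (h x)))"
  have sq: "sq_integrable (\<lambda>x. complex_of_real (cmod (h x)))" if "sq_integrable h" for h :: "'a \<Rightarrow> complex"
    using that by (auto simp: sq_integrable_def)
  have "(LINT x|lebesgue. cmod (f x) * cmod (g x)) = Re (L2_inner (?a f) (?a g))"
  proof -
    have "L2_inner (?a f) (?a g) = (LINT x|lebesgue. complex_of_real (cmod (f x) * cmod (g x)))"
      unfolding L2_inner_def
    proof (rule integral_cong_AE)
      show "AE x in lebesgue. rep_L2 (?a f) x * cnj (rep_L2 (?a g) x)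
          = complex_of_real (cmod (f x) * cmod (g x))"
        using rep_abs_L2[OF sq[OF assms(1)]] rep_abs_L2[OF sq[OF assms(2)]]
        by eventually_elim simp
    qed (use assms in \<open>auto simp: sq_integrable_def intro!: borel_measurable_times
        rep_measurable measurable_cnj\<close>)
    then show ?thesis by (simp del: of_real_mult)
  qed
  also have "\<dots> = inner (?a f) (?a g)" by (simp add: inner_L2_def)
  also have "\<dots> \<le> norm (?a f) * norm (?a g)" by (rule norm_cauchy_schwarz)
  also have "\<dots> = sqrt (LINT x|lebesgue. (cmod (f x))\<^sup>2) * sqrt (LINT x|lebesgue. (cmod (g x))\<^sup>2)"
  proof -
    have "norm (?a h) = sqrt (LINT x|lebesgue. (cmod (h x))\<^sup>2)" if "sq_integrable h" for h :: "'a \<Rightarrow> complex"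
      using norm_abs_L2_sq[OF sq[OF that]] by (metis (no_types, lifting) Bochner_Integration.integral_cong
          abs_norm_cancel norm_of_real norm_ge_zero real_sqrt_unique)
    then show ?thesis using assms by simp
  qed
  finally show ?thesis .
qed

text \<open>Fatou's lemma for |F n|^2: pointwise convergence and a uniform bound suffice, so the
  limit need not be known to be square integrable beforehand. Both the L2 norm and the potential
  energy are later carried to limits in this way.\<close>

lemma L2_bound_by_Fatou:
  fixes f :: "'a :: euclidean_space \<Rightarrow> complex"
  assumes meas: "f \<in> borel_measurable lebesgue" "\<And>n. sq_integrable (F n)"
    and lim: "AE x in lebesgue. (\<lambda>n. F n x) \<longlonglongrightarrow> f x"
    and bd: "\<And>n. (LINT x|lebesgue. (cmod (F n x))\<^sup>2) \<le> B"
  shows "sq_integrable f" "(LINT x|lebesgue. (cmod (f x))\<^sup>2) \<le> B"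
proof -
  have mF [measurable]: "F n \<in> borel_measurable lebesgue" for n
    using meas(2)[of n] by (simp add: sq_integrable_def)
  note [measurable] = meas(1)
  have "(\<integral>\<^sup>+x. ennreal ((cmod (f x))\<^sup>2) \<partial>lebesgue)
      = (\<integral>\<^sup>+x. liminf (\<lambda>n. ennreal ((cmod (F n x))\<^sup>2)) \<partial>lebesgue)"
  proof (rule nn_integral_cong_AE)
    show "AE x in lebesgue. ennreal ((cmod (f x))\<^sup>2) = liminf (\<lambda>n. ennreal ((cmod (F n x))\<^sup>2))"
      using lim
    proof eventually_elim
      case (elim x)
      then have "(\<lambda>n. ennreal ((cmod (F n x))\<^sup>2)) \<longlonglongrightarrow> ennreal ((cmod (f x))\<^sup>2)"
        by (intro tendsto_intros) auto
      then show ?case by (metis lim_imp_Liminf sequentially_bot)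
    qed
  qed
  also have "\<dots> \<le> liminf (\<lambda>n. \<integral>\<^sup>+x. ennreal ((cmod (F n x))\<^sup>2) \<partial>lebesgue)"
    by (rule nn_integral_liminf) measurable
  also have "\<dots> \<le> ennreal B"
  proof -
    have "(\<integral>\<^sup>+x. ennreal ((cmod (F n x))\<^sup>2) \<partial>lebesgue) \<le> ennreal B" for n
      using meas(2)[of n] bd[of n] by (subst nn_integral_eq_integral) (auto simp: sq_integrable_def intro: ennreal_leI)
    then show ?thesis by (intro Liminf_le) auto
  qed
  finally have *: "(\<integral>\<^sup>+x. ennreal ((cmod (f x))\<^sup>2) \<partial>lebesgue) \<le> ennreal B" .
  then have "(\<integral>\<^sup>+x. ennreal ((cmod (f x))\<^sup>2) \<partial>lebesgue) < \<infinity>"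
    using ennreal_less_top le_less_trans by (metis infinity_ennreal_def)
  then show sq: "sq_integrable f"
    unfolding sq_integrable_def by (auto intro!: integrableI_nonneg)
  have "0 \<le> B" using bd[of 0] by (smt (verit) integral_nonneg_AE AE_I2 zero_le_power2)
  then show "(LINT x|lebesgue. (cmod (f x))\<^sup>2) \<le> B"
    using * sq by (subst (asm) nn_integral_eq_integral) (auto simp: sq_integrable_def ennreal_le_iff)
qed

text \<open>A fast subsequence has increments with \<open>\<Sum> 2\<^sup>n |d\<^sub>n|\<^sup>2 < \<infinity>\<close> almost everywhere.\<close>

lemma Cauchy_AE_subseq:
  fixes F :: "nat \<Rightarrow> 'a :: euclidean_space L2"
  assumes "Cauchy F"
  obtains r f where "strict_mono (r :: nat \<Rightarrow> nat)" "f \<in> borel_measurable lebesgue"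
    "AE x in lebesgue. (\<lambda>n. rep_L2 (F (r n)) x) \<longlonglongrightarrow> f x"
proof -
  have "\<exists>M. \<forall>m\<ge>M. \<forall>k\<ge>M. norm (F m - F k) < (1/2)^n" for n
    using assms unfolding Cauchy_iff by (meson zero_less_power half_gt_zero zero_less_one)
  then obtain M where M: "\<And>n m k. m \<ge> M n \<Longrightarrow> k \<ge> M n \<Longrightarrow> norm (F m - F k) < (1/2)^n" by metis
  \<comment> \<open>Keeping \<open>r n\<close> above \<open>M n\<close> makes the n-th increment
    smaller than 2^(-n); the entry \<open>Suc p\<close> makes \<open>r\<close> strictly
    increasing.\<close>
  define r where "r = rec_nat (M 0) (\<lambda>n p. max (M (Suc n)) (Suc p))"
  have r0: "r n \<ge> M n" for n by (cases n) (auto simp: r_def)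
  have rS: "r n < r (Suc n)" for n by (auto simp: r_def)
  then have sm: "strict_mono r" by (simp add: strict_mono_Suc_iff)
  define d where "d = (\<lambda>n x. rep_L2 (F (r (Suc n))) x - rep_L2 (F (r n)) x)"
  have [measurable]: "d n \<in> borel_measurable lebesgue" for n unfolding d_def by measurable
  \<comment> \<open>The squared increments have size 4^(-n), so the weight 2^n still leaves a
    summable series; the weight is spent below on a pointwise geometric rate.\<close>
  have int_d: "(\<integral>\<^sup>+x. ennreal (2^n * (cmod (d n x))\<^sup>2) \<partial>lebesgue) \<le> ennreal ((1/2)^n)" for n
  proof -
    have "(\<integral>\<^sup>+x. ennreal (2^n * (cmod (d n x))\<^sup>2) \<partial>lebesgue)
        = (\<integral>\<^sup>+x. ennreal (2^n * (cmod (rep_L2 (F (r (Suc n)) - F (r n)) x))\<^sup>2) \<partial>lebesgue)"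
      using rep_minus[of "F (r (Suc n))" "F (r n)"]
      by (intro nn_integral_cong_AE) (auto simp: d_def elim: AE_mp)
    also have "\<dots> = ennreal (2^n * (norm (F (r (Suc n)) - F (r n)))\<^sup>2)"
      by (subst nn_integral_eq_integral) (auto intro: integrable_rep_sq simp: norm_L2_sq)
    also have "\<dots> \<le> ennreal (2^n * ((1/2)^n)\<^sup>2)"
      using M[OF order.trans[OF r0 less_imp_le[OF rS]] r0, of n]
      by (intro ennreal_leI mult_left_mono power_mono) auto
    also have "2^n * ((1/2)^n)\<^sup>2 = ((1/2::real)^n)"
      by (simp add: power2_eq_square power_mult_distrib[symmetric] mult.assoc[symmetric])
    finally show ?thesis .
  qed
  have "(\<integral>\<^sup>+x. (\<Sum>n. ennreal (2^n * (cmod (d n x))\<^sup>2)) \<partial>lebesgue)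
      = (\<Sum>n. \<integral>\<^sup>+x. ennreal (2^n * (cmod (d n x))\<^sup>2) \<partial>lebesgue)"
    by (rule nn_integral_suminf) measurable
  also have "\<dots> \<le> (\<Sum>n. ennreal ((1/2)^n))"
    by (intro suminf_le int_d) auto
  also have "\<dots> = ennreal (\<Sum>n. (1/2)^n)"
    by (rule suminf_ennreal2) (auto intro: summable_geometric)
  also have "\<dots> < \<infinity>" by (simp only: infinity_ennreal_def ennreal_less_top)
  finally have fin: "(\<integral>\<^sup>+x. (\<Sum>n. ennreal (2^n * (cmod (d n x))\<^sup>2)) \<partial>lebesgue) \<noteq> \<infinity>"
    by (rule less_imp_neq)
  have "AE x in lebesgue. (\<Sum>n. ennreal (2^n * (cmod (d n x))\<^sup>2)) \<noteq> \<infinity>"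
  proof (rule nn_integral_PInf_AE[OF _ fin])
    show "(\<lambda>x. \<Sum>n. ennreal (2^n * (cmod (d n x))\<^sup>2)) \<in> borel_measurable lebesgue"
      by (intro borel_measurable_suminf_order) measurable
  qed
  then have conv: "AE x in lebesgue. convergent (\<lambda>n. rep_L2 (F (r n)) x)"
  proof eventually_elim
    case (elim x)
    define e where "e = (\<lambda>n. ennreal (2^n * (cmod (d n x))\<^sup>2))"
    define C where "C = enn2real (suminf e)"
    have C0: "0 \<le> C" unfolding C_def by (rule enn2real_nonneg)
    have eC: "suminf e = ennreal C"
      using elim unfolding C_def e_def[symmetric] by (simp add: less_top)
    have le: "2^n * (cmod (d n x))\<^sup>2 \<le> C" for n
    proof -
      have "e n \<le> suminf e"
        using sum_le_suminf[OF summableI, of "{n}" e] by simp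
      then have "ennreal (2^n * (cmod (d n x))\<^sup>2) \<le> ennreal C" unfolding eC by (simp only: e_def)
      then show ?thesis using C0 by (simp only: ennreal_le_iff)
    qed
    \<comment> \<open>A finite weighted sum \<open>C\<close> bounds each of its terms, so the
      increments at \<open>x\<close> decay like 2^(-n/2) and their series converges
      absolutely.\<close>
    have "cmod (d n x) \<le> sqrt C * (1 / sqrt 2)^n" for n
    proof (rule power2_le_imp_le)
      have "(1 / sqrt 2)\<^sup>2 = (1/2 :: real)" by (simp add: power_divide)
      then have "((1 / sqrt 2)^n)\<^sup>2 = (1/2 :: real)^n" by (simp only: power_mult[symmetric] mult.commute[of n 2] power_mult)
      then show "(cmod (d n x))\<^sup>2 \<le> (sqrt C * (1 / sqrt 2)^n)\<^sup>2"
        using le[of n] C0 by (simp add: power_mult_distrib field_simps)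
    qed (use C0 in simp)
    moreover have "summable (\<lambda>n. sqrt C * (1 / sqrt 2)^n)"
      by (intro summable_mult summable_geometric) auto
    ultimately have "summable (\<lambda>n. d n x)"
      using summable_comparison_test'[where N=0 and f="\<lambda>n. d n x"] by blast
    then have "convergent (\<lambda>n. \<Sum>i<n. d i x)" by (simp add: summable_iff_convergent)
    then have "convergent (\<lambda>n. rep_L2 (F (r 0)) x + (\<Sum>i<n. d i x))"
      by (intro convergent_add convergent_const)
    moreover have "rep_L2 (F (r 0)) x + (\<Sum>i<n. d i x) = rep_L2 (F (r n)) x" for n
      using sum_lessThan_telescope[of "\<lambda>n. rep_L2 (F (r n)) x" n] by (simp add: d_def)
    ultimately show ?case by (simp only:)
  qed
  show thesis
  proof (rule that[OF sm])
    show "(\<lambda>x. lim (\<lambda>n. rep_L2 (F (r n)) x)) \<in> borel_measurable lebesgue" by measurable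
    show "AE x in lebesgue. (\<lambda>n. rep_L2 (F (r n)) x) \<longlonglongrightarrow> lim (\<lambda>n. rep_L2 (F (r n)) x)"
      using conv by eventually_elim (simp add: convergent_LIMSEQ_iff)
  qed
qed

text \<open>The limit along a fast subsequence is at first only a measurable function. Fatou's lemma
  with the index \<open>m\<close> held fixed shows that \<open>f - F m\<close> is square integrable,
  hence so is \<open>f\<close>, and that the whole sequence converges to the class of
  \<open>f\<close>.\<close>

instance L2 :: (euclidean_space) complete_space
proof
  fix F :: "nat \<Rightarrow> 'a L2"
  assume C: "Cauchy F"
  obtain r f where rf: "strict_mono (r :: nat \<Rightarrow> nat)" "f \<in> borel_measurable lebesgue"
    "AE x in lebesgue. (\<lambda>n. rep_L2 (F (r n)) x) \<longlonglongrightarrow> f x"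
    using Cauchy_AE_subseq[OF C] .
  note [measurable] = rf(2)
  have key: "sq_integrable (\<lambda>x. f x - rep_L2 (F m) x)
      \<and> (LINT x|lebesgue. (cmod (f x - rep_L2 (F m) x))\<^sup>2) \<le> e\<^sup>2"
    if M: "\<And>n m. n \<ge> M \<Longrightarrow> m \<ge> M \<Longrightarrow> norm (F n - F m) \<le> e" and m: "m \<ge> M" and e: "e \<ge> 0" for m M e
  proof -
    have "AE x in lebesgue. \<forall>n. rep_L2 (F (r (n + M)) - F m) x = rep_L2 (F (r (n + M))) x - rep_L2 (F m) x"
      by (subst AE_all_countable) (auto intro: rep_minus)
    with rf(3) have *: "AE x in lebesgue. (\<lambda>n. rep_L2 (F (r (n + M)) - F m) x) \<longlonglongrightarrow> f x - rep_L2 (F m) x"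
    proof eventually_elim
      case (elim x)
      from elim(1) have "(\<lambda>n. rep_L2 (F (r (n + M))) x) \<longlonglongrightarrow> f x" by (rule LIMSEQ_ignore_initial_segment)
      then show ?case using elim(2) by (auto intro!: tendsto_intros)
    qed
    have "(LINT x|lebesgue. (cmod (rep_L2 (F (r (n + M)) - F m) x))\<^sup>2) \<le> e\<^sup>2" for n
    proof -
      have "r (n + M) \<ge> M" using strict_mono_imp_increasing[OF rf(1), of "n + M"] by linarith
      then show ?thesis unfolding norm_L2_sq[symmetric] using M[of "r (n + M)" m] m e by (intro power_mono) auto
    qed
    then show ?thesis
      using L2_bound_by_Fatou[OF _ sq_integrable_rep *, of "e\<^sup>2"] by auto
  qed
  obtain M1 where "\<And>n m. n \<ge> M1 \<Longrightarrow> m \<ge> M1 \<Longrightarrow> norm (F n - F m) \<le> 1"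
    using C unfolding Cauchy_iff by (meson zero_less_one less_imp_le)
  then have "sq_integrable (\<lambda>x. f x - rep_L2 (F M1) x)" using key[of M1 1 M1] by simp
  from sq_integrable_add[OF this sq_integrable_rep[of "F M1"]] have sf: "sq_integrable f" by simp
  have "F \<longlonglongrightarrow> abs_L2 f"
  proof (rule LIMSEQ_I)
    fix e :: real assume e: "e > 0"
    then obtain M where M: "\<And>n m. n \<ge> M \<Longrightarrow> m \<ge> M \<Longrightarrow> norm (F n - F m) \<le> e / 2"
      using C unfolding Cauchy_iff by (meson half_gt_zero less_imp_le)
    have "norm (F n - abs_L2 f) < e" if "n \<ge> M" for n
    proof -
      have "(norm (F n - abs_L2 f))\<^sup>2 = (norm (abs_L2 f - F n))\<^sup>2" by (simp add: norm_minus_commute)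
      also have "\<dots> = (LINT x|lebesgue. (cmod (f x - rep_L2 (F n) x))\<^sup>2)"
        unfolding norm_L2_sq
      proof (rule integral_cong_AE)
        show "AE x in lebesgue. (cmod (rep_L2 (abs_L2 f - F n) x))\<^sup>2 = (cmod (f x - rep_L2 (F n) x))\<^sup>2"
          using rep_minus[of "abs_L2 f" "F n"] rep_abs_L2[OF sf] by eventually_elim simp
      qed measurable
      also have "\<dots> \<le> (e/2)\<^sup>2" using key[OF M that] e by auto
      finally have "norm (F n - abs_L2 f) \<le> e / 2" by (rule power2_le_imp_le) (use e in simp)
      then show ?thesis using e by simp
    qed
    then show "\<exists>M. \<forall>n\<ge>M. norm (F n - abs_L2 f) < e" by blast
  qed
  then show "convergent F" by (rule convergentI)
qed

text \<open>Norm convergence is L1 convergence of the squared differences to 0, which yields an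
  almost everywhere convergent subsequence. It connects limits in the space with later uses of
  Fatou's lemma.\<close>

lemma L2_tendsto_AE_subseq:
  fixes F :: "nat \<Rightarrow> 'a :: euclidean_space L2"
  assumes "F \<longlonglongrightarrow> f"
  obtains r where "strict_mono (r :: nat \<Rightarrow> nat)"
    "AE x in lebesgue. (\<lambda>n. rep_L2 (F (r n)) x) \<longlonglongrightarrow> rep_L2 f x"
proof -
  have "\<And>n. integrable lebesgue (\<lambda>x. (cmod (rep_L2 (F n - f) x))\<^sup>2)" by (rule integrable_rep_sq)
  moreover have "(\<lambda>n. (norm (F n - f))\<^sup>2) \<longlonglongrightarrow> 0"
    using assms by (auto intro!: tendsto_eq_intros tendsto_norm_zero simp: LIM_zero_iff)
  then have "(\<lambda>n. LINT x|lebesgue. norm ((cmod (rep_L2 (F n - f) x))\<^sup>2)) \<longlonglongrightarrow> 0"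
    by (simp add: norm_L2_sq)
  ultimately obtain r where r: "strict_mono (r :: nat \<Rightarrow> nat)"
      "AE x in lebesgue. (\<lambda>n. (cmod (rep_L2 (F (r n) - f) x))\<^sup>2) \<longlonglongrightarrow> 0"
    using tendsto_L1_AE_subseq[of lebesgue "\<lambda>n x. (cmod (rep_L2 (F n - f) x))\<^sup>2"] by blast
  have "AE x in lebesgue. \<forall>n. rep_L2 (F (r n) - f) x = rep_L2 (F (r n)) x - rep_L2 f x"
    by (subst AE_all_countable) (auto intro: rep_minus)
  with r(2) have "AE x in lebesgue. (\<lambda>n. rep_L2 (F (r n)) x) \<longlonglongrightarrow> rep_L2 f x"
  proof eventually_elim
    case (elim x)
    from tendsto_real_sqrt[OF elim(1)] have "(\<lambda>n. cmod (rep_L2 (F (r n)) x - rep_L2 f x)) \<longlonglongrightarrow> 0"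
      using elim(2) by simp
    then show ?case by (simp add: tendsto_norm_zero_iff LIM_zero_iff)
  qed
  with r(1) that show thesis by blast
qed

section \<open>Smooth functions of product form\<close>

text \<open>The one-variable counterpart of \<open>C_k\<close>, with the derivative existentially
  quantified: closure under sums, products and affine substitution then follows by exhibiting a
  derivative.\<close>

primrec smooth_k :: "nat \<Rightarrow> (real \<Rightarrow> real) \<Rightarrow> bool" where
  "smooth_k 0 h \<longleftrightarrow> continuous_on UNIV h"
| "smooth_k (Suc k) h \<longleftrightarrow> (\<exists>h'. (\<forall>x. (h has_real_derivative h' x) (at x)) \<and> smooth_k k h')"

lemma smooth_k_SucD: "smooth_k (Suc k) h \<Longrightarrow> smooth_k k h"
proof (induction k arbitrary: h)
  case 0
  then show ?case
    by (metis DERIV_isCont continuous_at_imp_continuous_on smooth_k.simps)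
next
  case (Suc k)
  then obtain h' where "\<forall>x. (h has_real_derivative h' x) (at x)" "smooth_k (Suc k) h'"
    by (auto simp del: smooth_k.simps simp add: smooth_k.simps(2)[of "Suc k"])
  with Suc.IH[of h'] show ?case by auto
qed

lemma smooth_k_const: "smooth_k k (\<lambda>x. c)"
  by (induction k arbitrary: c) (auto intro!: exI[of _ "\<lambda>x. 0"])

lemma smooth_k_add: "smooth_k k f \<Longrightarrow> smooth_k k g \<Longrightarrow> smooth_k k (\<lambda>x. f x + g x)"
proof (induction k arbitrary: f g)
  case 0
  then show ?case by (auto intro: continuous_on_add)
next
  case (Suc k)
  then obtain f' g' where "\<forall>x. (f has_real_derivative f' x) (at x)" "smooth_k k f'"
    "\<forall>x. (g has_real_derivative g' x) (at x)" "smooth_k k g'" by auto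
  with Suc.IH[of f' g'] show ?case
    by (auto intro!: exI[of _ "\<lambda>x. f' x + g' x"] DERIV_add)
qed

lemma smooth_k_mult: "smooth_k k f \<Longrightarrow> smooth_k k g \<Longrightarrow> smooth_k k (\<lambda>x. f x * g x)"
proof (induction k arbitrary: f g)
  case 0
  then show ?case by (auto intro: continuous_on_mult)
next
  case (Suc k)
  then obtain f' g' where fg: "\<forall>x. (f has_real_derivative f' x) (at x)" "smooth_k k f'"
    "\<forall>x. (g has_real_derivative g' x) (at x)" "smooth_k k g'" by auto
  have "smooth_k k f" "smooth_k k g" using Suc.prems smooth_k_SucD by blast+
  then have "smooth_k k (\<lambda>x. f' x * g x + g' x * f x)"
    using fg Suc.IH by (intro smooth_k_add) auto
  then show ?case
    using fg by (auto intro!: exI[of _ "\<lambda>x. f' x * g x + g' x * f x"] DERIV_mult)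
qed

lemma smooth_k_diff: "smooth_k k f \<Longrightarrow> smooth_k k g \<Longrightarrow> smooth_k k (\<lambda>x. f x - g x)"
  using smooth_k_add[of k f "\<lambda>x. (-1) * g x"] smooth_k_mult[OF smooth_k_const[of k "-1"], of g]
  by simp

lemma smooth_k_affine: "smooth_k k h \<Longrightarrow> smooth_k k (\<lambda>x. h (c * x + d))"
proof (induction k arbitrary: h)
  case 0
  then show ?case by (auto intro!: continuous_on_compose2[of UNIV h] continuous_intros)
next
  case (Suc k)
  then obtain h' where h': "\<forall>x. (h has_real_derivative h' x) (at x)" "smooth_k k h'" by auto
  have "((\<lambda>x. h (c * x + d)) has_real_derivative c * h' (c * x + d)) (at x)" for x
  proof -
    have "((\<lambda>x. c * x + d) has_real_derivative c) (at x)" by (auto intro!: derivative_eq_intros)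
    from DERIV_chain2[OF h'(1)[rule_format] this] show ?thesis by (simp only: mult.commute)
  qed
  moreover have "smooth_k k (\<lambda>x. c * h' (c * x + d))"
    by (intro smooth_k_mult smooth_k_const Suc.IH h')
  ultimately show ?case by (auto intro!: exI[of _ "\<lambda>x. c * h' (c * x + d)"])
qed

section \<open>A smooth step built from exp(-1/x)\<close>

definition flat :: "real poly \<Rightarrow> real \<Rightarrow> real" where
  "flat p x = (if x > 0 then poly p (1 / x) * exp (- (1 / x)) else 0)"

lemma poly_exp_tendsto_0: "((\<lambda>y::real. poly q y * exp (- y)) \<longlongrightarrow> 0) at_top"
proof -
  have "((\<lambda>y. \<Sum>i\<le>degree q. coeff q i * (y ^ i / exp y)) \<longlongrightarrow> (\<Sum>i\<le>degree q. coeff q i * 0)) at_top"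
    by (intro tendsto_intros tendsto_power_div_exp_0)
  moreover have "poly q y * exp (- y) = (\<Sum>i\<le>degree q. coeff q i * (y ^ i / exp y))" for y
    by (simp add: poly_altdef sum_distrib_right exp_minus divide_inverse mult.assoc)
  ultimately show ?thesis by simp
qed

text \<open>Differentiating p(1/x) exp(-1/x) gives x^(-2) (p - p')(1/x) exp(-1/x), and the factor
  x^(-2) is the polynomial \<open>[:0, 0, 1:]\<close> in 1/x. The family is thus closed under
  differentiation, which makes every member smooth.\<close>

lemma flat_deriv:
  "(flat p has_real_derivative flat ([:0, 0, 1:] * (p - pderiv p)) x) (at x)"
proof -
  consider "x > 0" | "x < 0" | "x = 0" by linarith
  then show ?thesis
  proof cases
    case 1
    have "((\<lambda>x. poly p (1 / x) * exp (- (1 / x))) has_real_derivative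
        flat ([:0, 0, 1:] * (p - pderiv p)) x) (at x)"
      using 1 unfolding flat_def
      by (auto intro!: derivative_eq_intros poly_DERIV[THEN DERIV_chain2]
          simp: field_simps power2_eq_square)
    then show ?thesis
    proof (rule has_field_derivative_transform_within_open[where S="{0<..}"])
      show "x \<in> {0<..}" using 1 by simp
    qed (auto simp: flat_def)
  next
    case 2
    have "((\<lambda>x. 0) has_real_derivative flat ([:0, 0, 1:] * (p - pderiv p)) x) (at x)"
      using 2 by (simp add: flat_def)
    then show ?thesis
    proof (rule has_field_derivative_transform_within_open[where S="{..<0}"])
      show "x \<in> {..<0}" using 2 by simp
    qed (auto simp: flat_def)
  next
    case 3
    \<comment> \<open>In the variable y = 1/h, division by h multiplies the polynomial by y, which
      is what \<open>pCons 0 p\<close> expresses.\<close>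
    have "((\<lambda>h. poly (pCons 0 p) (inverse h) * exp (- inverse h)) \<longlongrightarrow> 0) (at_right 0)"
      using poly_exp_tendsto_0[of "pCons 0 p"] filterlim_inverse_at_top_right
      by (rule filterlim_compose)
    then have R: "((\<lambda>h. flat p h / h) \<longlongrightarrow> 0) (at_right 0)"
    proof (rule Lim_transform_eventually)
      show "\<forall>\<^sub>F h in at_right 0. poly (pCons 0 p) (inverse h) * exp (- inverse h) = flat p h / h"
        using eventually_at_right_less[of "0::real"]
        by eventually_elim (simp add: flat_def field_simps)
    qed
    have L: "((\<lambda>h. flat p h / h) \<longlongrightarrow> 0) (at_left 0)"
    proof (rule Lim_transform_eventually[OF tendsto_const])
      show "\<forall>\<^sub>F h in at_left 0. 0 = flat p h / h"
        using eventually_at_left_real[of "-1::real" 0]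
        by (auto simp: flat_def elim!: eventually_mono)
    qed
    have "((\<lambda>h. (flat p (0 + h) - flat p 0) / h) \<longlongrightarrow> 0) (at 0)"
      using R L by (simp add: filterlim_split_at flat_def[of p 0])
    then show ?thesis using 3 by (simp add: DERIV_def flat_def[of _ 0])
  qed
qed

lemma smooth_k_flat: "smooth_k k (flat p)"
proof (induction k arbitrary: p)
  case 0
  show ?case using flat_deriv
    by (metis DERIV_isCont continuous_at_imp_continuous_on smooth_k.simps(1))
next
  case (Suc k)
  then show ?case using flat_deriv by auto
qed

lemma antiderivative_real:
  fixes h :: "real \<Rightarrow> real"
  assumes "continuous_on UNIV h"
  obtains F where "\<And>x. (F has_real_derivative h x) (at x)"
  using einterval_antiderivative[of "-\<infinity>" \<infinity> h] assms
  by (auto simp: continuous_on_eq_continuous_at has_real_derivative_iff_has_vector_derivative)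

text \<open>A primitive of a bump that is positive exactly on (0, 1), normalised by its total
  increase: monotone because the bump is nonnegative, constant on either side because the bump
  vanishes there.\<close>

lemma smooth_step:
  obtains \<sigma> :: "real \<Rightarrow> real" where "\<And>k. smooth_k k \<sigma>" "mono \<sigma>"
    "\<And>x. x \<le> 0 \<Longrightarrow> \<sigma> x = 0" "\<And>x. x \<ge> 1 \<Longrightarrow> \<sigma> x = 1"
proof -
  define w where "w = (\<lambda>x. flat 1 x * flat 1 ((-1) * x + 1))"
  have w_smooth: "smooth_k k w" for k
    unfolding w_def by (intro smooth_k_mult smooth_k_affine smooth_k_flat)
  have w0: "w x \<ge> 0" "x \<le> 0 \<Longrightarrow> w x = 0" "x \<ge> 1 \<Longrightarrow> w x = 0" "0 < x \<Longrightarrow> x < 1 \<Longrightarrow> w x > 0" for x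
    by (auto simp: w_def flat_def)
  obtain F where F: "\<And>x. (F has_real_derivative w x) (at x)"
    using antiderivative_real[of w] w_smooth[of 0] by auto
  have mvt: "\<exists>z. x < z \<and> z < y \<and> F y - F x = (y - x) * w z" if "x < y" for x y
    using MVT2[OF that, of F w] F by blast
  have FL: "F x = F 0" if "x \<le> 0" for x
    using mvt[of x 0] w0(2) that by (cases "x = 0") force+
  have FR: "F x = F 1" if "x \<ge> 1" for x
    using mvt[of 1 x] w0(3) that by (cases "x = 1") force+
  have d: "F 1 - F 0 > 0" using mvt[of 0 1] w0(4) by force
  have mono: "F x \<le> F y" if "x \<le> y" for x y
    using DERIV_nonneg_imp_nondecreasing[OF that, of F] F w0(1) by blast
  have smooth: "smooth_k k F" for k
    using smooth_k_SucD[of k F] F w_smooth[of k] by auto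
  define \<sigma> where "\<sigma> = (\<lambda>x. (F x - F 0) * (1 / (F 1 - F 0)))"
  show thesis
  proof (rule that[of \<sigma>])
    show "smooth_k k \<sigma>" for k
      unfolding \<sigma>_def by (rule smooth_k_mult[OF smooth_k_diff[OF smooth smooth_k_const] smooth_k_const])
    show "mono \<sigma>"
      unfolding \<sigma>_def using mono d by (intro monoI mult_right_mono diff_right_mono) auto
    show "\<sigma> x = 0" if "x \<le> 0" for x using FL[OF that] by (simp add: \<sigma>_def)
    show "\<sigma> x = 1" if "x \<ge> 1" for x using FR[OF that] d by (simp add: \<sigma>_def)
  qed
qed

definition eps :: "nat \<Rightarrow> real" where
  "eps n = 1 / real (Suc n)"

lemma eps_pos: "0 < eps n" and eps_le_1: "eps n \<le> 1" and eps_Suc_le: "eps (Suc n) \<le> eps n"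
  by (auto simp: eps_def field_simps)

lemma eps_small: "x > 0 \<Longrightarrow> \<exists>n. eps n < x"
  unfolding eps_def by (meson nat_approx_posE)

text \<open>The overhang \<open>eps n\<close> lies on the left and there is none on the right. The
  approximants can therefore converge at every point, end points included, to the indicator of the
  half-open interval; half-open boxes are the ones that tile the space.\<close>

definition interval_approx :: "real \<Rightarrow> real \<Rightarrow> (nat \<Rightarrow> real \<Rightarrow> real) \<Rightarrow> bool" where
  "interval_approx a c \<eta> \<longleftrightarrow>
    (\<forall>n k. smooth_k k (\<eta> n)) \<and> (\<forall>n s. 0 \<le> \<eta> n s \<and> \<eta> n s \<le> 1) \<and>
    (\<forall>n s. s \<notin> {a - eps n..<c} \<longrightarrow> \<eta> n s = 0) \<and>
    (\<forall>s. (\<lambda>n. \<eta> n s) \<longlonglongrightarrow> indicator {a..<c} s)"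

lemma interval_approxD:
  assumes "interval_approx a c \<eta>"
  shows "smooth_k k (\<eta> n)" "0 \<le> \<eta> n s" "\<eta> n s \<le> 1"
    "s \<notin> {a - eps n..<c} \<Longrightarrow> \<eta> n s = 0" "(\<lambda>n. \<eta> n s) \<longlonglongrightarrow> indicator {a..<c} s"
  using assms unfolding interval_approx_def by blast+

lemma smooth_indicator_approx:
  assumes "a < c"
  shows "\<exists>\<eta>. interval_approx a c \<eta>"
proof -
  obtain \<sigma> :: "real \<Rightarrow> real" where s: "\<And>k. smooth_k k \<sigma>" "mono \<sigma>"
    "\<And>x. x \<le> 0 \<Longrightarrow> \<sigma> x = 0" "\<And>x. x \<ge> 1 \<Longrightarrow> \<sigma> x = 1" using smooth_step by blast
  have s01: "0 \<le> \<sigma> x" "\<sigma> x \<le> 1" for x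
    using monoD[OF s(2), of "min x 0" x] monoD[OF s(2), of x "max x 1"] s(3,4) by auto
  \<comment> \<open>This step rises on [p - \<open>eps n\<close>, p] and has the value 1 from
    \<open>p\<close> on; its argument is arranged as c * s + d to match
    \<open>smooth_k_affine\<close>.\<close>
  define \<theta> where "\<theta> = (\<lambda>n p s. \<sigma> (real (Suc n) * s + (1 - real (Suc n) * p)))"
  have arg: "real (Suc n) * s + (1 - real (Suc n) * p) = real (Suc n) * (s - p) + 1" for n s p
    by (simp add: algebra_simps)
  have lim: "(\<lambda>n. \<theta> n p s) \<longlonglongrightarrow> indicator {p..} s" for p s
  proof (cases "p \<le> s")
    case True
    then have "\<theta> n p s = 1" for n unfolding \<theta>_def arg by (intro s) simp
    then show ?thesis using True by simp
  next
    case False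
    obtain M :: nat where M: "1 / real (Suc M) < p - s" using False nat_approx_posE[of "p - s"] by auto
    have "\<theta> n p s = 0" if "n \<ge> M" for n
    proof -
      have "1 / real (Suc n) \<le> 1 / real (Suc M)" using that by (intro divide_left_mono) auto
      then have "1 / real (Suc n) < p - s" using M by linarith
      then have "1 < real (Suc n) * (p - s)" by (simp add: field_simps)
      then show ?thesis unfolding \<theta>_def arg by (intro s) (simp add: algebra_simps)
    qed
    then have "\<forall>\<^sub>F n in sequentially. \<theta> n p s = 0" by (auto simp: eventually_sequentially)
    then show ?thesis using False by (auto intro: tendsto_eventually)
  qed
  show ?thesis
    unfolding interval_approx_def
  proof (intro exI[of _ "\<lambda>n s. \<theta> n a s - \<theta> n c s"] conjI allI impI)
    show "smooth_k k (\<lambda>s. \<theta> n a s - \<theta> n c s)" for k n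
      unfolding \<theta>_def by (intro smooth_k_diff smooth_k_affine s)
    show "0 \<le> \<theta> n a s - \<theta> n c s" for n s
    proof -
      have "real (Suc n) * (s - c) + 1 \<le> real (Suc n) * (s - a) + 1"
        using assms by (intro add_right_mono mult_left_mono) auto
      then show ?thesis unfolding \<theta>_def arg using monoD[OF s(2)] by simp
    qed
    show "\<theta> n a s - \<theta> n c s \<le> 1" for n s
      unfolding \<theta>_def by (smt (verit) s01)
    show "\<theta> n a s - \<theta> n c s = 0" if "s \<notin> {a - eps n..<c}" for n s
    proof (cases "s < c")
      case True
      then have "s - a < - (1 / real (Suc n))" using that by (auto simp: eps_def)
      then have *: "real (Suc n) * (s - a) + 1 \<le> 0" by (simp add: field_simps)
      have "real (Suc n) * (s - c) + 1 \<le> real (Suc n) * (s - a) + 1"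
        using assms by (intro add_right_mono mult_left_mono) auto
      with * have "real (Suc n) * (s - c) + 1 \<le> 0" by linarith
      with * show ?thesis unfolding \<theta>_def arg by (simp only: s diff_self)
    next
      case False
      then have "real (Suc n) * (s - c) \<ge> 0" "real (Suc n) * (s - a) \<ge> 0" using assms by auto
      then have "real (Suc n) * (s - c) + 1 \<ge> 1" "real (Suc n) * (s - a) + 1 \<ge> 1" by linarith+
      then show ?thesis unfolding \<theta>_def arg by (simp only: s diff_self)
    qed
    show "(\<lambda>n. \<theta> n a s - \<theta> n c s) \<longlonglongrightarrow> indicator {a..<c} s" for s
      using tendsto_diff[OF lim[of a s] lim[of c s]] assms by (auto simp: indicator_def split: if_splits)
  qed
qed

text \<open>For a primitive Z of \<eta>, the function \<zeta>(s) = Z(s - t) - Z(s) is minus the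
  integral of \<eta> over [s - t, s]. This explains the bound by \<open>t\<close> and the support,
  which grows by \<open>t\<close> on the right. It will be the factor of the test function in the
  direction of differentiation.\<close>

lemma smooth_translate_primitive:
  fixes \<eta> :: "real \<Rightarrow> real"
  assumes "\<And>k. smooth_k k \<eta>" "\<And>s. 0 \<le> \<eta> s" "\<And>s. \<eta> s \<le> 1"
    and supp: "\<And>s. s \<notin> {a..<c} \<Longrightarrow> \<eta> s = 0" and t: "t \<ge> 0"
  obtains \<zeta> where "\<And>k. smooth_k k \<zeta>" "\<And>s. (\<zeta> has_real_derivative \<eta> (s - t) - \<eta> s) (at s)"
    "\<And>s. \<bar>\<zeta> s\<bar> \<le> t" "\<And>s. s \<notin> {a..<c + t} \<Longrightarrow> \<zeta> s = 0"
proof -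
  obtain Z where Z: "\<And>x. (Z has_real_derivative \<eta> x) (at x)"
    using antiderivative_real[of \<eta>] assms(1)[of 0] by auto
  define \<zeta> where "\<zeta> = (\<lambda>s. Z (s - t) - Z s)"
  have mvt: "\<exists>z. s - t \<le> z \<and> z \<le> s \<and> (t = 0 \<or> s - t < z \<and> z < s) \<and> \<zeta> s = - (t * \<eta> z)" for s
  proof (cases "t = 0")
    case False
    then obtain z where "s - t < z" "z < s" "Z s - Z (s - t) = (s - (s - t)) * \<eta> z"
      using MVT2[of "s - t" s Z \<eta>] Z t by auto
    then show ?thesis by (intro exI[of _ z]) (simp add: \<zeta>_def)
  qed (auto simp: \<zeta>_def)
  have "smooth_k k Z" for k
    using smooth_k_SucD[of k Z] Z assms(1)[of k] by auto
  then have "smooth_k k (\<lambda>s. Z (1 * s + (- t)) - Z s)" for k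
    by (intro smooth_k_diff smooth_k_affine)
  then have "smooth_k k \<zeta>" for k by (simp add: \<zeta>_def)
  moreover have "(\<zeta> has_real_derivative \<eta> (s - t) - \<eta> s) (at s)" for s
  proof -
    have "((\<lambda>s. s - t) has_real_derivative 1) (at s)" by (auto intro!: derivative_eq_intros)
    from DERIV_diff[OF DERIV_chain2[OF Z this] Z] show ?thesis by (simp add: \<zeta>_def)
  qed
  moreover have "\<bar>\<zeta> s\<bar> \<le> t" for s
  proof -
    obtain z where "\<zeta> s = - (t * \<eta> z)" using mvt by blast
    then show ?thesis using assms(2,3)[of z] t by (simp add: abs_mult mult_left_le)
  qed
  moreover have "\<zeta> s = 0" if "s \<notin> {a..<c + t}" for s
  proof -
    obtain z where "s - t \<le> z" "z \<le> s" "t = 0 \<or> s - t < z \<and> z < s" "\<zeta> s = - (t * \<eta> z)"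
      using mvt by blast
    then show ?thesis using supp[of z] that by auto
  qed
  ultimately show thesis using that by blast
qed

section \<open>Products of one-variable functions as test functions\<close>

lemma prod_has_partial_deriv:
  fixes \<eta> \<eta>' :: "'a :: euclidean_space \<Rightarrow> real \<Rightarrow> real"
  assumes "\<And>i s. i \<in> Basis \<Longrightarrow> (\<eta> i has_real_derivative \<eta>' i s) (at s)"
  shows "(\<lambda>x. \<Prod>i\<in>Basis. \<eta> i (x \<bullet> i)) differentiable (at x)"
    and "b \<in> Basis \<Longrightarrow> partial_deriv b (\<lambda>x. \<Prod>i\<in>Basis. \<eta> i (x \<bullet> i)) x
      = (\<Prod>i\<in>Basis. (if i = b then \<eta>' i else \<eta> i) (x \<bullet> i))"
proof -
  have "((\<lambda>x. \<eta> i (x \<bullet> i)) has_derivative (\<lambda>y. \<eta>' i (x \<bullet> i) * (y \<bullet> i))) (at x)" if "i \<in> Basis" for i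
  proof -
    have "((\<lambda>x. x \<bullet> i) has_derivative (\<lambda>y. y \<bullet> i)) (at x)" by (auto intro!: derivative_eq_intros)
    from has_derivative_compose[OF this assms[OF that, of "x \<bullet> i", unfolded has_field_derivative_def]]
    show ?thesis .
  qed
  then have D: "((\<lambda>x. \<Prod>i\<in>Basis. \<eta> i (x \<bullet> i)) has_derivative
      (\<lambda>y. \<Sum>i\<in>Basis. (\<eta>' i (x \<bullet> i) * (y \<bullet> i)) * (\<Prod>j\<in>Basis - {i}. \<eta> j (x \<bullet> j)))) (at x)"
    by (intro has_derivative_prod)
  then show "(\<lambda>x. \<Prod>i\<in>Basis. \<eta> i (x \<bullet> i)) differentiable (at x)" by (rule differentiableI)
  assume b: "b \<in> Basis"
  have "partial_deriv b (\<lambda>x. \<Prod>i\<in>Basis. \<eta> i (x \<bullet> i)) x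
      = (\<Sum>i\<in>Basis. (\<eta>' i (x \<bullet> i) * (b \<bullet> i)) * (\<Prod>j\<in>Basis - {i}. \<eta> j (x \<bullet> j)))"
    by (simp only: partial_deriv_def frechet_derivative_at[OF D, symmetric])
  also have "\<dots> = (\<Sum>i\<in>Basis. if i = b then \<eta>' b (x \<bullet> b) * (\<Prod>j\<in>Basis - {b}. \<eta> j (x \<bullet> j)) else 0)"
    using b by (intro sum.cong) (auto simp: inner_Basis)
  also have "\<dots> = \<eta>' b (x \<bullet> b) * (\<Prod>j\<in>Basis - {b}. \<eta> j (x \<bullet> j))"
    using b by simp
  also have "\<dots> = (\<Prod>i\<in>Basis. (if i = b then \<eta>' i else \<eta> i) (x \<bullet> i))"
    using b by (subst prod.remove[of _ b]) (auto intro!: prod.cong)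
  finally show "partial_deriv b (\<lambda>x. \<Prod>i\<in>Basis. \<eta> i (x \<bullet> i)) x
      = (\<Prod>i\<in>Basis. (if i = b then \<eta>' i else \<eta> i) (x \<bullet> i))" .
qed

text \<open>A partial derivative of a product of one-variable factors is again such a product, with
  one factor differentiated. The induction therefore runs over all families \<eta> at once, and the
  remaining factors give up one order of smoothness.\<close>

lemma C_k_prod:
  fixes \<eta> :: "'a :: euclidean_space \<Rightarrow> real \<Rightarrow> real"
  assumes "\<And>i. i \<in> Basis \<Longrightarrow> smooth_k k (\<eta> i)"
  shows "C_k k (\<lambda>x. \<Prod>i\<in>Basis. \<eta> i (x \<bullet> i))"
  using assms
proof (induction k arbitrary: \<eta>)
  case 0
  have "continuous_on UNIV (\<lambda>x::'a. \<eta> i (x \<bullet> i))" if "i \<in> Basis" for i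
  proof (rule continuous_on_compose2[of UNIV "\<eta> i"])
    show "continuous_on UNIV (\<eta> i)" using 0 that by simp
  qed (auto intro: continuous_on_inner continuous_on_id continuous_on_const)
  then show ?case unfolding C_k.simps by (rule continuous_on_prod)
next
  case (Suc k)
  have "\<exists>h. \<forall>i\<in>Basis. (\<forall>x. (\<eta> i has_real_derivative h i x) (at x)) \<and> smooth_k k (h i)"
    using Suc.prems by (intro bchoice) auto
  then obtain \<eta>' where d: "\<And>i x. i \<in> Basis \<Longrightarrow> (\<eta> i has_real_derivative \<eta>' i x) (at x)"
    and s: "\<And>i. i \<in> Basis \<Longrightarrow> smooth_k k (\<eta>' i)" by blast
  note p = prod_has_partial_deriv[of \<eta> \<eta>', OF d]
  have "C_k k (partial_deriv b (\<lambda>x. \<Prod>i\<in>Basis. \<eta> i (x \<bullet> i)))" if b: "b \<in> Basis" for b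
  proof -
    have "partial_deriv b (\<lambda>x. \<Prod>i\<in>Basis. \<eta> i (x \<bullet> i))
        = (\<lambda>x. \<Prod>i\<in>Basis. (if i = b then \<eta>' i else \<eta> i) (x \<bullet> i))"
      using p(2) b by auto
    moreover have "C_k k (\<lambda>x::'a. \<Prod>i\<in>Basis. (if i = b then \<eta>' i else \<eta> i) (x \<bullet> i))"
      by (rule Suc.IH[of "\<lambda>i. if i = b then \<eta>' i else \<eta> i"])
        (simp add: s b smooth_k_SucD[OF Suc.prems])
    ultimately show ?thesis by (simp only:)
  qed
  moreover have "(\<lambda>x. \<Prod>i\<in>Basis. \<eta> i (x \<bullet> i)) differentiable_on UNIV"
    using p(1) by (auto simp: differentiable_on_def)
  ultimately show ?case by simp
qed

lemma test_function_prod: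
  fixes \<eta> :: "'a :: euclidean_space \<Rightarrow> real \<Rightarrow> real"
  assumes "\<And>i k. i \<in> Basis \<Longrightarrow> smooth_k k (\<eta> i)"
    and supp: "\<And>i s. i \<in> Basis \<Longrightarrow> s \<notin> {l i..u i} \<Longrightarrow> \<eta> i s = 0"
  shows "test_function (\<lambda>x. \<Prod>i\<in>Basis. \<eta> i (x \<bullet> i))"
proof -
  have "{x. (\<Prod>i\<in>Basis. \<eta> i (x \<bullet> i)) \<noteq> 0} \<subseteq> cbox (\<Sum>i\<in>Basis. l i *\<^sub>R i) (\<Sum>i\<in>Basis. u i *\<^sub>R i)"
    using supp by (force simp: mem_box prod_zero_iff)
  then have "compact (closure {x. (\<Prod>i\<in>Basis. \<eta> i (x \<bullet> i)) \<noteq> 0})"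
    by (meson bounded_cbox bounded_subset compact_closure)
  then show ?thesis using C_k_prod assms by (auto simp: test_function_def)
qed

section \<open>Dyadic cubes\<close>

text \<open>Completion does not change the measure of the Borel sets of a countable exhaustion.
  Fubini's theorem for the averages and the uniqueness of densities rest on this.\<close>

lemma sigma_finite_lebesgue: "sigma_finite_measure (lebesgue :: 'a :: euclidean_space measure)"
proof -
  obtain A :: "'a set set" where A: "countable A" "A \<subseteq> sets lborel" "\<Union>A = space lborel"
    "\<forall>a\<in>A. emeasure lborel a \<noteq> \<infinity>"
    using lborel.sigma_finite_countable by blast
  show ?thesis
  proof
    show "\<exists>A::'a set set. countable A \<and> A \<subseteq> sets lebesgue \<and> \<Union>A = space lebesgue
        \<and> (\<forall>a\<in>A. emeasure lebesgue a \<noteq> \<infinity>)"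
      using A by (intro exI[of _ A]) (auto simp: sets_completionI_sets)
  qed
qed

interpretation lebesgue_sf: sigma_finite_measure "lebesgue :: 'a :: euclidean_space measure"
  by (rule sigma_finite_lebesgue)

interpretation lebesgue_pair: pair_sigma_finite "lebesgue :: 'a :: euclidean_space measure"
  "lebesgue :: 'b :: euclidean_space measure" ..

definition hbox :: "'a :: euclidean_space \<Rightarrow> 'a \<Rightarrow> 'a set" where
  "hbox a c = {x. \<forall>i\<in>Basis. a \<bullet> i \<le> x \<bullet> i \<and> x \<bullet> i < c \<bullet> i}"

text \<open>Equality of floors makes membership in a common cube an equivalence relation at each
  level, and reduces the nesting of levels to integer division.\<close>

definition cube :: "nat \<Rightarrow> 'a :: euclidean_space \<Rightarrow> 'a set" where
  "cube k x = {y. \<forall>i\<in>Basis. \<lfloor>2 ^ k * (y \<bullet> i)\<rfloor> = \<lfloor>2 ^ k * (x \<bullet> i)\<rfloor>}"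

definition corner :: "nat \<Rightarrow> 'a :: euclidean_space \<Rightarrow> 'a" where
  "corner k x = (\<Sum>i\<in>Basis. (real_of_int \<lfloor>2 ^ k * (x \<bullet> i)\<rfloor> / 2 ^ k) *\<^sub>R i)"

lemma corner_inner: "i \<in> Basis \<Longrightarrow> corner k x \<bullet> i = real_of_int \<lfloor>2 ^ k * (x \<bullet> i)\<rfloor> / 2 ^ k"
  by (simp add: corner_def)

lemma cube_refl [simp]: "x \<in> cube k x" by (simp add: cube_def)

lemma cube_sym: "y \<in> cube k x \<longleftrightarrow> x \<in> cube k y" by (auto simp: cube_def)

lemma cube_eq: "y \<in> cube k x \<Longrightarrow> cube k y = cube k x" by (auto simp: cube_def)

lemma cube_mono: "j \<le> k \<Longrightarrow> cube k x \<subseteq> cube j x"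
proof -
  assume jk: "j \<le> k"
  have *: "\<lfloor>2 ^ j * t\<rfloor> = \<lfloor>2 ^ k * t\<rfloor> div 2 ^ (k - j)" for t :: real
  proof -
    have "2 ^ j * t = 2 ^ k * t / real_of_int (2 ^ (k - j))"
    proof -
      have "(2::real) ^ k = 2 ^ j * 2 ^ (k - j)" using jk by (simp add: power_add[symmetric])
      then show ?thesis by simp
    qed
    then show ?thesis using floor_divide_real_eq_div[of "2 ^ (k - j)" "2 ^ k * t"] by simp
  qed
  show ?thesis unfolding cube_def by (auto simp: *)
qed

lemma cube_subset_or_disjoint: "j \<le> k \<Longrightarrow> cube k x \<subseteq> cube j z \<or> cube k x \<inter> cube j z = {}"
  using cube_mono[of j k] cube_eq[of _ k x] cube_eq[of _ j z] by blast

lemma cube_eq_hbox: "cube k x = hbox (corner k x) (corner k x + (1 / 2 ^ k) *\<^sub>R One)"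
proof -
  have "\<lfloor>2 ^ k * s\<rfloor> = \<lfloor>2 ^ k * t\<rfloor> \<longleftrightarrow>
      real_of_int \<lfloor>2 ^ k * t\<rfloor> / 2 ^ k \<le> s \<and> s < real_of_int \<lfloor>2 ^ k * t\<rfloor> / 2 ^ k + 1 / 2 ^ k" for s t :: real
    by (simp add: floor_eq_iff add_divide_distrib[symmetric] field_simps)
  then show ?thesis
    by (auto simp: cube_def hbox_def corner_inner inner_add_left)
qed

lemma hbox_borel [measurable]: "hbox a c \<in> sets borel"
proof -
  have "hbox a c = (\<Inter>i\<in>Basis. {x. a \<bullet> i \<le> x \<bullet> i} \<inter> {x. x \<bullet> i < c \<bullet> i})"
    by (auto simp: hbox_def)
  also have "\<dots> \<in> sets borel" by (intro sets.finite_INT) auto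
  finally show ?thesis .
qed

lemma hbox_lebesgue [measurable]: "hbox a c \<in> sets lebesgue"
  using hbox_borel by (simp add: sets_completionI_sets)

lemma cube_borel: "cube k x \<in> sets borel"
  by (simp add: cube_eq_hbox hbox_borel)

lemma cube_lebesgue [measurable]: "cube k x \<in> sets lebesgue"
  by (simp add: cube_eq_hbox)

lemma box_subset_hbox: "box a c \<subseteq> hbox a c" "hbox a c \<subseteq> cbox a c"
  by (auto simp: hbox_def mem_box less_imp_le)

text \<open>The half-open box lies between the open and the closed box, which have the same
  volume.\<close>

lemma emeasure_hbox:
  assumes "\<And>i. i \<in> Basis \<Longrightarrow> a \<bullet> i \<le> c \<bullet> i"
  shows "emeasure lebesgue (hbox a c) = ennreal (\<Prod>i\<in>Basis. (c - a) \<bullet> i)"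
proof (rule antisym)
  have "emeasure lebesgue (hbox a c) \<le> emeasure lebesgue (cbox a c)"
    by (intro emeasure_mono box_subset_hbox) auto
  also have "\<dots> = ennreal (\<Prod>i\<in>Basis. (c - a) \<bullet> i)" using assms by (simp add: emeasure_lborel_cbox)
  finally show "emeasure lebesgue (hbox a c) \<le> ennreal (\<Prod>i\<in>Basis. (c - a) \<bullet> i)" .
  have "ennreal (\<Prod>i\<in>Basis. (c - a) \<bullet> i) = emeasure lebesgue (box a c)"
    using assms by (simp add: emeasure_lborel_box)
  also have "\<dots> \<le> emeasure lebesgue (hbox a c)"
    by (intro emeasure_mono box_subset_hbox) auto
  finally show "ennreal (\<Prod>i\<in>Basis. (c - a) \<bullet> i) \<le> emeasure lebesgue (hbox a c)" .
qed

lemma emeasure_cube: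
  fixes x :: "'a :: euclidean_space"
  shows "emeasure lebesgue (cube k x) = ennreal (1 / (2 ^ k) ^ DIM('a))"
  by (subst cube_eq_hbox, subst emeasure_hbox) (auto simp: inner_add_left power_one_over)

lemma measure_cube:
  fixes x :: "'a :: euclidean_space"
  shows "measure lebesgue (cube k x) = 1 / (2 ^ k) ^ DIM('a)"
  by (simp add: measure_def emeasure_cube)

lemma emeasure_hbox_finite: "emeasure lebesgue (hbox a c) < \<infinity>"
proof -
  have "emeasure lebesgue (hbox a c) \<le> emeasure lebesgue (cbox a c)"
    by (intro emeasure_mono box_subset_hbox) auto
  also have "\<dots> < \<infinity>" by (simp add: emeasure_lborel_cbox_eq)
  finally show ?thesis .
qed

text \<open>Both coordinates are viewed as maps into the Borel space, where the floors are
  measurable. Joint measurability is what Fubini's theorem asks of the averaging kernel.\<close>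

lemma cube_pred [measurable]: "Measurable.pred (lebesgue \<Otimes>\<^sub>M lebesgue) (\<lambda>p. snd p \<in> cube k (fst p))"
proof -
  have 1: "fst \<in> (lebesgue \<Otimes>\<^sub>M lebesgue) \<rightarrow>\<^sub>M (borel :: 'a measure)"
    by (rule measurable_compose[OF measurable_fst measurable_completion]) simp
  have 2: "snd \<in> (lebesgue \<Otimes>\<^sub>M lebesgue) \<rightarrow>\<^sub>M (borel :: 'a measure)"
    by (rule measurable_compose[OF measurable_snd measurable_completion]) simp
  note [measurable] = 1 2
  show ?thesis unfolding cube_def mem_Collect_eq by measurable
qed

lemma small_cube:
  fixes x :: "'a :: euclidean_space"
  assumes "open S" "x \<in> S"
  obtains k where "cube k x \<subseteq> S"
proof -
  obtain e where e: "e > 0" "ball x e \<subseteq> S" using assms open_contains_ball by blast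
  \<comment> \<open>Two points of a cube differ by at most 2^(-k) in each coordinate, so the l1 norm
    of their difference is at most d 2^(-k).\<close>
  obtain k where k: "(1/2 :: real) ^ k < e / DIM('a)"
    using real_arch_pow_inv[of "e / DIM('a)" "1/2"] e by auto
  have "y \<in> ball x e" if y: "y \<in> cube k x" for y
  proof -
    have "\<bar>(x - y) \<bullet> i\<bar> \<le> (1/2) ^ k" if "i \<in> Basis" for i
    proof -
      have "\<bar>2 ^ k * (x \<bullet> i) - 2 ^ k * (y \<bullet> i)\<bar> \<le> 1"
      proof -
        have "\<lfloor>2 ^ k * (y \<bullet> i)\<rfloor> = \<lfloor>2 ^ k * (x \<bullet> i)\<rfloor>" using y that by (simp add: cube_def)
        then show ?thesis by linarith
      qed
      then have "2 ^ k * \<bar>(x - y) \<bullet> i\<bar> \<le> 1"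
        by (simp add: inner_diff_left right_diff_distrib[symmetric] abs_mult)
      then show ?thesis by (simp add: power_one_over field_simps)
    qed
    then have "norm (x - y) \<le> (\<Sum>i\<in>(Basis::'a set). (1/2) ^ k)"
      by (intro order.trans[OF norm_le_l1] sum_mono) auto
    also have "\<dots> < e" using k by (simp add: field_simps)
    finally show ?thesis by (simp add: dist_norm)
  qed
  then show thesis using e that by blast
qed

text \<open>Each cube has nonempty interior and so is the cube of a point from a countable dense
  set.\<close>

lemma countable_cubes: "countable (range (cube k :: 'a :: euclidean_space \<Rightarrow> _))"
proof -
  obtain D :: "'a set" where D: "countable D" "\<And>U. open U \<Longrightarrow> U \<noteq> {} \<Longrightarrow> \<exists>d\<in>D. d \<in> U"
    using countable_dense_setE by blast
  have "cube k x \<in> cube k ` D" for x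
  proof -
    let ?B = "box (corner k x) (corner k x + (1 / 2 ^ k) *\<^sub>R One)"
    have "?B \<noteq> {}" by (auto simp: box_ne_empty inner_add_left)
    then obtain d where "d \<in> D" "d \<in> ?B" using D(2)[of ?B] open_box by blast
    then have "d \<in> cube k x" unfolding cube_eq_hbox[of k x] using box_subset_hbox(1) by blast
    then show ?thesis using cube_eq \<open>d \<in> D\<close> by (metis imageI)
  qed
  then have "range (cube k) \<subseteq> cube k ` D" by blast
  then show ?thesis by (rule countable_subset) (simp add: D)
qed

text \<open>Every open set is the union of the cubes it contains, and this union is
  countable.\<close>

lemma sets_borel_cubes:
  "sets (borel :: 'a :: euclidean_space measure) = sigma_sets UNIV (insert {} (\<Union>k. range (cube k)))"
    (is "_ = sigma_sets UNIV ?E")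
proof
  have "?E \<subseteq> sets borel" using cube_borel by auto
  then show "sigma_sets UNIV ?E \<subseteq> sets borel"
    using sets.sigma_sets_subset[of ?E borel] by simp
  have cE: "countable ?E" using countable_cubes by auto
  have "S \<in> sigma_sets UNIV ?E" if S: "open S" for S :: "'a set"
  proof -
    have "S = \<Union>{Q \<in> ?E. Q \<subseteq> S}"
    proof
      show "S \<subseteq> \<Union>{Q \<in> ?E. Q \<subseteq> S}"
      proof
        fix x assume "x \<in> S"
        then obtain k where "cube k x \<subseteq> S" using small_cube[OF S] by blast
        then show "x \<in> \<Union>{Q \<in> ?E. Q \<subseteq> S}" using cube_refl by blast
      qed
    qed blast
    moreover have "\<Union>{Q \<in> ?E. Q \<subseteq> S} \<in> sigma_sets UNIV ?E"
      by (intro sigma_sets_UNION countable_subset[OF _ cE]) auto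
    ultimately show ?thesis by simp
  qed
  then show "sets borel \<subseteq> sigma_sets UNIV ?E"
    unfolding borel_def by (simp del: insert_iff) (rule sigma_sets_mono, blast)
qed

lemma Int_stable_cubes: "Int_stable (insert {} (\<Union>k. range (cube k)))"
proof (rule Int_stableI)
  have *: "cube k x \<inter> cube j z \<in> insert {} (\<Union>k. range (cube k))" if "j \<le> k" for j k and x z :: 'a
    using cube_subset_or_disjoint[OF that, of x z] by (auto simp: Int_absorb2)
  fix A B :: "'a set"
  assume "A \<in> insert {} (\<Union>k. range (cube k))" "B \<in> insert {} (\<Union>k. range (cube k))"
  then show "A \<inter> B \<in> insert {} (\<Union>k. range (cube k))"
    using * by (metis (no_types, lifting) Int_commute Int_empty_left Int_empty_right UN_iff insert_iff
        nat_le_linear rangeE)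
qed

text \<open>Dynkin's argument: the cubes with the empty set are stable under intersection and
  generate the Borel sets. Complements use that the total integral vanishes, disjoint unions use
  integrability; null sets carry the result to Lebesgue sets, and uniqueness of densities
  concludes.\<close>

lemma integral_zero_on_cubes_integrable:
  fixes v :: "'a :: euclidean_space \<Rightarrow> complex"
  assumes v: "integrable lebesgue v" and v0: "(LINT y|lebesgue. v y) = 0"
    and cubes: "\<And>k x. (LINT y|lebesgue. indicator (cube k x) y *\<^sub>R v y) = 0"
  shows "AE x in lebesgue. v x = 0"
proof -
  have Pow: "insert {} (\<Union>k. range (cube k)) \<subseteq> Pow (UNIV :: 'a set)" by simp
  have borel: "(LINT y|lebesgue. indicator A y *\<^sub>R v y) = 0" if "A \<in> sets borel" for A
    using Int_stable_cubes Pow that[unfolded sets_borel_cubes]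
  proof (induction rule: sigma_sets_induct_disjoint)
    case (basic A)
    then show ?case using cubes by auto
  next
    case empty
    then show ?case by simp
  next
    case (compl A)
    then have A: "A \<in> sets lebesgue" unfolding sets_borel_cubes[symmetric] by (auto intro: sets_completionI_sets)
    have "(LINT y|lebesgue. indicator (UNIV - A) y *\<^sub>R v y)
        = (LINT y|lebesgue. v y - indicator A y *\<^sub>R v y)"
      by (intro Bochner_Integration.integral_cong) (auto simp: indicator_def)
    also have "\<dots> = 0" using compl v v0 A by (subst Bochner_Integration.integral_diff) (auto intro: integrable_mult_indicator)
    finally show ?case .
  next
    case (union A)
    then have A: "\<And>i. A i \<in> sets lebesgue"
      unfolding sets_borel_cubes[symmetric] by (auto intro: sets_completionI_sets)
    have "(LINT y:(\<Union>i. A i)|lebesgue. v y) = (\<Sum>i. (LINT y:A i|lebesgue. v y))"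
    proof (rule lebesgue_integral_countable_add)
      show "set_integrable lebesgue (\<Union> (range A)) v"
        unfolding set_integrable_def using v A by (intro integrable_mult_indicator) auto
    qed (use union A in \<open>auto simp: disjoint_family_on_def\<close>)
    then show ?case using union by (simp add: set_lebesgue_integral_def)
  qed
  show ?thesis
  proof (rule lebesgue_sf.density_unique_banach[where f'="\<lambda>x. 0"])
    fix A :: "'a set" assume "A \<in> sets lebesgue"
    then obtain S N N' where A: "A = S \<union> N" "N \<subseteq> N'" "N' \<in> null_sets lborel" "S \<in> sets lborel"
      by (rule sets_completionE)
    have N': "N' \<in> null_sets lebesgue" using A(3) null_sets_completionI by blast
    have mA: "A \<in> sets lebesgue" by fact
    have mS: "S \<in> sets lebesgue" using A(4) by (simp add: sets_completionI_sets)
    have "(LINT y|lebesgue. indicator A y *\<^sub>R v y) = (LINT y|lebesgue. indicator S y *\<^sub>R v y)"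
    proof (rule integral_cong_AE)
      show "AE x in lebesgue. indicator A x *\<^sub>R v x = indicator S x *\<^sub>R v x"
        using AE_not_in[OF N'] by eventually_elim (use A in \<open>auto simp: indicator_def\<close>)
    qed (use mA mS v in auto)
    also have "\<dots> = 0" using borel A(4) by simp
    finally show "(LINT x:A|lebesgue. v x) = (LINT x:A|lebesgue. 0)"
      by (simp add: set_lebesgue_integral_def)
  qed (use v in auto)
qed

text \<open>The restriction of \<open>u\<close> to a unit cube is integrable and, by nesting, has
  vanishing integral over every cube. The countably many unit cubes can thus be treated one at a
  time, although \<open>u\<close> is only integrable on each cube.\<close>

lemma integral_zero_on_cubes:
  fixes u :: "'a :: euclidean_space \<Rightarrow> complex"
  assumes int: "\<And>k x. integrable lebesgue (\<lambda>y. indicator (cube k x) y *\<^sub>R u y)"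
    and zero: "\<And>k x. (LINT y|lebesgue. indicator (cube k x) y *\<^sub>R u y) = 0"
  shows "AE x in lebesgue. u x = 0"
proof -
  have "AE x in lebesgue. indicator (cube 0 z) x *\<^sub>R u x = 0" for z
  proof (rule integral_zero_on_cubes_integrable)
    fix k x
    have "(\<lambda>y. indicator (cube k x) y *\<^sub>R indicator (cube 0 z) y *\<^sub>R u y)
        = (if cube k x \<subseteq> cube 0 z then (\<lambda>y. indicator (cube k x) y *\<^sub>R u y) else (\<lambda>y. 0))"
      using cube_subset_or_disjoint[of 0 k x z] by (auto simp: fun_eq_iff indicator_def)
    then show "(LINT y|lebesgue. indicator (cube k x) y *\<^sub>R indicator (cube 0 z) y *\<^sub>R u y) = 0"
      using zero[of k x] by auto
  qed (fact int zero)+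
  then have "\<forall>Q\<in>range (cube 0). AE x in lebesgue. indicator Q x *\<^sub>R u x = 0" by blast
  then have "AE x in lebesgue. \<forall>Q\<in>range (cube 0). indicator Q x *\<^sub>R u x = 0"
    by (subst AE_ball_countable[OF countable_cubes])
  then show ?thesis by eventually_elim (metis cube_refl indicator_simps(1) rangeI scaleR_one)
qed

section \<open>Averages over dyadic cubes as conditional expectations\<close>

lemma cube_indicator_measurable [measurable]:
  "(\<lambda>p. indicator (cube k (fst p)) (snd p) :: real) \<in> borel_measurable (lebesgue \<Otimes>\<^sub>M lebesgue)"
  unfolding indicator_def of_bool_def by measurable

lemma indicator_cube_commute: "indicator (cube k x) y = (indicator (cube k y) x :: real)"
  using cube_sym[of y k x] by (simp add: indicator_def)

lemma integrable_indicator_cube [simp]: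
  "integrable lebesgue (\<lambda>y. indicator (cube k x) y :: real)"
  by (simp add: integrable_real_indicator emeasure_cube)

lemma integral_indicator_cube:
  fixes x :: "'a :: euclidean_space"
  shows "(LINT y|lebesgue. indicator (cube k x) y :: real) = 1 / (2 ^ k) ^ DIM('a)"
  by (simp add: measure_cube)

text \<open>The factor is the reciprocal of the volume of the cube. The value type is left open
  because complex functions and their real moduli are both averaged.\<close>

definition avg :: "nat \<Rightarrow> ('a :: euclidean_space \<Rightarrow> 'b :: {banach, second_countable_topology}) \<Rightarrow> 'a \<Rightarrow> 'b" where
  "avg k u x = (2 ^ k) ^ DIM('a) *\<^sub>R (LINT y|lebesgue. indicator (cube k x) y *\<^sub>R u y)"

text \<open>Fubini's theorem for the kernel that tests whether two points share a cube. The kernel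
  is symmetric, and its normalised integral in either variable is 1.\<close>

lemma avg_integral:
  fixes u :: "'a :: euclidean_space \<Rightarrow> 'b :: {banach, second_countable_topology}"
  assumes u: "integrable lebesgue u"
  shows "integrable lebesgue (avg k u)" "(LINT x|lebesgue. avg k u x) = (LINT x|lebesgue. u x)"
proof -
  let ?c = "(2 ^ k) ^ DIM('a) :: real"
  define P where "P = (\<lambda>y x :: 'a. (?c * indicator (cube k y) x) *\<^sub>R u y)"
  have um [measurable]: "u \<in> borel_measurable lebesgue" using u by auto
  have Pm: "case_prod P \<in> borel_measurable (lebesgue \<Otimes>\<^sub>M lebesgue)"
    unfolding P_def case_prod_beta by (intro borel_measurable_scaleR borel_measurable_times
        cube_indicator_measurable measurable_compose[OF measurable_fst um]) auto
  have Pint: "integrable (lebesgue \<Otimes>\<^sub>M lebesgue) (case_prod P)"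
  proof (rule lebesgue_pair.Fubini_integrable[OF Pm])
    have "(\<lambda>y. LINT x|lebesgue. norm (case_prod P (y, x))) = (\<lambda>y. norm (u y))"
    proof
      fix y
      have "(LINT x|lebesgue. norm (case_prod P (y, x)))
          = (LINT x|lebesgue. (?c * norm (u y)) * indicator (cube k y) x)"
        by (intro Bochner_Integration.integral_cong) (auto simp: P_def abs_mult)
      also have "\<dots> = norm (u y)" by (subst integral_mult_right_zero) (simp add: integral_indicator_cube measure_cube)
      finally show "(LINT x|lebesgue. norm (case_prod P (y, x))) = norm (u y)" .
    qed
    then show "integrable lebesgue (\<lambda>y. LINT x|lebesgue. norm (case_prod P (y, x)))"
      using u by simp
    show "AE y in lebesgue. integrable lebesgue (\<lambda>x. case_prod P (y, x))"
      by (intro AE_I2) (auto simp: P_def)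
  qed
  have avg_eq: "avg k u x = (LINT y|lebesgue. P y x)" for x
  proof -
    have "(LINT y|lebesgue. P y x) = (LINT y|lebesgue. ?c *\<^sub>R (indicator (cube k x) y *\<^sub>R u y))"
      by (intro Bochner_Integration.integral_cong) (simp_all add: P_def indicator_cube_commute[of k x])
    then show ?thesis by (simp only: avg_def integral_scaleR_right)
  qed
  show "integrable lebesgue (avg k u)"
    using lebesgue_pair.integrable_snd[OF Pint] by (simp add: avg_eq[abs_def])
  have "(LINT x|lebesgue. avg k u x) = (LINT y|lebesgue. LINT x|lebesgue. P y x)"
    unfolding avg_eq by (rule lebesgue_pair.Fubini_integral[OF Pint])
  also have "(\<lambda>y. LINT x|lebesgue. P y x) = u"
  proof
    fix y
    have "(LINT x|lebesgue. P y x) = (LINT x|lebesgue. ?c * indicator (cube k y) x) *\<^sub>R u y"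
      unfolding P_def by (rule integral_scaleR_left) auto
    then show "(LINT x|lebesgue. P y x) = u y" by (simp add: measure_cube)
  qed
  finally show "(LINT x|lebesgue. avg k u x) = (LINT x|lebesgue. u x)" .
qed

lemma avg_indicator:
  assumes "j \<le> k"
  shows "avg k (\<lambda>y. indicator (cube j z) y *\<^sub>R u y) x = indicator (cube j z) x *\<^sub>R avg k u x"
proof (cases "x \<in> cube j z")
  case True
  then have "cube k x \<subseteq> cube j z" using cube_mono[OF assms, of x] cube_eq[of x j z] by blast
  then have "(\<lambda>y. indicator (cube k x) y *\<^sub>R indicator (cube j z) y *\<^sub>R u y)
      = (\<lambda>y. indicator (cube k x) y *\<^sub>R u y)" by (auto simp: fun_eq_iff indicator_def)
  with True show ?thesis by (simp add: avg_def)
next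
  case False
  then have "cube k x \<inter> cube j z = {}" using cube_subset_or_disjoint[OF assms, of x z] cube_refl by blast
  then have "(\<lambda>y. indicator (cube k x) y *\<^sub>R indicator (cube j z) y *\<^sub>R u y) = (\<lambda>y. 0)"
    by (auto simp: fun_eq_iff indicator_def)
  with False show ?thesis by (simp add: avg_def)
qed

text \<open>The indicator of a coarser cube is constant on the finer ones and comes out of the
  average, so this is preservation of the total integral for the restricted function.\<close>

lemma avg_tower:
  assumes "j \<le> k" and "integrable lebesgue (\<lambda>y. indicator (cube j z) y *\<^sub>R u y)"
  shows "integrable lebesgue (\<lambda>y. indicator (cube j z) y *\<^sub>R avg k u y)"
    and "(LINT y|lebesgue. indicator (cube j z) y *\<^sub>R avg k u y)
      = (LINT y|lebesgue. indicator (cube j z) y *\<^sub>R u y)"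
proof -
  have "avg k (\<lambda>y. indicator (cube j z) y *\<^sub>R u y) = (\<lambda>y. indicator (cube j z) y *\<^sub>R avg k u y)"
    using avg_indicator[OF assms(1)] by (rule ext)
  with avg_integral[OF assms(2), of k]
  show "integrable lebesgue (\<lambda>y. indicator (cube j z) y *\<^sub>R avg k u y)"
    "(LINT y|lebesgue. indicator (cube j z) y *\<^sub>R avg k u y)
      = (LINT y|lebesgue. indicator (cube j z) y *\<^sub>R u y)" by simp_all
qed

lemma avg_norm: "norm (avg k u x) \<le> avg k (\<lambda>y. norm (u y)) x"
proof -
  have "norm (LINT y|lebesgue. indicator (cube k x) y *\<^sub>R u y)
      \<le> (LINT y|lebesgue. norm (indicator (cube k x) y *\<^sub>R u y))"
    by (rule integral_norm_bound)
  then show ?thesis by (simp add: avg_def)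
qed

lemma avg_nonneg: "(\<And>x. u x \<ge> (0::real)) \<Longrightarrow> avg k u x \<ge> 0"
  by (auto simp: avg_def intro!: mult_nonneg_nonneg integral_nonneg_AE)

lemma avg_le_integral:
  fixes u :: "'a :: euclidean_space \<Rightarrow> real"
  assumes "integrable lebesgue u" "\<And>x. u x \<ge> 0"
  shows "avg k u x \<le> (2 ^ k) ^ DIM('a) * (LINT y|lebesgue. u y)"
proof -
  have "(LINT y|lebesgue. indicator (cube k x) y *\<^sub>R u y) \<le> (LINT y|lebesgue. u y)"
    using assms by (intro integral_mono integrable_mult_indicator) (auto simp: indicator_def)
  then show ?thesis by (simp add: avg_def)
qed

lemma sq_integrable_indicator:
  assumes "A \<in> sets lebesgue" "emeasure lebesgue A < \<infinity>"
  shows "sq_integrable (\<lambda>x. complex_of_real (indicator A x))"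
  unfolding sq_integrable_def
proof
  show "(\<lambda>x. complex_of_real (indicator A x)) \<in> borel_measurable lebesgue" using assms by measurable
  have "(\<lambda>x. (cmod (complex_of_real (indicator A x)))\<^sup>2) = (\<lambda>x. indicator A x)"
    by (auto simp: fun_eq_iff indicator_def)
  then show "integrable lebesgue (\<lambda>x. (cmod (complex_of_real (indicator A x)))\<^sup>2)"
    using assms by (simp add: integrable_real_indicator)
qed

lemma sq_integrable_times_indicator:
  assumes "A \<in> sets lebesgue" "sq_integrable u"
  shows "sq_integrable (\<lambda>x. indicator A x *\<^sub>R u x)"
proof (rule sq_integrable_bound[OF assms(2)])
  show "(\<lambda>x. indicator A x *\<^sub>R u x) \<in> borel_measurable lebesgue"
    using assms by (auto simp: sq_integrable_def)
qed (auto simp: indicator_def)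

lemma integrable_indicator_sq:
  assumes "A \<in> sets lebesgue" "emeasure lebesgue A < \<infinity>" "sq_integrable u"
  shows "integrable lebesgue (\<lambda>x. indicator A x *\<^sub>R u x)"
  using sq_integrable_mult_integrable[OF sq_integrable_indicator[OF assms(1,2)] assms(3)]
  by (simp add: scaleR_conv_of_real)

lemma integrable_cube_sq: "sq_integrable u \<Longrightarrow> integrable lebesgue (\<lambda>y. indicator (cube k x) y *\<^sub>R u y)"
  by (intro integrable_indicator_sq) (auto simp: emeasure_cube)

text \<open>Jensen's inequality for the square, obtained as Cauchy-Schwarz against the indicator of
  the cube.\<close>

lemma avg_cmod_sq_le:
  fixes u :: "'a :: euclidean_space \<Rightarrow> complex"
  assumes u: "sq_integrable u"
  shows "(avg k (\<lambda>y. cmod (u y)) x)\<^sup>2 \<le> avg k (\<lambda>y. (cmod (u y))\<^sup>2) x"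
proof -
  let ?c = "(2 ^ k) ^ DIM('a) :: real"
  let ?I = "\<lambda>y. complex_of_real (indicator (cube k x) y)"
  let ?v = "\<lambda>y. indicator (cube k x) y *\<^sub>R u y"
  have I: "sq_integrable ?I" by (rule sq_integrable_indicator) (auto simp: emeasure_cube)
  have v: "sq_integrable ?v" by (rule sq_integrable_times_indicator[OF _ u]) auto
  have 1: "(\<lambda>y. cmod (?I y) * cmod (?v y)) = (\<lambda>y. indicator (cube k x) y *\<^sub>R cmod (u y))"
    by (auto simp: fun_eq_iff indicator_def)
  have 2: "(LINT y|lebesgue. (cmod (?I y))\<^sup>2) = 1 / ?c"
  proof -
    have "(\<lambda>y. (cmod (?I y))\<^sup>2) = (\<lambda>y. indicator (cube k x) y)"
      by (auto simp: fun_eq_iff indicator_def)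
    then show ?thesis by (simp add: measure_cube)
  qed
  have 3: "(\<lambda>y. (cmod (?v y))\<^sup>2) = (\<lambda>y. indicator (cube k x) y *\<^sub>R (cmod (u y))\<^sup>2)"
    by (auto simp: fun_eq_iff indicator_def)
  let ?S = "LINT y|lebesgue. indicator (cube k x) y *\<^sub>R (cmod (u y))\<^sup>2"
  let ?T = "LINT y|lebesgue. indicator (cube k x) y *\<^sub>R cmod (u y)"
  have S0: "?S \<ge> 0" by (intro integral_nonneg_AE) auto
  have T0: "?T \<ge> 0" by (intro integral_nonneg_AE) auto
  have "?T \<le> sqrt (1 / ?c) * sqrt ?S"
    using sq_integrable_Cauchy_Schwarz[OF I v] unfolding 1 2 3 .
  then have "?T\<^sup>2 \<le> (sqrt (1 / ?c) * sqrt ?S)\<^sup>2" using T0 by (intro power_mono)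
  also have "\<dots> = ?S / ?c" using S0 by (simp add: power_mult_distrib)
  finally have "?c\<^sup>2 * ?T\<^sup>2 \<le> ?c\<^sup>2 * (?S / ?c)" by (intro mult_left_mono) auto
  also have "?c\<^sup>2 * (?S / ?c) = ?c * ?S" by (simp add: power2_eq_square)
  finally show ?thesis by (simp add: avg_def power_mult_distrib)
qed

lemma avg_measurable:
  assumes "u \<in> borel_measurable lebesgue"
  shows "avg k u \<in> borel_measurable lebesgue"
proof -
  have "(\<lambda>p. indicator (cube k (fst p)) (snd p) *\<^sub>R u (snd p)) \<in> borel_measurable (lebesgue \<Otimes>\<^sub>M lebesgue)"
    by (intro borel_measurable_scaleR cube_indicator_measurable measurable_compose[OF measurable_snd assms])
  then have "(\<lambda>x. LINT y|lebesgue. indicator (cube k x) y *\<^sub>R u y) \<in> borel_measurable lebesgue"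
    by (intro lebesgue_sf.borel_measurable_lebesgue_integral) (simp add: case_prod_beta)
  then show ?thesis unfolding avg_def[abs_def] by measurable
qed

lemma avg_sq_le:
  assumes "sq_integrable u"
  shows "(cmod (avg k u x))\<^sup>2 \<le> avg k (\<lambda>y. (cmod (u y))\<^sup>2) x"
  using power_mono[OF avg_norm[of k u x], of 2] avg_cmod_sq_le[OF assms, of k x] by simp

lemma sq_integrable_avg:
  assumes "sq_integrable u"
  shows "sq_integrable (avg k u)"
    and "(LINT x|lebesgue. (cmod (avg k u x))\<^sup>2) \<le> (LINT x|lebesgue. (cmod (u x))\<^sup>2)"
proof -
  have int: "integrable lebesgue (\<lambda>y. (cmod (u y))\<^sup>2)" and um: "u \<in> borel_measurable lebesgue"
    using assms by (auto simp: sq_integrable_def)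
  note [measurable] = avg_measurable[OF um, of k]
  have i: "integrable lebesgue (\<lambda>x. (cmod (avg k u x))\<^sup>2)"
    by (rule Bochner_Integration.integrable_bound[OF avg_integral(1)[OF int, of k]])
      (use avg_sq_le[OF assms] order.trans[OF avg_sq_le[OF assms] abs_ge_self] in auto)
  then show "sq_integrable (avg k u)" by (simp add: sq_integrable_def)
  have "(LINT x|lebesgue. (cmod (avg k u x))\<^sup>2) \<le> (LINT x|lebesgue. avg k (\<lambda>y. (cmod (u y))\<^sup>2) x)"
    by (intro integral_mono i avg_integral(1)[OF int] avg_sq_le[OF assms])
  then show "(LINT x|lebesgue. (cmod (avg k u x))\<^sup>2) \<le> (LINT x|lebesgue. (cmod (u x))\<^sup>2)"
    by (simp add: avg_integral(2)[OF int])
qed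

section \<open>Weak derivatives tested on boxes\<close>

lemma smooth_box_approx:
  fixes a c :: "'a :: euclidean_space"
  assumes "\<And>i. i \<in> Basis \<Longrightarrow> a \<bullet> i < c \<bullet> i"
  shows "\<exists>\<eta>. \<forall>i\<in>Basis. interval_approx (a \<bullet> i) (c \<bullet> i) (\<eta> i)"
  using assms by (intro bchoice ballI smooth_indicator_approx)

lemma box_approxD:
  fixes a c :: "'a :: euclidean_space"
  assumes \<eta>: "\<forall>i\<in>Basis. interval_approx (a \<bullet> i) (c \<bullet> i) (\<eta> i)"
  shows "i \<in> Basis \<Longrightarrow> smooth_k k (\<eta> i n)" "i \<in> Basis \<Longrightarrow> 0 \<le> \<eta> i n s" "i \<in> Basis \<Longrightarrow> \<eta> i n s \<le> 1"
    "i \<in> Basis \<Longrightarrow> s \<notin> {a \<bullet> i - eps n..<c \<bullet> i} \<Longrightarrow> \<eta> i n s = 0"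
    "(\<lambda>n. \<Prod>i\<in>Basis. \<eta> i n (x \<bullet> i)) \<longlonglongrightarrow> indicator (hbox a c) x"
proof -
  note D = interval_approxD[OF bspec[OF \<eta>]]
  have "(\<lambda>n. \<Prod>i\<in>Basis. \<eta> i n (x \<bullet> i)) \<longlonglongrightarrow> (\<Prod>i\<in>Basis. indicator {a \<bullet> i..<c \<bullet> i} (x \<bullet> i))"
    by (intro tendsto_prod D)
  also have "(\<Prod>i\<in>Basis. indicator {a \<bullet> i..<c \<bullet> i} (x \<bullet> i)) = (indicator (hbox a c) x :: real)"
    by (auto simp: hbox_def indicator_def prod_zero_iff)
  finally show "(\<lambda>n. \<Prod>i\<in>Basis. \<eta> i n (x \<bullet> i)) \<longlonglongrightarrow> indicator (hbox a c) x" .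
  show "smooth_k k (\<eta> i n)" "0 \<le> \<eta> i n s" "\<eta> i n s \<le> 1" if "i \<in> Basis"
    by (rule D[OF that])+
  show "\<eta> i n s = 0" if "i \<in> Basis" "s \<notin> {a \<bullet> i - eps n..<c \<bullet> i}"
    by (rule D(4)[OF that])
qed

lemma not_in_hbox: "x \<notin> hbox a c \<longleftrightarrow> (\<exists>i\<in>Basis. x \<bullet> i \<notin> {a \<bullet> i..<c \<bullet> i})"
  by (auto simp: hbox_def)

lemma continuous_lebesgue_measurable:
  fixes \<phi> :: "'a :: euclidean_space \<Rightarrow> real"
  assumes "continuous_on UNIV \<phi>"
  shows "\<phi> \<in> borel_measurable lebesgue"
  by (rule measurable_completion) (simp add: borel_measurable_continuous_onI assms)

lemma integrable_hbox_rep: "integrable lebesgue (\<lambda>x. indicator (hbox a c) x *\<^sub>R rep_L2 f x)"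
  and integrable_norm_hbox_rep: "integrable lebesgue (\<lambda>x. norm (indicator (hbox a c) x *\<^sub>R rep_L2 f x))"
  and integrable_norm_hbox: "sq_integrable u \<Longrightarrow> integrable lebesgue (\<lambda>x. norm (indicator (hbox a c) x *\<^sub>R u x))"
  by (intro integrable_norm integrable_indicator_sq sq_integrable_rep hbox_lebesgue emeasure_hbox_finite; assumption?)+

lemma prod_unit_interval:
  fixes f :: "'a \<Rightarrow> real"
  assumes "\<And>i. i \<in> I \<Longrightarrow> 0 \<le> f i" "\<And>i. i \<in> I \<Longrightarrow> f i \<le> 1"
  shows "0 \<le> prod f I" "prod f I \<le> 1"
  using assms by (auto intro!: prod_nonneg prod_le_1)

text \<open>The test functions are products of smoothed indicators. Since \<open>eps n\<close> is at
  most 1, all of them vanish outside the box extended by 1 to the left in every direction, and this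
  box supplies the dominating function.\<close>

lemma test_orthogonal_box:
  fixes u :: "'a :: euclidean_space \<Rightarrow> complex"
  assumes u: "sq_integrable u" and ac: "\<And>i. i \<in> Basis \<Longrightarrow> a \<bullet> i < c \<bullet> i"
    and orth: "\<And>\<psi>. test_function \<psi> \<Longrightarrow> (LINT x|lebesgue. u x * of_real (\<psi> x)) = 0"
  shows "(LINT x|lebesgue. indicator (hbox a c) x *\<^sub>R u x) = 0"
proof -
  obtain \<eta> where "\<forall>i\<in>Basis. interval_approx (a \<bullet> i) (c \<bullet> i) (\<eta> i)"
    using smooth_box_approx[of a c] ac by blast
  note \<eta> = box_approxD[OF this]
  define A where "A = (\<lambda>n x::'a. \<Prod>i\<in>Basis. \<eta> i n (x \<bullet> i))"
  let ?K = "hbox (a - One) c"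
  have A01: "0 \<le> A n x" "A n x \<le> 1" for n x
    unfolding A_def using \<eta>(2,3) by (intro prod_unit_interval; simp)+
  have A0: "A n x = 0" if nx: "x \<notin> ?K" for n x
  proof -
    obtain i where i: "i \<in> Basis" "x \<bullet> i \<notin> {(a - One) \<bullet> i..<c \<bullet> i}"
      using nx unfolding not_in_hbox by blast
    have "eps n \<le> 1" by (rule eps_le_1)
    then have "x \<bullet> i \<notin> {a \<bullet> i - eps n..<c \<bullet> i}" using i by (auto simp: inner_diff_left)
    then show ?thesis unfolding A_def using \<eta>(4)[OF i(1)] i(1) by (intro prod_zero) auto
  qed
  have test: "test_function (A n)" for n
    unfolding A_def using \<eta>(1) \<eta>(4)
    by (intro test_function_prod[where l="\<lambda>i. a \<bullet> i - eps n" and u="\<lambda>i. c \<bullet> i"]) auto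
  have [measurable]: "A n \<in> borel_measurable lebesgue" for n
  proof -
    have "C_k 0 (A n)" using test[of n] by (auto simp: test_function_def)
    then show ?thesis by (intro continuous_lebesgue_measurable) simp
  qed
  have [measurable]: "u \<in> borel_measurable lebesgue" using u by (simp add: sq_integrable_def)
  have "(\<lambda>n. LINT x|lebesgue. u x * of_real (A n x)) \<longlonglongrightarrow> (LINT x|lebesgue. u x * of_real (indicator (hbox a c) x))"
  proof (rule integral_dominated_convergence[where w="\<lambda>x. norm (indicator ?K x *\<^sub>R u x)"])
    show "integrable lebesgue (\<lambda>x. norm (indicator ?K x *\<^sub>R u x))"
      by (rule integrable_norm_hbox[OF u])
    show "AE x in lebesgue. (\<lambda>n. u x * of_real (A n x)) \<longlonglongrightarrow> u x * of_real (indicator (hbox a c) x)"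
      using \<eta>(5) unfolding A_def by (intro AE_I2 tendsto_intros)
    show "AE x in lebesgue. norm (u x * of_real (A n x)) \<le> norm (indicator ?K x *\<^sub>R u x)" for n
      using A01[of n] A0[of _ n]
      by (intro AE_I2) (auto simp: norm_mult indicator_def intro: mult_left_le)
  qed measurable
  moreover have "(LINT x|lebesgue. u x * of_real (A n x)) = 0" for n by (rule orth[OF test])
  ultimately have "(LINT x|lebesgue. u x * of_real (indicator (hbox a c) x)) = 0"
    by (simp add: LIMSEQ_const_iff)
  then show ?thesis by (simp add: scaleR_conv_of_real mult.commute)
qed

lemma test_orthogonal_zero:
  fixes u :: "'a :: euclidean_space \<Rightarrow> complex"
  assumes u: "sq_integrable u"
    and orth: "\<And>\<psi>. test_function \<psi> \<Longrightarrow> (LINT x|lebesgue. u x * of_real (\<psi> x)) = 0"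
  shows "AE x in lebesgue. u x = 0"
proof (rule integral_zero_on_cubes)
  fix k x
  show "integrable lebesgue (\<lambda>y. indicator (cube k x) y *\<^sub>R u y)" by (rule integrable_cube_sq[OF u])
  show "(LINT y|lebesgue. indicator (cube k x) y *\<^sub>R u y) = 0"
    unfolding cube_eq_hbox by (rule test_orthogonal_box[OF u _ orth]) (auto simp: inner_add_left)
qed

lemma hbox_translate: "x - v \<in> hbox a c \<longleftrightarrow> x \<in> hbox (a + v) (c + v)"
  by (auto simp: hbox_def inner_diff_left inner_add_left algebra_simps)

text \<open>
  The test functions are products of smoothed indicators, except that the factor in direction \<open>b\<close>
  is a primitive of the difference of the smoothed indicators of two translated intervals. Its
  derivative is thus an approximate difference of indicators of boxes.
\<close>

lemma weak_deriv_shift: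
  fixes f g :: "'a :: euclidean_space L2"
  assumes fg: "is_weak_deriv b f g" and b: "b \<in> Basis" and t: "t \<ge> 0"
    and ac: "\<And>i. i \<in> Basis \<Longrightarrow> a \<bullet> i < c \<bullet> i"
  shows "cmod ((LINT x|lebesgue. indicator (hbox (a + t *\<^sub>R b) (c + t *\<^sub>R b)) x *\<^sub>R rep_L2 f x)
      - (LINT x|lebesgue. indicator (hbox a c) x *\<^sub>R rep_L2 f x))
    \<le> t * (LINT x|lebesgue. indicator (hbox a (c + t *\<^sub>R b)) x * cmod (rep_L2 g x))"
proof -
  let ?v = "t *\<^sub>R b"
  have vi: "?v \<bullet> i = (if i = b then t else 0)" if "i \<in> Basis" for i
    using that b by (simp add: inner_Basis)
  have v0: "?v \<bullet> i \<ge> 0" if "i \<in> Basis" for i using vi[OF that] t by simp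
  obtain \<eta> where "\<forall>i\<in>Basis. interval_approx (a \<bullet> i) (c \<bullet> i) (\<eta> i)"
    using smooth_box_approx[of a c] ac by blast
  note \<eta> = box_approxD[OF this]
  have "\<exists>\<zeta>. (\<forall>k. smooth_k k \<zeta>) \<and> (\<forall>s. (\<zeta> has_real_derivative \<eta> b n (s - t) - \<eta> b n s) (at s))
      \<and> (\<forall>s. \<bar>\<zeta> s\<bar> \<le> t) \<and> (\<forall>s. s \<notin> {a \<bullet> b - eps n..<c \<bullet> b + t} \<longrightarrow> \<zeta> s = 0)" for n
    using smooth_translate_primitive[of "\<eta> b n", OF \<eta>(1)[OF b] \<eta>(2)[OF b] \<eta>(3)[OF b] \<eta>(4)[OF b] t] by metis
  then obtain \<zeta> where \<zeta>: "\<And>n k. smooth_k k (\<zeta> n)"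
    "\<And>n s. (\<zeta> n has_real_derivative \<eta> b n (s - t) - \<eta> b n s) (at s)"
    "\<And>n s. \<bar>\<zeta> n s\<bar> \<le> t" "\<And>n s. s \<notin> {a \<bullet> b - eps n..<c \<bullet> b + t} \<Longrightarrow> \<zeta> n s = 0"
    by metis
  define A where "A = (\<lambda>n x::'a. \<Prod>i\<in>Basis. \<eta> i n (x \<bullet> i))"
  define \<rho> where "\<rho> = (\<lambda>n i. if i = b then \<zeta> n else \<eta> i n)"
  define \<psi> where "\<psi> = (\<lambda>n x::'a. \<Prod>i\<in>Basis. \<rho> n i (x \<bullet> i))"
  let ?l = "\<lambda>n. a - eps n *\<^sub>R One"
  let ?K = "hbox (a - One) (c + ?v)"
  have A01: "0 \<le> A n x" "A n x \<le> 1" for n x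
    unfolding A_def using \<eta>(2,3) by (intro prod_unit_interval; simp)+
  have A0: "A n x = 0" if nx: "x \<notin> hbox (?l n) c" for n x
  proof -
    obtain i where i': "i \<in> Basis" "x \<bullet> i \<notin> {?l n \<bullet> i..<c \<bullet> i}"
      using nx unfolding not_in_hbox by blast
    then have i: "i \<in> Basis" "x \<bullet> i \<notin> {a \<bullet> i - eps n..<c \<bullet> i}"
      by (auto simp: inner_diff_left)
    then show ?thesis unfolding A_def using \<eta>(4)[OF i] by (intro prod_zero) auto
  qed
  have \<rho>_smooth: "smooth_k k (\<rho> n i)" if "i \<in> Basis" for k n i
    using \<eta>(1)[OF that] \<zeta>(1) by (simp add: \<rho>_def)
  have \<rho>_supp: "\<rho> n i s = 0" if "i \<in> Basis" "s \<notin> {?l n \<bullet> i..<(c + ?v) \<bullet> i}" for n i s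
    using \<eta>(4)[of i s n] \<zeta>(4)[of s n] that vi[OF that(1)] by (auto simp: \<rho>_def inner_diff_left inner_add_left inner_Basis)
  have test: "test_function (\<psi> n)" for n
    unfolding \<psi>_def
    by (rule test_function_prod[where l="\<lambda>i. ?l n \<bullet> i" and u="\<lambda>i. (c + ?v) \<bullet> i"])
      (use \<rho>_smooth \<rho>_supp in auto)
  \<comment> \<open>Translation along \<open>b\<close> leaves the other factors unchanged, so the
    difference in the factor of \<open>b\<close> becomes a difference of two translates of the whole
    product.\<close>
  have dpsi: "partial_deriv b (\<psi> n) x = A n (x - ?v) - A n x" for n x
  proof -
    have "\<forall>i\<in>Basis. \<exists>h. \<forall>s. (\<rho> n i has_real_derivative h s) (at s)"
    proof
      fix i :: 'a assume "i \<in> Basis"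
      from \<rho>_smooth[OF this, of "Suc 0" n] obtain h where "\<forall>s. (\<rho> n i has_real_derivative h s) (at s)"
        by auto
      then show "\<exists>h. \<forall>s. (\<rho> n i has_real_derivative h s) (at s)" by (intro exI[of _ h])
    qed
    from bchoice[OF this] obtain h where h: "\<forall>i\<in>Basis. \<forall>s. (\<rho> n i has_real_derivative h i s) (at s)" ..
    have hb: "h b s = \<eta> b n (s - t) - \<eta> b n s" for s
    proof (rule DERIV_unique)
      show "(\<zeta> n has_real_derivative h b s) (at s)" using h[rule_format, OF b, of s] by (simp add: \<rho>_def)
    qed (rule \<zeta>(2))
    have "partial_deriv b (\<psi> n) x = (\<Prod>i\<in>Basis. (if i = b then h i else \<rho> n i) (x \<bullet> i))"
      unfolding \<psi>_def using h b by (intro prod_has_partial_deriv(2)) auto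
    also have "\<dots> = h b (x \<bullet> b) * (\<Prod>i\<in>Basis - {b}. \<eta> i n (x \<bullet> i))"
      using b by (subst prod.remove[of _ b]) (auto intro!: prod.cong simp: \<rho>_def)
    also have "\<dots> = \<eta> b n ((x - ?v) \<bullet> b) * (\<Prod>i\<in>Basis - {b}. \<eta> i n ((x - ?v) \<bullet> i))
        - \<eta> b n (x \<bullet> b) * (\<Prod>i\<in>Basis - {b}. \<eta> i n (x \<bullet> i))"
    proof -
      have "(\<Prod>i\<in>Basis - {b}. \<eta> i n ((x - ?v) \<bullet> i)) = (\<Prod>i\<in>Basis - {b}. \<eta> i n (x \<bullet> i))"
        by (rule prod.cong) (auto simp: inner_diff_left inner_Basis b)
      then show ?thesis using b by (simp add: hb inner_diff_left left_diff_distrib)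
    qed
    also have "\<dots> = A n (x - ?v) - A n x"
      unfolding A_def using b by (simp add: prod.remove[of Basis b])
    finally show ?thesis .
  qed
  \<comment> \<open>The factor \<zeta> contributes \<open>t\<close> and the remaining factors at
    most 1; this is the origin of the factor \<open>t\<close> in the conclusion.\<close>
  have psi_le: "\<bar>\<psi> n x\<bar> \<le> t * indicator (hbox (?l n) (c + ?v)) x" for n x
  proof (cases "x \<in> hbox (?l n) (c + ?v)")
    case True
    have "\<bar>\<psi> n x\<bar> = \<bar>\<zeta> n (x \<bullet> b)\<bar> * (\<Prod>i\<in>Basis - {b}. \<eta> i n (x \<bullet> i))"
      unfolding \<psi>_def using b \<eta>(2)
      by (subst prod.remove[of _ b]) (auto intro!: prod.cong simp: \<rho>_def abs_mult abs_prod)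
    also have "\<dots> \<le> t * 1"
      using \<zeta>(3) \<eta>(2,3) t by (intro mult_mono prod_unit_interval) auto
    finally show ?thesis using True by simp
  next
    case False
    then obtain i where "i \<in> Basis" "x \<bullet> i \<notin> {?l n \<bullet> i..<(c + ?v) \<bullet> i}" unfolding not_in_hbox by blast
    then have "\<psi> n x = 0" unfolding \<psi>_def using \<rho>_supp by (intro prod_zero) auto
    with False show ?thesis by simp
  qed
  have Am [measurable]: "A n \<in> borel_measurable lebesgue" "(\<lambda>x. A n (x - ?v)) \<in> borel_measurable lebesgue" for n
  proof -
    have "C_k 0 (A n)" unfolding A_def by (rule C_k_prod) (rule \<eta>(1))
    then have c: "continuous_on UNIV (A n)" by simp
    then show "A n \<in> borel_measurable lebesgue" by (rule continuous_lebesgue_measurable)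
    have "continuous_on UNIV (\<lambda>x. A n (x - ?v))"
      by (rule continuous_on_compose2[OF c]) (auto intro!: continuous_intros)
    then show "(\<lambda>x. A n (x - ?v)) \<in> borel_measurable lebesgue" by (rule continuous_lebesgue_measurable)
  qed
  have psim [measurable]: "\<psi> n \<in> borel_measurable lebesgue" for n
    using test[of n] by (intro continuous_lebesgue_measurable) (metis C_k.simps(1) test_function_def)
  have lhs: "(\<lambda>n. LINT x|lebesgue. rep_L2 f x * of_real (partial_deriv b (\<psi> n) x))
      \<longlonglongrightarrow> (LINT x|lebesgue. rep_L2 f x * of_real (indicator (hbox (a + ?v) (c + ?v)) x - indicator (hbox a c) x))"
  proof (rule integral_dominated_convergence[where w="\<lambda>x. norm (indicator ?K x *\<^sub>R rep_L2 f x)"])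
    show "integrable lebesgue (\<lambda>x. norm (indicator ?K x *\<^sub>R rep_L2 f x))"
      by (rule integrable_norm_hbox_rep)
    show "AE x in lebesgue. (\<lambda>n. rep_L2 f x * of_real (partial_deriv b (\<psi> n) x)) \<longlonglongrightarrow>
        rep_L2 f x * of_real (indicator (hbox (a + ?v) (c + ?v)) x - indicator (hbox a c) x)"
    proof (intro AE_I2 tendsto_intros)
      fix x
      have "(\<lambda>n. A n (x - ?v) - A n x) \<longlonglongrightarrow> indicator (hbox a c) (x - ?v) - indicator (hbox a c) x"
        unfolding A_def by (intro tendsto_diff \<eta>(5))
      then show "(\<lambda>n. partial_deriv b (\<psi> n) x) \<longlonglongrightarrow> indicator (hbox (a + ?v) (c + ?v)) x - indicator (hbox a c) x"
        unfolding dpsi by (simp add: indicator_def hbox_translate)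
    qed
    fix n
    show "AE x in lebesgue. norm (rep_L2 f x * of_real (partial_deriv b (\<psi> n) x)) \<le> norm (indicator ?K x *\<^sub>R rep_L2 f x)"
    proof (intro AE_I2)
      fix x
      have n1: "eps n \<le> 1" by (rule eps_le_1)
      have "\<bar>A n (x - ?v) - A n x\<bar> \<le> indicator ?K x"
      proof (cases "x \<in> ?K")
        case True
        then show ?thesis using A01[of n x] A01[of n "x - ?v"] by simp
      next
        case False
        then obtain i where i': "i \<in> Basis" "x \<bullet> i \<notin> {(a - One) \<bullet> i..<(c + ?v) \<bullet> i}"
          unfolding not_in_hbox by blast
        then have i: "x \<bullet> i < a \<bullet> i - 1 \<or> c \<bullet> i + ?v \<bullet> i \<le> x \<bullet> i"
          by (auto simp: inner_diff_left inner_add_left)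
        have "x \<bullet> i \<notin> {?l n \<bullet> i..<c \<bullet> i}"
          using i n1 v0[OF i'(1)] i'(1) by (auto simp: inner_diff_left)
        then have "x \<notin> hbox (?l n) c" using i'(1) unfolding not_in_hbox by blast
        moreover have "(x - ?v) \<bullet> i \<notin> {?l n \<bullet> i..<c \<bullet> i}"
          using i n1 v0[OF i'(1)] i'(1) by (auto simp: inner_diff_left)
        then have "x - ?v \<notin> hbox (?l n) c" using i'(1) unfolding not_in_hbox by blast
        ultimately show ?thesis using A0 by simp
      qed
      then show "norm (rep_L2 f x * of_real (partial_deriv b (\<psi> n) x)) \<le> norm (indicator ?K x *\<^sub>R rep_L2 f x)"
        unfolding dpsi norm_mult norm_of_real norm_scaleR
        by (subst mult.commute) (auto intro!: mult_right_mono)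
    qed
  qed (auto simp: dpsi)
  \<comment> \<open>The overhang on the left shrinks to nothing and the boxes are closed on the
    left, so their intersection is exactly the half-open box.\<close>
  have hK: "(\<lambda>n. indicator (hbox (?l n) (c + ?v)) x :: real) \<longlonglongrightarrow> indicator (hbox a (c + ?v)) x" for x
  proof -
    have "decseq (\<lambda>n. hbox (?l n) (c + ?v))"
    proof (rule decseq_SucI, rule subsetI)
      fix n y assume y: "y \<in> hbox (?l (Suc n)) (c + ?v)"
      have "eps (Suc n) \<le> eps n" by (rule eps_Suc_le)
      then show "y \<in> hbox (?l n) (c + ?v)" using y
        by (auto simp: hbox_def inner_diff_left)
    qed
    from LIMSEQ_indicator_decseq[OF this]
    have "(\<lambda>n. indicator (hbox (?l n) (c + ?v)) x :: real) \<longlonglongrightarrow> indicator (\<Inter>n. hbox (?l n) (c + ?v)) x" .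
    also have "(\<Inter>n. hbox (?l n) (c + ?v)) = hbox a (c + ?v)"
    proof
      show "(\<Inter>n. hbox (?l n) (c + ?v)) \<subseteq> hbox a (c + ?v)"
      proof
        fix y assume y: "y \<in> (\<Inter>n. hbox (?l n) (c + ?v))"
        have "a \<bullet> i \<le> y \<bullet> i" if i: "i \<in> Basis" for i
        proof (rule ccontr)
          assume "\<not> ?thesis"
          then obtain n where "eps n < a \<bullet> i - y \<bullet> i" using eps_small[of "a \<bullet> i - y \<bullet> i"] by auto
          moreover have "a \<bullet> i - eps n \<le> y \<bullet> i" using y i by (auto simp: hbox_def inner_diff_left)
          ultimately show False by linarith
        qed
        then show "y \<in> hbox a (c + ?v)" using y by (auto simp: hbox_def)
      qed
      have "a \<bullet> i - eps n \<le> z" if "a \<bullet> i \<le> z" for i n z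
      proof -
        have "0 \<le> eps n" using eps_pos[of n] by simp
        with that show ?thesis by linarith
      qed
      then show "hbox a (c + ?v) \<subseteq> (\<Inter>n. hbox (?l n) (c + ?v))"
        by (auto simp: hbox_def inner_diff_left)
    qed
    finally show ?thesis .
  qed
  have rhs: "(\<lambda>n. LINT x|lebesgue. indicator (hbox (?l n) (c + ?v)) x * cmod (rep_L2 g x))
      \<longlonglongrightarrow> (LINT x|lebesgue. indicator (hbox a (c + ?v)) x * cmod (rep_L2 g x))"
  proof (rule integral_dominated_convergence[where w="\<lambda>x. norm (indicator ?K x *\<^sub>R rep_L2 g x)"])
    show "integrable lebesgue (\<lambda>x. norm (indicator ?K x *\<^sub>R rep_L2 g x))"
      by (rule integrable_norm_hbox_rep)
    show "AE x in lebesgue. (\<lambda>n. indicator (hbox (?l n) (c + ?v)) x * cmod (rep_L2 g x))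
        \<longlonglongrightarrow> indicator (hbox a (c + ?v)) x * cmod (rep_L2 g x)"
      by (intro AE_I2 tendsto_mult hK tendsto_const)
    fix n
    have "hbox (?l n) (c + ?v) \<subseteq> ?K"
    proof
      fix y assume y: "y \<in> hbox (?l n) (c + ?v)"
      have "eps n \<le> 1" by (rule eps_le_1)
      then show "y \<in> ?K" using y by (auto simp: hbox_def inner_diff_left)
    qed
    then show "AE x in lebesgue. norm (indicator (hbox (?l n) (c + ?v)) x * cmod (rep_L2 g x))
        \<le> norm (indicator ?K x *\<^sub>R rep_L2 g x)"
      by (intro AE_I2) (auto simp: indicator_def)
  qed measurable
  have "cmod (LINT x|lebesgue. rep_L2 f x * of_real (partial_deriv b (\<psi> n) x))
      \<le> t * (LINT x|lebesgue. indicator (hbox (?l n) (c + ?v)) x * cmod (rep_L2 g x))" for n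
  proof -
    have "(LINT x|lebesgue. rep_L2 f x * of_real (partial_deriv b (\<psi> n) x))
        = - (LINT x|lebesgue. rep_L2 g x * of_real (\<psi> n x))"
      using fg test[of n] by (simp add: is_weak_deriv_def)
    then have "cmod (LINT x|lebesgue. rep_L2 f x * of_real (partial_deriv b (\<psi> n) x))
        \<le> (LINT x|lebesgue. cmod (rep_L2 g x * of_real (\<psi> n x)))"
      using integral_norm_bound[of lebesgue "\<lambda>x. rep_L2 g x * of_real (\<psi> n x)"] by simp
    also have "\<dots> \<le> (LINT x|lebesgue. t * (indicator (hbox (?l n) (c + ?v)) x * cmod (rep_L2 g x)))"
    proof (rule integral_mono_AE)
      have i: "integrable lebesgue (\<lambda>x. norm (indicator (hbox (?l n) (c + ?v)) x *\<^sub>R rep_L2 g x))"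
        by (rule integrable_norm_hbox_rep)
      then show I: "integrable lebesgue (\<lambda>x. t * (indicator (hbox (?l n) (c + ?v)) x * cmod (rep_L2 g x)))"
        by (intro integrable_mult_right) simp
      show le: "AE x in lebesgue. cmod (rep_L2 g x * of_real (\<psi> n x))
          \<le> t * (indicator (hbox (?l n) (c + ?v)) x * cmod (rep_L2 g x))"
      proof (intro AE_I2)
        fix x
        show "cmod (rep_L2 g x * of_real (\<psi> n x)) \<le> t * (indicator (hbox (?l n) (c + ?v)) x * cmod (rep_L2 g x))"
          using mult_right_mono[OF psi_le[of n x], of "cmod (rep_L2 g x)"] by (simp add: norm_mult mult_ac)
      qed
      have "integrable lebesgue (\<lambda>x. rep_L2 g x * of_real (\<psi> n x))"
        by (rule Bochner_Integration.integrable_bound[OF I])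
          (use le t in \<open>auto elim!: eventually_mono\<close>)
      then show "integrable lebesgue (\<lambda>x. cmod (rep_L2 g x * of_real (\<psi> n x)))" by (rule integrable_norm)
    qed
    finally show ?thesis by simp
  qed
  then have le: "cmod (LINT x|lebesgue. rep_L2 f x * of_real (indicator (hbox (a + ?v) (c + ?v)) x - indicator (hbox a c) x))
      \<le> t * (LINT x|lebesgue. indicator (hbox a (c + ?v)) x * cmod (rep_L2 g x))"
    by (intro LIMSEQ_le[OF tendsto_norm[OF lhs] tendsto_mult[OF tendsto_const rhs]]) auto
  have i: "integrable lebesgue (\<lambda>x. indicator (hbox p q) x *\<^sub>R rep_L2 f x)" for p q
    by (rule integrable_hbox_rep)
  have "(LINT x|lebesgue. rep_L2 f x * of_real (indicator (hbox (a + ?v) (c + ?v)) x - indicator (hbox a c) x))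
      = (LINT x|lebesgue. indicator (hbox (a + ?v) (c + ?v)) x *\<^sub>R rep_L2 f x)
        - (LINT x|lebesgue. indicator (hbox a c) x *\<^sub>R rep_L2 f x)"
    by (subst Bochner_Integration.integral_diff[OF i i, symmetric])
      (simp add: scaleR_conv_of_real algebra_simps)
  with le show ?thesis by simp
qed

section \<open>Weak differentiation as a closed linear relation\<close>

lemma test_function_sq_integrable:
  fixes \<psi> :: "'a :: euclidean_space \<Rightarrow> real"
  assumes "test_function \<psi>"
  shows "sq_integrable (\<lambda>x. complex_of_real (\<psi> x))"
proof -
  let ?K = "closure {x. \<psi> x \<noteq> 0}"
  have c: "continuous_on UNIV \<psi>" and K: "compact ?K"
    using assms C_k.simps(1) unfolding test_function_def by blast+
  note [measurable] = continuous_lebesgue_measurable[OF c]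
  have "bounded (\<psi> ` ?K)"
    using c K by (meson compact_continuous_image compact_imp_bounded continuous_on_subset subset_UNIV)
  then obtain B where B: "\<And>x. x \<in> ?K \<Longrightarrow> \<bar>\<psi> x\<bar> \<le> B" unfolding bounded_iff by auto
  have Kfin: "emeasure lebesgue ?K < \<infinity>" and Km: "?K \<in> sets lebesgue"
    using K emeasure_compact_finite[OF K] by (auto simp: compact_imp_closed)
  have "sq_integrable (\<lambda>x. complex_of_real B * complex_of_real (indicator ?K x))"
    by (intro sq_integrable_mult sq_integrable_indicator Kfin Km)
  then show ?thesis
  proof (rule sq_integrable_bound)
    have "cmod (complex_of_real (\<psi> x)) \<le> cmod (complex_of_real B * complex_of_real (indicator ?K x))" for x
    proof (cases "\<psi> x = 0")
      case False
      then have "x \<in> ?K" by (intro subsetD[OF closure_subset]) simp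
      then show ?thesis using B[of x] by simp
    qed simp
    then show "AE x in lebesgue. cmod (complex_of_real (\<psi> x)) \<le> cmod (complex_of_real B * complex_of_real (indicator ?K x))"
      by simp
  qed measurable
qed

lemma test_function_partial_deriv:
  fixes \<psi> :: "'a :: euclidean_space \<Rightarrow> real"
  assumes "test_function \<psi>" "b \<in> Basis"
  shows "test_function (partial_deriv b \<psi>)"
proof -
  let ?K = "closure {x. \<psi> x \<noteq> 0}"
  have K: "compact ?K" using assms by (simp add: test_function_def)
  have "C_k k (partial_deriv b \<psi>)" for k
  proof -
    have "C_k (Suc k) \<psi>" using assms(1) unfolding test_function_def by blast
    then show ?thesis using assms(2) by simp
  qed
  moreover have "partial_deriv b \<psi> x = 0" if "x \<notin> ?K" for x
  proof -
    have "frechet_derivative (\<lambda>x. 0) (at x) = frechet_derivative \<psi> (at x)"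
    proof (rule frechet_derivative_transform_within_open)
      show "open (- ?K)" by (simp add: open_Compl)
      show "0 = \<psi> y" if "y \<in> - ?K" for y
        using that subsetD[OF closure_subset, of y "{x. \<psi> x \<noteq> 0}"] by auto
    qed (use that in auto)
    then show ?thesis by (simp add: partial_deriv_def fun_eq_iff)
  qed
  then have "closure {x. partial_deriv b \<psi> x \<noteq> 0} \<subseteq> ?K" by (intro closure_minimal) auto
  then have "compact (closure {x. partial_deriv b \<psi> x \<noteq> 0})"
    using K compact_Int_closed[of ?K "closure {x. partial_deriv b \<psi> x \<noteq> 0}"]
    by (simp add: Int_absorb1)
  ultimately show ?thesis by (simp add: test_function_def)
qed

lemma integral_rep_eq_L2_inner:
  assumes "sq_integrable v"
  shows "(LINT x|lebesgue. rep_L2 f x * v x) = L2_inner f (abs_L2 (\<lambda>x. cnj (v x)))"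
  unfolding L2_inner_def
proof (rule integral_cong_AE)
  note v = sq_integrable_cnj[OF assms]
  show "AE x in lebesgue. rep_L2 f x * v x = rep_L2 f x * cnj (rep_L2 (abs_L2 (\<lambda>x. cnj (v x))) x)"
    using rep_abs_L2[OF v] by eventually_elim simp
qed (use assms in \<open>auto simp: sq_integrable_def intro!: borel_measurable_times measurable_cnj rep_measurable\<close>)

text \<open>With the test functions and their derivatives as fixed elements of the space, the
  defining identity is linear and continuous in the pair (f, g). Sums, multiples and limits of weak
  derivatives follow at once.\<close>

lemma is_weak_deriv_inner:
  assumes "b \<in> Basis"
  shows "is_weak_deriv b f g \<longleftrightarrow> (\<forall>\<psi>. test_function \<psi> \<longrightarrow>
    L2_inner f (abs_L2 (\<lambda>x. of_real (partial_deriv b \<psi> x))) = - L2_inner g (abs_L2 (\<lambda>x. of_real (\<psi> x))))"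
  unfolding is_weak_deriv_def
  by (auto simp: integral_rep_eq_L2_inner[OF test_function_sq_integrable]
    integral_rep_eq_L2_inner[OF test_function_sq_integrable[OF test_function_partial_deriv[OF _ assms]]])

lemma L2_inner_zero_left: "L2_inner 0 h = 0"
  using L2_inner_add_left[of 0 0 h] by simp

lemma is_weak_deriv_zero: "b \<in> Basis \<Longrightarrow> is_weak_deriv b 0 0"
  by (simp add: is_weak_deriv_inner L2_inner_zero_left)

lemma is_weak_deriv_add:
  "b \<in> Basis \<Longrightarrow> is_weak_deriv b f g \<Longrightarrow> is_weak_deriv b f' g' \<Longrightarrow> is_weak_deriv b (f + f') (g + g')"
  by (simp add: is_weak_deriv_inner L2_inner_add_left)

lemma is_weak_deriv_scaleC:
  "b \<in> Basis \<Longrightarrow> is_weak_deriv b f g \<Longrightarrow> is_weak_deriv b (c *\<^sub>C f) (c *\<^sub>C g)"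
  by (simp add: is_weak_deriv_inner L2_inner_scaleC_left)

lemma L2_inner_bound: "cmod (L2_inner f g) \<le> norm f * norm g"
proof -
  have "cmod (L2_inner f g) \<le> (LINT x|lebesgue. cmod (rep_L2 f x) * cmod (rep_L2 g x))"
    unfolding L2_inner_def
    using integral_norm_bound[of lebesgue "\<lambda>x. rep_L2 f x * cnj (rep_L2 g x)"] by (simp add: norm_mult)
  also have "\<dots> \<le> norm f * norm g"
    using sq_integrable_Cauchy_Schwarz[OF sq_integrable_rep[of f] sq_integrable_rep[of g]]
    by (simp add: norm_L2_sq[symmetric])
  finally show ?thesis .
qed

lemma L2_inner_diff_left: "L2_inner (f - g) h = L2_inner f h - L2_inner g h"
  using L2_inner_add_left[of "f - g" g h] by simp

lemma tendsto_L2_inner: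
  assumes "F \<longlonglongrightarrow> f"
  shows "(\<lambda>n. L2_inner (F n) h) \<longlonglongrightarrow> L2_inner f h"
proof -
  have "(\<lambda>n. norm (F n - f) * norm h) \<longlonglongrightarrow> 0"
    using assms by (auto intro!: tendsto_eq_intros tendsto_norm_zero simp: LIM_zero_iff)
  then have "(\<lambda>n. L2_inner (F n - f) h) \<longlonglongrightarrow> 0"
    by (rule Lim_null_comparison[rotated]) (intro always_eventually allI L2_inner_bound)
  then show ?thesis by (simp add: L2_inner_diff_left LIM_zero_iff)
qed

lemma is_weak_deriv_limit:
  assumes "b \<in> Basis" "\<And>n. is_weak_deriv b (F n) (G n)" "F \<longlonglongrightarrow> f" "G \<longlonglongrightarrow> g"
  shows "is_weak_deriv b f g"
  unfolding is_weak_deriv_inner[OF assms(1)]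
proof (intro allI impI)
  fix \<psi> :: "'a \<Rightarrow> real" assume \<psi>: "test_function \<psi>"
  have "(\<lambda>n. L2_inner (F n) (abs_L2 (\<lambda>x. of_real (partial_deriv b \<psi> x))))
      \<longlonglongrightarrow> - L2_inner g (abs_L2 (\<lambda>x. of_real (\<psi> x)))"
    using tendsto_minus[OF tendsto_L2_inner[OF assms(4)]] assms(2) \<psi>
    by (simp add: is_weak_deriv_inner[OF assms(1)])
  with tendsto_L2_inner[OF assms(3)]
  show "L2_inner f (abs_L2 (\<lambda>x. of_real (partial_deriv b \<psi> x))) = - L2_inner g (abs_L2 (\<lambda>x. of_real (\<psi> x)))"
    by (rule LIMSEQ_unique)
qed

text \<open>Test functions separate square integrable functions. This gives the definite description
  in \<open>weak_deriv\<close> its meaning.\<close>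

lemma is_weak_deriv_unique:
  assumes "b \<in> Basis" "is_weak_deriv b f g" "is_weak_deriv b f g'"
  shows "g = g'"
proof -
  have "AE x in lebesgue. rep_L2 (g - g') x = 0"
  proof (rule test_orthogonal_zero[OF sq_integrable_rep])
    fix \<psi> :: "'a \<Rightarrow> real" assume \<psi>: "test_function \<psi>"
    show "(LINT x|lebesgue. rep_L2 (g - g') x * of_real (\<psi> x)) = 0"
      using assms \<psi>
      by (simp add: integral_rep_eq_L2_inner[OF test_function_sq_integrable[OF \<psi>]]
          is_weak_deriv_inner[OF assms(1)] L2_inner_diff_left)
  qed
  with rep_minus[of g g'] have "AE x in lebesgue. rep_L2 g x = rep_L2 g' x"
    by eventually_elim simp
  then show ?thesis by (rule L2_eqI)
qed

lemma weak_deriv_eq: "b \<in> Basis \<Longrightarrow> is_weak_deriv b f g \<Longrightarrow> weak_deriv b f = g"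
  unfolding weak_deriv_def using is_weak_deriv_unique by (intro the_equality) blast+

lemma weak_deriv: "f \<in> H1 \<Longrightarrow> b \<in> Basis \<Longrightarrow> is_weak_deriv b f (weak_deriv b f)"
  using weak_deriv_eq unfolding H1_def by fastforce

section \<open>Oscillation of the averages within a parent cube\<close>

lemma floor_double:
  assumes "\<lfloor>2 ^ k * s\<rfloor> = M"
  shows "\<lfloor>2 ^ Suc k * s\<rfloor> = 2 * M \<or> \<lfloor>2 ^ Suc k * (s::real)\<rfloor> = 2 * M + 1"
proof -
  have "2 ^ Suc k * s = 2 * (2 ^ k * s)" by simp
  then show ?thesis using assms by linarith
qed

text \<open>Left without the volume factor because the shift estimate compares plain
  integrals.\<close>

definition cube_integral :: "('a :: euclidean_space \<Rightarrow> complex) \<Rightarrow> nat \<Rightarrow> 'a \<Rightarrow> complex" where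
  "cube_integral u k x = (LINT y|lebesgue. indicator (cube k x) y *\<^sub>R u y)"

text \<open>The subcubes of \<open>z\<close> and \<open>w\<close> are adjacent in direction
  \<open>b\<close>, and the upper one is the translate of the lower by their side length. The box
  swept by the translation stays inside the parent \<open>cube k x\<close>, so the gradient is
  integrated over the parent only.\<close>

lemma cube_integral_neighbour:
  fixes f g :: "'a :: euclidean_space L2"
  assumes wd: "is_weak_deriv b f g" and b: "b \<in> Basis"
    and z: "z \<in> cube k x" and w: "w \<in> cube k x"
    and eq: "\<And>i. i \<in> Basis \<Longrightarrow> i \<noteq> b \<Longrightarrow> z \<bullet> i = w \<bullet> i"
    and step: "\<lfloor>2 ^ Suc k * (w \<bullet> b)\<rfloor> = \<lfloor>2 ^ Suc k * (z \<bullet> b)\<rfloor> + 1"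
  shows "cmod (cube_integral (rep_L2 f) (Suc k) w - cube_integral (rep_L2 f) (Suc k) z)
    \<le> 1 / 2 ^ Suc k * (LINT y|lebesgue. indicator (cube k x) y * cmod (rep_L2 g y))"
proof -
  let ?h = "1 / 2 ^ Suc k :: real"
  let ?a = "corner (Suc k) z"
  let ?c = "?a + ?h *\<^sub>R One"
  have fl: "\<lfloor>2 ^ k * (z \<bullet> i)\<rfloor> = \<lfloor>2 ^ k * (x \<bullet> i)\<rfloor>" "\<lfloor>2 ^ k * (w \<bullet> i)\<rfloor> = \<lfloor>2 ^ k * (x \<bullet> i)\<rfloor>"
    if "i \<in> Basis" for i using z w that by (auto simp: cube_def)
  have cw: "corner (Suc k) w = ?a + ?h *\<^sub>R b"
  proof (rule euclidean_eqI)
    fix i :: 'a assume i: "i \<in> Basis"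
    show "corner (Suc k) w \<bullet> i = (?a + ?h *\<^sub>R b) \<bullet> i"
    proof (cases "i = b")
      case True
      then show ?thesis using b step by (simp add: corner_inner inner_add_left add_divide_distrib)
    next
      case False
      then show ?thesis using b i eq[OF i] by (simp add: corner_inner inner_add_left inner_Basis)
    qed
  qed
  have sub: "hbox ?a (?c + ?h *\<^sub>R b) \<subseteq> cube k x"
  proof
    fix y assume y: "y \<in> hbox ?a (?c + ?h *\<^sub>R b)"
    show "y \<in> cube k x" unfolding cube_def mem_Collect_eq
    proof
      fix i :: 'a assume i: "i \<in> Basis"
      let ?m = "\<lfloor>2 ^ Suc k * (z \<bullet> i)\<rfloor>" and ?M = "\<lfloor>2 ^ k * (x \<bullet> i)\<rfloor>"
      have lo: "real_of_int ?m / 2 ^ Suc k \<le> y \<bullet> i"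
        using y i by (auto simp: hbox_def corner_inner)
      have hi: "y \<bullet> i < real_of_int ?m / 2 ^ Suc k + ?h + (if i = b then ?h else 0)"
        using y i b by (auto simp: hbox_def corner_inner inner_add_left inner_Basis)
      have lo': "real_of_int ?m \<le> 2 * (2 ^ k * (y \<bullet> i))"
        using lo by (simp add: field_simps)
      have hi': "2 * (2 ^ k * (y \<bullet> i)) < real_of_int ?m + 1 + (if i = b then 1 else 0)"
        using hi by (simp add: field_simps split: if_splits)
      have mM: "?m = 2 * ?M \<or> ?m = 2 * ?M + 1" by (rule floor_double[OF fl(1)[OF i]])
      \<comment> \<open>In direction \<open>b\<close> the point \<open>z\<close> lies in the lower
        half, since otherwise \<open>w\<close>, one step above, would leave the parent cube. Without
        this the swept box would stick out.\<close>
      have "i = b \<Longrightarrow> ?m = 2 * ?M"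
        using floor_double[OF fl(2)[OF i]] mM step by auto
      then have "2 * real_of_int ?M \<le> real_of_int ?m \<and> real_of_int ?m + 1 + (if i = b then 1 else 0) \<le> 2 * real_of_int ?M + 2"
        using mM by auto
      then have "real_of_int ?M \<le> 2 ^ k * (y \<bullet> i)" "2 ^ k * (y \<bullet> i) < real_of_int ?M + 1"
        using lo' hi' by linarith+
      then show "\<lfloor>2 ^ k * (y \<bullet> i)\<rfloor> = ?M" by (intro floor_unique) auto
    qed
  qed
  have "cmod (cube_integral (rep_L2 f) (Suc k) w - cube_integral (rep_L2 f) (Suc k) z)
      \<le> ?h * (LINT y|lebesgue. indicator (hbox ?a (?c + ?h *\<^sub>R b)) y * cmod (rep_L2 g y))"
  proof -
    have ac: "?a \<bullet> i < ?c \<bullet> i" if "i \<in> Basis" for i using that by (simp add: inner_add_left)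
    have "?c + ?h *\<^sub>R b = (?a + ?h *\<^sub>R b) + ?h *\<^sub>R One" by (simp add: algebra_simps)
    then have 1: "cube (Suc k) w = hbox (?a + ?h *\<^sub>R b) (?c + ?h *\<^sub>R b)" by (simp only: cube_eq_hbox cw)
    have 2: "cube (Suc k) z = hbox ?a ?c" by (simp only: cube_eq_hbox)
    show ?thesis unfolding cube_integral_def 1 2
      by (rule weak_deriv_shift[OF wd b _ ac]) auto
  qed
  also have "\<dots> \<le> ?h * (LINT y|lebesgue. indicator (cube k x) y * cmod (rep_L2 g y))"
  proof (rule mult_left_mono[OF integral_mono])
    show "integrable lebesgue (\<lambda>y. indicator (hbox ?a (?c + ?h *\<^sub>R b)) y * cmod (rep_L2 g y))"
      using integrable_norm_hbox_rep[of ?a "?c + ?h *\<^sub>R b" g] by simp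
    show "integrable lebesgue (\<lambda>y. indicator (cube k x) y * cmod (rep_L2 g y))"
      using integrable_norm_hbox_rep[of "corner k x" "corner k x + (1 / 2 ^ k) *\<^sub>R One" g]
      by (simp add: cube_eq_hbox)
    show "indicator (hbox ?a (?c + ?h *\<^sub>R b)) y * cmod (rep_L2 g y) \<le> indicator (cube k x) y * cmod (rep_L2 g y)" for y
      using sub by (auto simp: indicator_def)
  qed auto
  finally show ?thesis .
qed

text \<open>A parent interval has just two halves, so the floors of \<open>z\<close> and
  \<open>w\<close> in direction \<open>b\<close> agree or differ by one.\<close>

lemma cube_integral_step:
  fixes f g :: "'a :: euclidean_space L2"
  assumes wd: "is_weak_deriv b f g" and b: "b \<in> Basis"
    and z: "z \<in> cube k x" and w: "w \<in> cube k x"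
    and eq: "\<And>i. i \<in> Basis \<Longrightarrow> i \<noteq> b \<Longrightarrow> z \<bullet> i = w \<bullet> i"
  shows "cmod (cube_integral (rep_L2 f) (Suc k) w - cube_integral (rep_L2 f) (Suc k) z)
    \<le> 1 / 2 ^ Suc k * (LINT y|lebesgue. indicator (cube k x) y * cmod (rep_L2 g y))"
proof -
  let ?mz = "\<lfloor>2 ^ Suc k * (z \<bullet> b)\<rfloor>" and ?mw = "\<lfloor>2 ^ Suc k * (w \<bullet> b)\<rfloor>"
  let ?M = "\<lfloor>2 ^ k * (x \<bullet> b)\<rfloor>"
  have "\<lfloor>2 ^ k * (z \<bullet> b)\<rfloor> = ?M" "\<lfloor>2 ^ k * (w \<bullet> b)\<rfloor> = ?M" using z w b by (auto simp: cube_def)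
  from floor_double[OF this(1)] floor_double[OF this(2)]
  consider "?mw = ?mz" | "?mw = ?mz + 1" | "?mz = ?mw + 1" by linarith
  then show ?thesis
  proof cases
    case 1
    have "w \<in> cube (Suc k) z" unfolding cube_def mem_Collect_eq
    proof
      fix i :: 'a assume i: "i \<in> Basis"
      show "\<lfloor>2 ^ Suc k * (w \<bullet> i)\<rfloor> = \<lfloor>2 ^ Suc k * (z \<bullet> i)\<rfloor>"
        using 1 eq[OF i] by (cases "i = b") auto
    qed
    then have "cube (Suc k) w = cube (Suc k) z" by (rule cube_eq)
    then show ?thesis by (auto simp: cube_integral_def intro!: mult_nonneg_nonneg integral_nonneg_AE)
  next
    case 2
    then show ?thesis by (intro cube_integral_neighbour[OF wd b z w eq])
  next
    case 3
    then show ?thesis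
      using cube_integral_neighbour[OF wd b w z] eq by (simp add: norm_minus_commute)
  qed
qed

text \<open>The coordinates of \<open>x\<close> are replaced by those of \<open>y\<close> one at a
  time. The cube is a product, so every intermediate point \<open>z S\<close> stays in it and each
  change costs one directional term.\<close>

lemma cube_integral_path:
  fixes f :: "'a :: euclidean_space L2"
  assumes wd: "\<And>b. b \<in> Basis \<Longrightarrow> is_weak_deriv b f (g b)" and y: "y \<in> cube k x"
  shows "cmod (cube_integral (rep_L2 f) (Suc k) y - cube_integral (rep_L2 f) (Suc k) x)
    \<le> (\<Sum>b\<in>Basis. 1 / 2 ^ Suc k * (LINT t|lebesgue. indicator (cube k x) t * cmod (rep_L2 (g b) t)))"
proof -
  define z where "z = (\<lambda>S. \<Sum>i\<in>Basis. (if i \<in> S then y \<bullet> i else x \<bullet> i) *\<^sub>R i)"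
  have zi: "z S \<bullet> i = (if i \<in> S then y \<bullet> i else x \<bullet> i)" if "i \<in> Basis" for S i
    using that by (simp add: z_def)
  have zc: "z S \<in> cube k x" for S
    using y by (auto simp: cube_def zi)
  have "cmod (cube_integral (rep_L2 f) (Suc k) (z S) - cube_integral (rep_L2 f) (Suc k) x)
    \<le> (\<Sum>b\<in>S. 1 / 2 ^ Suc k * (LINT t|lebesgue. indicator (cube k x) t * cmod (rep_L2 (g b) t)))"
    if "finite S" "S \<subseteq> Basis" for S
    using that
  proof (induction S rule: finite_induct)
    case empty
    have "z {} = x" by (rule euclidean_eqI) (simp add: zi)
    then show ?case by simp
  next
    case (insert b S)
    have "cmod (cube_integral (rep_L2 f) (Suc k) (z (insert b S)) - cube_integral (rep_L2 f) (Suc k) (z S))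
        \<le> 1 / 2 ^ Suc k * (LINT t|lebesgue. indicator (cube k x) t * cmod (rep_L2 (g b) t))"
      using insert.prems by (intro cube_integral_step[OF wd _ zc zc]) (auto simp: zi)
    moreover have "cmod (cube_integral (rep_L2 f) (Suc k) (z S) - cube_integral (rep_L2 f) (Suc k) x)
        \<le> (\<Sum>b\<in>S. 1 / 2 ^ Suc k * (LINT t|lebesgue. indicator (cube k x) t * cmod (rep_L2 (g b) t)))"
      using insert by auto
    ultimately show ?case
      using norm_triangle_le[of "cube_integral (rep_L2 f) (Suc k) (z (insert b S)) - cube_integral (rep_L2 f) (Suc k) (z S)"
          "cube_integral (rep_L2 f) (Suc k) (z S) - cube_integral (rep_L2 f) (Suc k) x"]
        insert.hyps by simp
  qed
  from this[of Basis] have "cmod (cube_integral (rep_L2 f) (Suc k) (z Basis) - cube_integral (rep_L2 f) (Suc k) x)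
    \<le> (\<Sum>b\<in>Basis. 1 / 2 ^ Suc k * (LINT t|lebesgue. indicator (cube k x) t * cmod (rep_L2 (g b) t)))" by simp
  moreover have "z Basis = y" by (rule euclidean_eqI) (simp add: zi)
  ultimately show ?thesis by simp
qed

lemma avg_eq_cube_integral:
  fixes x :: "'a :: euclidean_space"
  shows "avg k u x = (2 ^ k) ^ DIM('a) *\<^sub>R cube_integral u k x"
  by (simp add: avg_def cube_integral_def)

text \<open>By the tower property the coarse average is the mean of the fine averages over the
  parent cube, and so differs from each of them by at most their oscillation there.\<close>

lemma avg_increment:
  fixes f :: "'a :: euclidean_space L2"
  assumes wd: "\<And>b. b \<in> Basis \<Longrightarrow> is_weak_deriv b f (g b)"
  shows "cmod (avg (Suc k) (rep_L2 f) x - avg k (rep_L2 f) x)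
    \<le> 2 ^ DIM('a) / 2 ^ k * (\<Sum>b\<in>Basis. avg k (\<lambda>t. cmod (rep_L2 (g b) t)) x)"
proof -
  let ?u = "rep_L2 f" and ?d = "DIM('a)"
  let ?R = "2 ^ ?d / 2 ^ k * (\<Sum>b\<in>Basis. avg k (\<lambda>t. cmod (rep_L2 (g b) t)) x)"
  let ?v = "avg (Suc k) ?u"
  have R0: "?R \<ge> 0" by (intro mult_nonneg_nonneg sum_nonneg avg_nonneg) auto
  have point: "cmod (?v x - ?v y) \<le> ?R" if y: "y \<in> cube k x" for y
  proof -
    have "cmod (?v x - ?v y) = (2 ^ Suc k) ^ ?d * cmod (cube_integral ?u (Suc k) y - cube_integral ?u (Suc k) x)"
      unfolding avg_eq_cube_integral by (simp add: scaleR_diff_right[symmetric] norm_minus_commute)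
    also have "\<dots> \<le> (2 ^ Suc k) ^ ?d
        * (\<Sum>b\<in>Basis. 1 / 2 ^ Suc k * (LINT t|lebesgue. indicator (cube k x) t * cmod (rep_L2 (g b) t)))"
      by (intro mult_left_mono cube_integral_path[OF wd y]) auto
    \<comment> \<open>Renormalising leaves (2^(k+1))^d 2^(-(k+1)) 2^(-kd) = 2^d 2^(-k) / 2; the
      factor 1/2 is given away.\<close>
    also have "\<dots> = (1 / 2) * ?R"
      by (simp add: avg_def sum_distrib_left power_mult_distrib field_simps sum_divide_distrib)
    also have "\<dots> \<le> ?R" using R0 by simp
    finally show ?thesis .
  qed
  have int: "integrable lebesgue (\<lambda>y. indicator (cube k x) y *\<^sub>R ?u y)"
    by (rule integrable_cube_sq[OF sq_integrable_rep])
  note tower = avg_tower[OF _ int, of "Suc k"]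
  have ci: "integrable lebesgue (\<lambda>y. indicator (cube k x) y *\<^sub>R ?v x)" by simp
  have "avg k (\<lambda>y. ?v x - ?v y) x = ?v x - avg k ?u x"
  proof -
    have "(LINT y|lebesgue. indicator (cube k x) y *\<^sub>R (?v x - ?v y))
        = (LINT y|lebesgue. indicator (cube k x) y *\<^sub>R ?v x) - (LINT y|lebesgue. indicator (cube k x) y *\<^sub>R ?v y)"
      using tower(1) ci by (subst Bochner_Integration.integral_diff[symmetric]) (auto simp: scaleR_diff_right)
    also have "\<dots> = (1 / (2 ^ k) ^ ?d) *\<^sub>R ?v x - (LINT y|lebesgue. indicator (cube k x) y *\<^sub>R ?u y)"
      using tower(2) by (simp add: measure_cube)
    finally show ?thesis by (simp add: avg_def scaleR_diff_right)
  qed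
  moreover have "norm (avg k (\<lambda>y. ?v x - ?v y) x) \<le> ?R"
  proof -
    have i2: "integrable lebesgue (\<lambda>y. indicator (cube k x) y *\<^sub>R (?v x - ?v y))"
      using Bochner_Integration.integrable_diff[OF ci tower(1)] by (simp add: scaleR_diff_right)
    have "norm (LINT y|lebesgue. indicator (cube k x) y *\<^sub>R (?v x - ?v y))
        \<le> (LINT y|lebesgue. norm (indicator (cube k x) y *\<^sub>R (?v x - ?v y)))"
      by (rule integral_norm_bound)
    also have "\<dots> \<le> (LINT y|lebesgue. indicator (cube k x) y * ?R)"
      by (intro integral_mono integrable_norm i2 integrable_mult_left integrable_indicator_cube)
        (use point in \<open>auto simp: indicator_def\<close>)
    also have "\<dots> = ?R / (2 ^ k) ^ ?d" by (simp add: measure_cube)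
    finally show ?thesis unfolding avg_def norm_scaleR by (simp add: field_simps)
  qed
  ultimately show ?thesis by simp
qed

section \<open>Dyadic averages and the Sobolev embedding\<close>

definition grad_norm_sq :: "('a :: euclidean_space \<Rightarrow> 'a L2) \<Rightarrow> real" where
  "grad_norm_sq g = (\<Sum>b\<in>Basis. (norm (g b))\<^sup>2)"

lemma grad_norm_sq_nonneg: "grad_norm_sq g \<ge> 0"
  by (auto simp: grad_norm_sq_def intro: sum_nonneg)

definition weak_grad :: "'a :: euclidean_space L2 \<Rightarrow> ('a \<Rightarrow> 'a L2) \<Rightarrow> bool" where
  "weak_grad f g \<longleftrightarrow> (\<forall>b\<in>Basis. is_weak_deriv b f (g b))"

definition cube_avg :: "nat \<Rightarrow> 'a :: euclidean_space L2 \<Rightarrow> 'a L2" where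
  "cube_avg k f = abs_L2 (avg k (rep_L2 f))"

lemma rep_cube_avg: "AE x in lebesgue. rep_L2 (cube_avg k f) x = avg k (rep_L2 f) x"
  unfolding cube_avg_def by (rule rep_abs_L2[OF sq_integrable_avg(1)[OF sq_integrable_rep]])

text \<open>The factor \<open>4 ^ DIM('a)\<close> is the square of the 2^d in
  \<open>avg_increment\<close>; the factor \<open>DIM('a)\<close> comes from Cauchy-Schwarz for the
  sum over the directions.\<close>

definition poincare_const :: "'a :: euclidean_space itself \<Rightarrow> real" where
  "poincare_const t = 4 ^ DIM('a) * real (DIM('a))"

lemma avg_increment_sq:
  fixes f :: "'a :: euclidean_space L2"
  assumes wg: "weak_grad f g"
  shows "(cmod (avg (Suc k) (rep_L2 f) x - avg k (rep_L2 f) x))\<^sup>2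
    \<le> poincare_const TYPE('a) / 4 ^ k * (\<Sum>b\<in>Basis. avg k (\<lambda>t. (cmod (rep_L2 (g b) t))\<^sup>2) x)"
proof -
  let ?S = "\<Sum>b\<in>Basis. avg k (\<lambda>t. cmod (rep_L2 (g b) t)) x"
  let ?T = "\<Sum>b\<in>Basis. avg k (\<lambda>t. (cmod (rep_L2 (g b) t))\<^sup>2) x"
  have "(cmod (avg (Suc k) (rep_L2 f) x - avg k (rep_L2 f) x))\<^sup>2 \<le> (2 ^ DIM('a) / 2 ^ k * ?S)\<^sup>2"
    using wg by (intro power_mono avg_increment) (auto simp: weak_grad_def)
  also have "\<dots> = 4 ^ DIM('a) / 4 ^ k * ?S\<^sup>2"
  proof -
    have "((2::real) ^ n)\<^sup>2 = 4 ^ n" for n by (simp add: power_mult[symmetric] mult.commute[of n] power_mult)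
    then show ?thesis by (simp add: power_mult_distrib power_divide)
  qed
  also have "\<dots> \<le> 4 ^ DIM('a) / 4 ^ k * (?T * DIM('a))"
  proof (rule mult_left_mono)
    have "?S\<^sup>2 \<le> (\<Sum>b\<in>Basis. (avg k (\<lambda>t. cmod (rep_L2 (g b) t)) x)\<^sup>2) * card (Basis :: 'a set)"
      by (rule sum_squared_le_sum_of_squares)
    also have "\<dots> \<le> ?T * card (Basis :: 'a set)"
      by (intro mult_right_mono sum_mono avg_cmod_sq_le sq_integrable_rep) auto
    finally show "?S\<^sup>2 \<le> ?T * DIM('a)" .
  qed auto
  finally show ?thesis by (simp add: poincare_const_def mult_ac)
qed

lemma integral_sum_avg:
  "integrable lebesgue (\<lambda>x. \<Sum>b\<in>Basis. avg k (\<lambda>t. (cmod (rep_L2 (g b) t))\<^sup>2) x)"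
  "(LINT x|lebesgue. (\<Sum>b\<in>Basis. avg k (\<lambda>t. (cmod (rep_L2 (g b) t))\<^sup>2) x)) = grad_norm_sq g"
proof -
  have i: "integrable lebesgue (avg k (\<lambda>t. (cmod (rep_L2 (g b) t))\<^sup>2))" for b
    by (rule avg_integral(1)[OF integrable_rep_sq])
  then show "integrable lebesgue (\<lambda>x. \<Sum>b\<in>Basis. avg k (\<lambda>t. (cmod (rep_L2 (g b) t))\<^sup>2) x)" by auto
  show "(LINT x|lebesgue. (\<Sum>b\<in>Basis. avg k (\<lambda>t. (cmod (rep_L2 (g b) t))\<^sup>2) x)) = grad_norm_sq g"
    by (subst Bochner_Integration.integral_sum[OF i])
      (simp add: avg_integral(2)[OF integrable_rep_sq] grad_norm_sq_def norm_L2_sq)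
qed

text \<open>Each average of |g|^2 is at most the inverse cube volume 2^(kd) times the total
  integral. The supremum is bought with this growth in \<open>k\<close>, which the L4 estimate can
  afford in low dimension.\<close>

lemma avg_increment_sup:
  fixes f :: "'a :: euclidean_space L2"
  assumes wg: "weak_grad f g"
  shows "(cmod (avg (Suc k) (rep_L2 f) x - avg k (rep_L2 f) x))\<^sup>2
    \<le> poincare_const TYPE('a) / 4 ^ k * ((2 ^ k) ^ DIM('a) * grad_norm_sq g)"
proof -
  have "(\<Sum>b\<in>Basis. avg k (\<lambda>t. (cmod (rep_L2 (g b) t))\<^sup>2) x) \<le> (\<Sum>b\<in>Basis. (2 ^ k) ^ DIM('a) * (norm (g b))\<^sup>2)"
    unfolding norm_L2_sq by (intro sum_mono avg_le_integral integrable_rep_sq) auto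
  also have "\<dots> = (2 ^ k) ^ DIM('a) * grad_norm_sq g" by (simp add: grad_norm_sq_def sum_distrib_left)
  finally show ?thesis
    by (intro order.trans[OF avg_increment_sq[OF wg]] mult_left_mono) (auto simp: poincare_const_def)
qed

lemma norm_cube_avg_increment:
  fixes f :: "'a :: euclidean_space L2"
  assumes wg: "weak_grad f g"
  shows "(LINT x|lebesgue. (cmod (avg (Suc k) (rep_L2 f) x - avg k (rep_L2 f) x))\<^sup>2)
      \<le> poincare_const TYPE('a) / 4 ^ k * grad_norm_sq g" (is ?A)
    and "norm (cube_avg (Suc k) f - cube_avg k f) \<le> sqrt (poincare_const TYPE('a) * grad_norm_sq g) * (1/2) ^ k" (is ?B)
proof -
  let ?D = "\<lambda>x. avg (Suc k) (rep_L2 f) x - avg k (rep_L2 f) x"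
  have D: "sq_integrable ?D"
    using sq_integrable_add[OF sq_integrable_avg(1)[OF sq_integrable_rep, of "Suc k" f]
        sq_integrable_mult[OF sq_integrable_avg(1)[OF sq_integrable_rep, of k f], of "-1"]] by simp
  have "(LINT x|lebesgue. (cmod (?D x))\<^sup>2)
    \<le> (LINT x|lebesgue. poincare_const TYPE('a) / 4 ^ k * (\<Sum>b\<in>Basis. avg k (\<lambda>t. (cmod (rep_L2 (g b) t))\<^sup>2) x))"
    using D by (intro integral_mono integrable_mult_right integral_sum_avg(1) avg_increment_sq[OF wg])
      (auto simp: sq_integrable_def)
  then show A: ?A by (simp add: integral_sum_avg(2))
  have "(norm (cube_avg (Suc k) f - cube_avg k f))\<^sup>2 = (LINT x|lebesgue. (cmod (?D x))\<^sup>2)"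
    unfolding norm_L2_sq
  proof (rule integral_cong_AE)
    show "AE x in lebesgue. (cmod (rep_L2 (cube_avg (Suc k) f - cube_avg k f) x))\<^sup>2 = (cmod (?D x))\<^sup>2"
      using rep_minus[of "cube_avg (Suc k) f" "cube_avg k f"] rep_cube_avg[of "Suc k" f] rep_cube_avg[of k f]
      by eventually_elim simp
  qed (use D in \<open>auto simp: sq_integrable_def\<close>)
  also have "\<dots> \<le> (sqrt (poincare_const TYPE('a) * grad_norm_sq g) * (1/2) ^ k)\<^sup>2"
  proof -
    have "((1/2) ^ k)\<^sup>2 = (1 / 4 ^ k :: real)"
      by (simp add: power_mult[symmetric] mult.commute[of k] power_mult power_one_over)
    then show ?thesis using A by (simp add: power_mult_distrib grad_norm_sq_nonneg poincare_const_def)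
  qed
  finally show ?B by (rule power2_le_imp_le) (simp add: grad_norm_sq_nonneg poincare_const_def)
qed

lemma L2_inner_indicator_cube:
  "L2_inner f (abs_L2 (\<lambda>y. of_real (indicator (cube k x) y))) = cube_integral (rep_L2 f) k x"
proof -
  have "sq_integrable (\<lambda>y. complex_of_real (indicator (cube k x) y))"
    by (rule sq_integrable_indicator) (auto simp: emeasure_cube)
  from integral_rep_eq_L2_inner[OF this, of f] show ?thesis
    by (simp add: cube_integral_def scaleR_conv_of_real mult.commute)
qed

lemma cube_integral_cube_avg:
  assumes "j \<le> k"
  shows "cube_integral (rep_L2 (cube_avg k f)) j x = cube_integral (rep_L2 f) j x"
proof -
  have "cube_integral (rep_L2 (cube_avg k f)) j x = (LINT y|lebesgue. indicator (cube j x) y *\<^sub>R avg k (rep_L2 f) y)"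
    unfolding cube_integral_def
  proof (rule integral_cong_AE)
    show "AE y in lebesgue. indicator (cube j x) y *\<^sub>R rep_L2 (cube_avg k f) y = indicator (cube j x) y *\<^sub>R avg k (rep_L2 f) y"
      using rep_cube_avg[of k f] by eventually_elim simp
  qed (auto intro!: borel_measurable_scaleR avg_measurable rep_measurable)
  also have "\<dots> = cube_integral (rep_L2 f) j x"
    unfolding cube_integral_def by (rule avg_tower(2)[OF assms integrable_cube_sq[OF sq_integrable_rep]])
  finally show ?thesis .
qed

text \<open>The averages form a Cauchy sequence; its limit has the same integral as \<open>f\<close> over every dyadic cube.\<close>

lemma cube_avg_converges:
  fixes f :: "'a :: euclidean_space L2"
  assumes wg: "weak_grad f g"
  shows "(\<lambda>k. cube_avg k f) \<longlonglongrightarrow> f"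
    and "norm (f - cube_avg k f) \<le> 2 * sqrt (poincare_const TYPE('a) * grad_norm_sq g) * (1/2) ^ k"
proof -
  let ?C = "sqrt (poincare_const TYPE('a) * grad_norm_sq g)"
  have C0: "?C \<ge> 0" by (simp add: grad_norm_sq_nonneg poincare_const_def)
  \<comment> \<open>The factor 1 - 2^(-n) makes the partial geometric sum an exact inductive
    invariant.\<close>
  have tele: "norm (cube_avg (k + n) f - cube_avg k f) \<le> 2 * ?C * (1/2) ^ k * (1 - (1/2) ^ n)" for k n
  proof (induction n)
    case (Suc n)
    have "norm (cube_avg (k + Suc n) f - cube_avg k f)
        \<le> norm (cube_avg (Suc (k + n)) f - cube_avg (k + n) f) + norm (cube_avg (k + n) f - cube_avg k f)"
      using norm_triangle_ineq[of "cube_avg (Suc (k + n)) f - cube_avg (k + n) f" "cube_avg (k + n) f - cube_avg k f"] by simp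
    also have "\<dots> \<le> ?C * (1/2) ^ (k + n) + 2 * ?C * (1/2) ^ k * (1 - (1/2) ^ n)"
      by (intro add_mono norm_cube_avg_increment(2)[OF wg] Suc.IH)
    also have "\<dots> = 2 * ?C * (1/2) ^ k * (1 - (1/2) ^ Suc n)"
      by (simp add: power_add algebra_simps)
    finally show ?case .
  qed simp
  have tele': "norm (cube_avg (k + n) f - cube_avg k f) \<le> 2 * ?C * (1/2) ^ k" for k n
  proof -
    have "2 * ?C * (1/2) ^ k * (1 - (1/2) ^ n) \<le> 2 * ?C * (1/2) ^ k * 1"
      using C0 by (intro mult_left_mono) auto
    then show ?thesis using tele[of k n] by linarith
  qed
  have "Cauchy (\<lambda>k. cube_avg k f)"
  proof (rule CauchyI)
    fix e :: real assume e: "e > 0"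
    have "(\<lambda>k. 4 * ?C * (1/2) ^ k) \<longlonglongrightarrow> 4 * ?C * 0"
      by (intro tendsto_intros LIMSEQ_realpow_zero) auto
    then have "\<forall>\<^sub>F k in sequentially. 4 * ?C * (1/2) ^ k < e"
      using e by (intro order_tendstoD) auto
    then obtain k where k: "4 * ?C * (1/2) ^ k < e" by (auto simp: eventually_sequentially)
    have "norm (cube_avg m f - cube_avg n f) < e" if "m \<ge> k" "n \<ge> k" for m n
    proof -
      have "norm (cube_avg m f - cube_avg k f) \<le> 2 * ?C * (1/2) ^ k" "norm (cube_avg n f - cube_avg k f) \<le> 2 * ?C * (1/2) ^ k"
        using tele'[of k "m - k"] tele'[of k "n - k"] that by simp_all
      then show ?thesis
        using norm_triangle_ineq4[of "cube_avg m f - cube_avg k f" "cube_avg n f - cube_avg k f"] k by simp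
    qed
    then show "\<exists>M. \<forall>m\<ge>M. \<forall>n\<ge>M. norm (cube_avg m f - cube_avg n f) < e" by blast
  qed
  then obtain F where F: "(\<lambda>k. cube_avg k f) \<longlonglongrightarrow> F" using Cauchy_convergent_iff convergent_def by blast
  have "cube_integral (rep_L2 F) j x = cube_integral (rep_L2 f) j x" for j x
  proof -
    have "(\<lambda>k. cube_integral (rep_L2 (cube_avg k f)) j x) \<longlonglongrightarrow> cube_integral (rep_L2 F) j x"
      unfolding L2_inner_indicator_cube[symmetric] by (rule tendsto_L2_inner[OF F])
    moreover have "\<forall>\<^sub>F k in sequentially. cube_integral (rep_L2 (cube_avg k f)) j x = cube_integral (rep_L2 f) j x"
      using eventually_ge_at_top[of j] by eventually_elim (rule cube_integral_cube_avg)
    ultimately have "(\<lambda>k. cube_integral (rep_L2 f) j x) \<longlonglongrightarrow> cube_integral (rep_L2 F) j x"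
      by (rule Lim_transform_eventually)
    then show ?thesis by (simp add: LIMSEQ_const_iff)
  qed
  then have zero: "cube_integral (rep_L2 (F - f)) j x = 0" for j x
    by (simp add: L2_inner_indicator_cube[symmetric] L2_inner_diff_left)
  have "AE x in lebesgue. rep_L2 (F - f) x = 0"
    by (rule integral_zero_on_cubes[OF integrable_cube_sq[OF sq_integrable_rep] zero[unfolded cube_integral_def]])
  with rep_minus[of F f] have "AE x in lebesgue. rep_L2 F x = rep_L2 f x" by eventually_elim simp
  then have "F = f" by (rule L2_eqI)
  with F show lim: "(\<lambda>k. cube_avg k f) \<longlonglongrightarrow> f" by simp
  have "(\<lambda>n. norm (cube_avg (n + k) f - cube_avg k f)) \<longlonglongrightarrow> norm (f - cube_avg k f)"
    by (intro tendsto_intros LIMSEQ_ignore_initial_segment lim)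
  then show "norm (f - cube_avg k f) \<le> 2 * ?C * (1/2) ^ k"
    by (rule LIMSEQ_le_const2) (use tele'[of k] in \<open>auto simp: add.commute\<close>)
qed

text \<open>The fourth power of the L4 norm, valued in \<open>ennreal\<close> so that bounds can be
  carried through sums and limits before integrability is known.\<close>

definition I4 :: "('a :: euclidean_space \<Rightarrow> complex) \<Rightarrow> ennreal" where
  "I4 u = (\<integral>\<^sup>+x. ennreal ((cmod (u x)) ^ 4) \<partial>lebesgue)"

lemma I4_cong: "AE x in lebesgue. u x = v x \<Longrightarrow> I4 u = I4 v"
  unfolding I4_def by (rule nn_integral_cong_AE) (auto elim: AE_mp)

text \<open>Convexity of x^4 with the weights A/(A+B) and B/(A+B) at the points p/A and q/B.
  Integrated, it is Minkowski's inequality in L4.\<close>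

lemma convex_fourth_power:
  fixes p q A B :: real
  assumes "A > 0" "B > 0" "p \<ge> 0" "q \<ge> 0"
  shows "(p + q) ^ 4 \<le> (A + B) ^ 3 * (p ^ 4 / A ^ 3 + q ^ 4 / B ^ 3)"
proof -
  let ?l = "B / (A + B)"
  have sq: "convex_on (UNIV :: real set) (\<lambda>x. x ^ 4)" by (rule convex_power_even) simp
  have l: "0 \<le> ?l" "?l \<le> 1" "1 - ?l = A / (A + B)" using assms by (auto simp: field_simps)
  have "((1 - ?l) *\<^sub>R (p / A) + ?l *\<^sub>R (q / B)) ^ 4 \<le> (1 - ?l) * (p / A) ^ 4 + ?l * (q / B) ^ 4"
    using convex_onD[OF sq, of ?l "p / A" "q / B"] l(1,2) by simp
  also have "(1 - ?l) *\<^sub>R (p / A) + ?l *\<^sub>R (q / B) = (p + q) / (A + B)"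
    using assms unfolding l(3) by (simp add: add_divide_distrib)
  finally have *: "((p + q) / (A + B)) ^ 4 \<le> A / (A + B) * (p / A) ^ 4 + B / (A + B) * (q / B) ^ 4"
    unfolding l(3) .
  have "(p + q) ^ 4 = (A + B) ^ 4 * ((p + q) / (A + B)) ^ 4"
    using assms by (simp add: power_divide)
  also have "\<dots> \<le> (A + B) ^ 4 * (A / (A + B) * (p / A) ^ 4 + B / (A + B) * (q / B) ^ 4)"
    using * assms by (intro mult_left_mono) auto
  also have "\<dots> = (A + B) ^ 3 * (p ^ 4 / A ^ 3 + q ^ 4 / B ^ 3)"
  proof -
    have f1: "X ^ 4 * (Y / X * Z) = X ^ 3 * (Y * Z)" if "X \<noteq> 0" for X Y Z :: real
      using that by (simp add: eval_nat_numeral)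
    have f2: "Y * (Z / Y) ^ 4 = Z ^ 4 / Y ^ 3" if "Y \<noteq> 0" for Y Z :: real
      using that by (simp add: eval_nat_numeral)
    have nz: "A + B \<noteq> 0" "A \<noteq> 0" "B \<noteq> 0" using assms by auto
    show ?thesis by (simp only: distrib_left f1[OF nz(1)] f2[OF nz(2)] f2[OF nz(3)])
  qed
  finally show ?thesis .
qed

text \<open>Minkowski's inequality, phrased for upper bounds \<open>A\<close> and \<open>B\<close>
  of the L4 norms. The weights divide by these bounds, so they are taken positive; hence the
  additive slack in \<open>sobolev_level_pos\<close>.\<close>

lemma I4_triangle_pos:
  assumes [measurable]: "u \<in> borel_measurable lebesgue" "v \<in> borel_measurable lebesgue"
    and A: "A > 0" "I4 u \<le> ennreal (A ^ 4)" and B: "B > 0" "I4 v \<le> ennreal (B ^ 4)"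
  shows "I4 (\<lambda>x. u x + v x) \<le> ennreal ((A + B) ^ 4)"
proof -
  let ?a = "(A + B) ^ 3 / A ^ 3" and ?b = "(A + B) ^ 3 / B ^ 3"
  have "I4 (\<lambda>x. u x + v x) \<le> (\<integral>\<^sup>+x. ennreal ?a * ennreal ((cmod (u x)) ^ 4) + ennreal ?b * ennreal ((cmod (v x)) ^ 4) \<partial>lebesgue)"
    unfolding I4_def
  proof (rule nn_integral_mono)
    fix x
    have "(cmod (u x + v x)) ^ 4 \<le> (cmod (u x) + cmod (v x)) ^ 4"
      by (intro power_mono norm_triangle_ineq) auto
    also have "\<dots> \<le> (A + B) ^ 3 * ((cmod (u x)) ^ 4 / A ^ 3 + (cmod (v x)) ^ 4 / B ^ 3)"
      using A B by (intro convex_fourth_power) auto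
    finally show "ennreal ((cmod (u x + v x)) ^ 4) \<le> ennreal ?a * ennreal ((cmod (u x)) ^ 4) + ennreal ?b * ennreal ((cmod (v x)) ^ 4)"
      using A B by (simp add: ennreal_mult[symmetric] ennreal_plus[symmetric] distrib_left del: ennreal_plus)
  qed
  also have "\<dots> = ennreal ?a * I4 u + ennreal ?b * I4 v"
    unfolding I4_def by (simp add: nn_integral_add nn_integral_cmult)
  also have "\<dots> \<le> ennreal ?a * ennreal (A ^ 4) + ennreal ?b * ennreal (B ^ 4)"
    by (intro add_mono mult_left_mono A B) auto
  also have "\<dots> = ennreal (?a * A ^ 4 + ?b * B ^ 4)"
    using A B by (simp add: ennreal_mult[symmetric] ennreal_plus[symmetric] del: ennreal_plus)
  also have "?a * A ^ 4 + ?b * B ^ 4 = (A + B) ^ 4"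
    using A B by (simp add: eval_nat_numeral field_simps)
  finally show ?thesis .
qed

text \<open>In |u|^4 = |u|^2 |u|^2 one factor is measured by its supremum and the other by its
  integral.\<close>

lemma I4_bound:
  assumes u: "sq_integrable u" and sup: "\<And>x. (cmod (u x))\<^sup>2 \<le> S"
    and int: "(LINT x|lebesgue. (cmod (u x))\<^sup>2) \<le> T"
  shows "I4 u \<le> ennreal (S * T)"
proof -
  have S0: "S \<ge> 0" using sup[of undefined] by (meson order.trans zero_le_power2)
  have i: "integrable lebesgue (\<lambda>x. (cmod (u x))\<^sup>2)" using u by (simp add: sq_integrable_def)
  have "I4 u \<le> (\<integral>\<^sup>+x. ennreal (S * (cmod (u x))\<^sup>2) \<partial>lebesgue)"
    unfolding I4_def
  proof (intro nn_integral_mono ennreal_leI)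
    fix x
    have "(cmod (u x)) ^ 4 = (cmod (u x))\<^sup>2 * (cmod (u x))\<^sup>2" by (simp add: power2_eq_square eval_nat_numeral)
    also have "\<dots> \<le> S * (cmod (u x))\<^sup>2" by (intro mult_right_mono sup) auto
    finally show "(cmod (u x)) ^ 4 \<le> S * (cmod (u x))\<^sup>2" .
  qed
  also have "\<dots> = ennreal (S * (LINT x|lebesgue. (cmod (u x))\<^sup>2))"
    using S0 i by (subst nn_integral_eq_integral) (auto intro: integrable_mult_right)
  also have "\<dots> \<le> ennreal (S * T)" using S0 int by (intro ennreal_leI mult_left_mono)
  finally show ?thesis .
qed

lemma pow_dim_le: "DIM('a :: euclidean_space) \<le> 3 \<Longrightarrow> ((2::real) ^ k) ^ DIM('a) \<le> 8 ^ k"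
proof -
  assume "DIM('a) \<le> 3"
  then have "((2::real) ^ k) ^ DIM('a) \<le> (2 ^ k) ^ 3" by (intro power_increasing) auto
  also have "\<dots> = 8 ^ k" by (simp add: power_mult[symmetric] mult.commute[of k] power_mult)
  finally show ?thesis .
qed

text \<open>The decay rate of the increments in L4: in dimension three their fourth powers decay
  like 8^k / 16^k = 2^(-k), whence the fourth root of 1/2.\<close>

definition theta :: real where "theta = root 4 (1/2)"

lemma theta: "0 < theta" "theta < 1" "theta ^ 4 = 1/2"
proof -
  show "0 < theta" and 4: "theta ^ 4 = 1/2" by (simp_all add: theta_def)
  show "theta < 1"
  proof (rule ccontr)
    assume "\<not> theta < 1"
    then have "1 \<le> theta ^ 4" by (intro one_le_power) simp
    with 4 show False by simp
  qed
qed

text \<open>The supremum bound contributes 2^(kd) 4^(-k) and the L2 bound 4^(-k); with d at most 3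
  the product is at most 2^(-k). \<open>C\<close> may exceed the square root so that it can be made
  positive.\<close>

lemma I4_avg_increment:
  fixes f :: "'a :: euclidean_space L2"
  assumes dim: "DIM('a) \<le> 3" and wg: "weak_grad f g"
    and C: "C \<ge> sqrt (poincare_const TYPE('a) * grad_norm_sq g)"
  shows "I4 (\<lambda>x. avg (Suc k) (rep_L2 f) x - avg k (rep_L2 f) x) \<le> ennreal ((C * theta ^ k) ^ 4)"
proof -
  let ?D = "\<lambda>x. avg (Suc k) (rep_L2 f) x - avg k (rep_L2 f) x"
  let ?KG = "poincare_const TYPE('a) * grad_norm_sq g"
  have KG: "?KG \<ge> 0" by (simp add: grad_norm_sq_nonneg poincare_const_def)
  have D: "sq_integrable ?D"
    using sq_integrable_add[OF sq_integrable_avg(1)[OF sq_integrable_rep, of "Suc k" f]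
        sq_integrable_mult[OF sq_integrable_avg(1)[OF sq_integrable_rep, of k f], of "-1"]] by simp
  have "I4 ?D \<le> ennreal ((poincare_const TYPE('a) / 4 ^ k * ((2 ^ k) ^ DIM('a) * grad_norm_sq g))
      * (poincare_const TYPE('a) / 4 ^ k * grad_norm_sq g))"
    by (intro I4_bound D avg_increment_sup[OF wg] norm_cube_avg_increment(1)[OF wg])
  also have "\<dots> \<le> ennreal ((C * theta ^ k) ^ 4)"
  proof (rule ennreal_leI)
    have "(poincare_const TYPE('a) / 4 ^ k * ((2 ^ k) ^ DIM('a) * grad_norm_sq g)) * (poincare_const TYPE('a) / 4 ^ k * grad_norm_sq g)
        = ?KG\<^sup>2 / 16 ^ k * (2 ^ k) ^ DIM('a)"
      by (simp add: power2_eq_square power_mult_distrib[symmetric] flip: mult.assoc)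
    also have "\<dots> \<le> ?KG\<^sup>2 / 16 ^ k * 8 ^ k"
      by (intro mult_left_mono pow_dim_le dim) auto
    also have "\<dots> = ?KG\<^sup>2 * (1/2) ^ k"
    proof -
      have "(16::real) ^ k = 8 ^ k * 2 ^ k" by (simp flip: power_mult_distrib)
      then show ?thesis by (simp add: power_one_over)
    qed
    also have "\<dots> \<le> C ^ 4 * (1/2) ^ k"
    proof (rule mult_right_mono)
      have "?KG\<^sup>2 = (sqrt ?KG) ^ 4" using KG by (simp add: power4_eq_xxxx power2_eq_square)
      also have "\<dots> \<le> C ^ 4" using C KG by (intro power_mono) auto
      finally show "?KG\<^sup>2 \<le> C ^ 4" .
    qed auto
    also have "\<dots> = (C * theta ^ k) ^ 4"
      by (simp add: power_mult_distrib power_mult[symmetric] mult.commute[of k] power_mult theta(3))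
    finally show "(poincare_const TYPE('a) / 4 ^ k * ((2 ^ k) ^ DIM('a) * grad_norm_sq g))
      * (poincare_const TYPE('a) / 4 ^ k * grad_norm_sq g) \<le> (C * theta ^ k) ^ 4" .
  qed
  finally show ?thesis .
qed

lemma I4_avg:
  fixes f :: "'a :: euclidean_space L2"
  assumes dim: "DIM('a) \<le> 3"
  shows "I4 (avg k (rep_L2 f)) \<le> ennreal ((2 ^ k * norm f) ^ 4)"
proof -
  have "I4 (avg k (rep_L2 f)) \<le> ennreal ((2 ^ k) ^ DIM('a) * (norm f)\<^sup>2 * (norm f)\<^sup>2)"
  proof (rule I4_bound)
    fix x
    show "(cmod (avg k (rep_L2 f) x))\<^sup>2 \<le> (2 ^ k) ^ DIM('a) * (norm f)\<^sup>2"
      unfolding norm_L2_sq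
      by (intro order.trans[OF avg_sq_le[OF sq_integrable_rep]] avg_le_integral integrable_rep_sq) auto
    show "(LINT x|lebesgue. (cmod (avg k (rep_L2 f) x))\<^sup>2) \<le> (norm f)\<^sup>2"
      unfolding norm_L2_sq by (rule sq_integrable_avg(2)[OF sq_integrable_rep])
  qed (rule sq_integrable_avg(1)[OF sq_integrable_rep])
  also have "\<dots> \<le> ennreal ((2 ^ k * norm f) ^ 4)"
  proof (rule ennreal_leI)
    have "((2::real) ^ k) ^ DIM('a) \<le> (2 ^ k) ^ 4" using dim by (intro power_increasing) auto
    then have "(2 ^ k) ^ DIM('a) * ((norm f)\<^sup>2 * (norm f)\<^sup>2) \<le> (2 ^ k) ^ 4 * ((norm f)\<^sup>2 * (norm f)\<^sup>2)"
      by (intro mult_right_mono) auto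
    then show "(2 ^ k) ^ DIM('a) * (norm f)\<^sup>2 * (norm f)\<^sup>2 \<le> (2 ^ k * norm f) ^ 4"
      by (simp add: power_mult_distrib mult_ac power4_eq_xxxx power2_eq_square)
  qed
  finally show ?thesis .
qed

lemma I4_Fatou:
  assumes [measurable]: "\<And>n. u n \<in> borel_measurable lebesgue" "v \<in> borel_measurable lebesgue"
    and lim: "AE x in lebesgue. (\<lambda>n. u n x) \<longlonglongrightarrow> v x" and bd: "\<And>n. I4 (u n) \<le> B"
  shows "I4 v \<le> B"
proof -
  have "I4 v = (\<integral>\<^sup>+x. liminf (\<lambda>n. ennreal ((cmod (u n x)) ^ 4)) \<partial>lebesgue)"
    unfolding I4_def
  proof (rule nn_integral_cong_AE)
    show "AE x in lebesgue. ennreal ((cmod (v x)) ^ 4) = liminf (\<lambda>n. ennreal ((cmod (u n x)) ^ 4))"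
      using lim
    proof eventually_elim
      case (elim x)
      then have "(\<lambda>n. ennreal ((cmod (u n x)) ^ 4)) \<longlonglongrightarrow> ennreal ((cmod (v x)) ^ 4)"
        by (intro tendsto_intros) auto
      then show ?case by (metis lim_imp_Liminf sequentially_bot)
    qed
  qed
  also have "\<dots> \<le> liminf (\<lambda>n. I4 (u n))"
    unfolding I4_def by (rule nn_integral_liminf) measurable
  also have "\<dots> \<le> B" using bd by (intro Liminf_le) auto
  finally show ?thesis .
qed

text \<open>The increments are summed from level \<open>k\<close> on rather than from 0: the
  starting average costs 2^k times the L2 norm, while the gradient carries only the tail
  \<open>theta ^ k / (1 - theta)\<close>. The slack \<open>e\<close> keeps all bounds positive, and
  Fatou's lemma passes from the averages to \<open>f\<close>.\<close>

lemma sobolev_level_pos: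
  fixes f :: "'a :: euclidean_space L2"
  assumes dim: "DIM('a) \<le> 3" and wg: "weak_grad f g" and e: "e > 0"
  shows "I4 (rep_L2 f) \<le> ennreal ((2 ^ k * norm f + e
    + (sqrt (poincare_const TYPE('a) * grad_norm_sq g) + e) * (theta ^ k / (1 - theta))) ^ 4)"
proof -
  let ?A = "2 ^ k * norm f + e"
  let ?C = "sqrt (poincare_const TYPE('a) * grad_norm_sq g) + e"
  have KG: "poincare_const TYPE('a) * grad_norm_sq g \<ge> 0" by (simp add: grad_norm_sq_nonneg poincare_const_def)
  have A: "?A > 0" using e by (simp add: add_nonneg_pos)
  have C: "?C > 0" using e KG by (simp add: add_nonneg_pos)
  define P where "P = (\<lambda>n. ?A + ?C * theta ^ k * (\<Sum>j<n. theta ^ j))"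
  have P: "P n > 0" for n
    unfolding P_def using C theta(1) by (intro add_pos_nonneg[OF A] mult_nonneg_nonneg sum_nonneg) auto
  have meas: "avg j (rep_L2 f) \<in> borel_measurable lebesgue" for j by (rule avg_measurable[OF rep_measurable])
  have ind: "I4 (avg (k + n) (rep_L2 f)) \<le> ennreal (P n ^ 4)" for n
  proof (induction n)
    case 0
    have "ennreal ((2 ^ k * norm f) ^ 4) \<le> ennreal (?A ^ 4)" using e by (intro ennreal_leI power_mono) auto
    then show ?case using order.trans[OF I4_avg[OF dim, of k f]] by (simp add: P_def)
  next
    case (Suc n)
    let ?D = "\<lambda>x. avg (Suc (k + n)) (rep_L2 f) x - avg (k + n) (rep_L2 f) x"
    have "I4 (\<lambda>x. avg (k + n) (rep_L2 f) x + ?D x) \<le> ennreal ((P n + ?C * theta ^ (k + n)) ^ 4)"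
    proof (rule I4_triangle_pos[OF meas _ P Suc.IH])
      show "?D \<in> borel_measurable lebesgue" using meas by measurable
      show "?C * theta ^ (k + n) > 0" using C theta(1) by simp
      show "I4 ?D \<le> ennreal ((?C * theta ^ (k + n)) ^ 4)"
        using e by (intro I4_avg_increment[OF dim wg]) simp
    qed
    also have "P n + ?C * theta ^ (k + n) = P (Suc n)"
      by (simp add: P_def power_add algebra_simps)
    finally show ?case by simp
  qed
  let ?Q = "?A + ?C * (theta ^ k / (1 - theta))"
  have PQ: "P n \<le> ?Q" for n
  proof -
    have "(\<Sum>j<n. theta ^ j) = (1 - theta ^ n) / (1 - theta)"
      using theta(2) by (simp add: sum_gp_strict)
    also have "\<dots> \<le> 1 / (1 - theta)" using theta by (intro divide_right_mono) auto
    finally have "?C * theta ^ k * (\<Sum>j<n. theta ^ j) \<le> ?C * theta ^ k * (1 / (1 - theta))"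
      using C theta(1) by (intro mult_left_mono) auto
    then show ?thesis by (simp add: P_def)
  qed
  have all: "I4 (rep_L2 (cube_avg m f)) \<le> ennreal (?Q ^ 4)" if "m \<ge> k" for m
  proof -
    have "I4 (rep_L2 (cube_avg m f)) = I4 (avg (k + (m - k)) (rep_L2 f))"
      using that by (intro I4_cong) (simp add: rep_cube_avg)
    also have "\<dots> \<le> ennreal (P (m - k) ^ 4)" by (rule ind)
    also have "\<dots> \<le> ennreal (?Q ^ 4)"
      using PQ[of "m - k"] less_imp_le[OF P[of "m - k"]] by (intro ennreal_leI power_mono)
    finally show ?thesis .
  qed
  obtain r where r: "strict_mono (r :: nat \<Rightarrow> nat)"
    "AE x in lebesgue. (\<lambda>n. rep_L2 (cube_avg (r n) f) x) \<longlonglongrightarrow> rep_L2 f x"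
    using L2_tendsto_AE_subseq[OF cube_avg_converges(1)[OF wg]] by blast
  show ?thesis
  proof (rule I4_Fatou[where u="\<lambda>n. rep_L2 (cube_avg (r (n + k)) f)"])
    show "AE x in lebesgue. (\<lambda>n. rep_L2 (cube_avg (r (n + k)) f) x) \<longlonglongrightarrow> rep_L2 f x"
      using r(2) by eventually_elim (rule LIMSEQ_ignore_initial_segment)
    show "I4 (rep_L2 (cube_avg (r (n + k)) f)) \<le> ennreal (?Q ^ 4)" for n
      using seq_suble[OF r(1), of "n + k"] by (intro all) simp
  qed (rule rep_measurable)+
qed

text \<open>A high starting level makes the gradient coefficient smaller than \<open>e\<close>, at
  the expense of \<open>M\<close> = 2^k; the slack of the previous bound is then sent to 0.\<close>

theorem sobolev_L4:
  assumes dim: "DIM('a :: euclidean_space) \<le> 3" and e: "e > 0"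
  shows "\<exists>M\<ge>0. \<forall>(f :: 'a L2) g. weak_grad f g \<longrightarrow>
    I4 (rep_L2 f) \<le> ennreal ((M * norm f + e * sqrt (grad_norm_sq g)) ^ 4)"
proof -
  let ?K = "poincare_const TYPE('a)"
  have K0: "?K \<ge> 0" by (simp add: poincare_const_def)
  have "(\<lambda>k. sqrt ?K * (theta ^ k / (1 - theta))) \<longlonglongrightarrow> sqrt ?K * (0 / (1 - theta))"
    using theta by (intro tendsto_intros LIMSEQ_realpow_zero) auto
  then have "\<forall>\<^sub>F k in sequentially. sqrt ?K * (theta ^ k / (1 - theta)) < e"
    using e by (intro order_tendstoD) auto
  then obtain k where k: "sqrt ?K * (theta ^ k / (1 - theta)) < e" by (auto simp: eventually_sequentially)
  have "I4 (rep_L2 f) \<le> ennreal ((2 ^ k * norm f + e * sqrt (grad_norm_sq g)) ^ 4)"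
    if wg: "weak_grad f g" for f :: "'a L2" and g
  proof -
    let ?X = "\<lambda>d. 2 ^ k * norm f + d + (sqrt (?K * grad_norm_sq g) + d) * (theta ^ k / (1 - theta))"
    have "(\<lambda>n. ennreal (?X (inverse (real (Suc n))) ^ 4)) \<longlonglongrightarrow> ennreal (?X 0 ^ 4)"
      by (intro tendsto_intros LIMSEQ_inverse_real_of_nat)
    then have "I4 (rep_L2 f) \<le> ennreal (?X 0 ^ 4)"
      by (rule LIMSEQ_le_const) (intro exI[of _ 0] allI impI sobolev_level_pos[OF dim wg], simp)
    also have "\<dots> \<le> ennreal ((2 ^ k * norm f + e * sqrt (grad_norm_sq g)) ^ 4)"
    proof (intro ennreal_leI power_mono)
      have "sqrt (?K * grad_norm_sq g) * (theta ^ k / (1 - theta)) = sqrt ?K * (theta ^ k / (1 - theta)) * sqrt (grad_norm_sq g)"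
        by (simp add: real_sqrt_mult)
      also have "\<dots> \<le> e * sqrt (grad_norm_sq g)"
        using k grad_norm_sq_nonneg[of g] by (intro mult_right_mono) auto
      finally show "?X 0 \<le> 2 ^ k * norm f + e * sqrt (grad_norm_sq g)" by simp
      show "0 \<le> ?X 0" using theta K0 grad_norm_sq_nonneg[of g] by (intro add_nonneg_nonneg mult_nonneg_nonneg) auto
    qed
    finally show ?thesis .
  qed
  then show ?thesis by (intro exI[of _ "2 ^ k"]) auto
qed

section \<open>The compact embedding\<close>

lemma norm_diff_abs_L2:
  assumes u: "sq_integrable u"
  shows "(norm (f - abs_L2 u))\<^sup>2 = (LINT x|lebesgue. (cmod (rep_L2 f x - u x))\<^sup>2)"
  unfolding norm_L2_sq
proof (rule integral_cong_AE)
  show "AE x in lebesgue. (cmod (rep_L2 (f - abs_L2 u) x))\<^sup>2 = (cmod (rep_L2 f x - u x))\<^sup>2"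
    using rep_minus[of f "abs_L2 u"] rep_abs_L2[OF u] by eventually_elim simp
qed (use u in \<open>auto simp: sq_integrable_def\<close>)

lemma sq_integrable_diff: "sq_integrable u \<Longrightarrow> sq_integrable v \<Longrightarrow> sq_integrable (\<lambda>x. u x - v x)"
  using sq_integrable_add[of u "\<lambda>x. (-1) * v x"] sq_integrable_mult[of v "-1"] by simp

lemma cube_integral_bound: "cmod (cube_integral (rep_L2 f) k x) \<le> norm f"
proof -
  let ?i = "\<lambda>y. complex_of_real (indicator (cube k x) y)"
  have sq: "sq_integrable ?i" by (rule sq_integrable_indicator) (auto simp: emeasure_cube)
  have "(norm (abs_L2 ?i))\<^sup>2 = (LINT y|lebesgue. indicator (cube k x) y)"
    unfolding norm_abs_L2_sq[OF sq] by (intro Bochner_Integration.integral_cong) (auto simp: indicator_def)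
  also have "\<dots> \<le> 1" by (simp add: measure_cube)
  finally have "norm (abs_L2 ?i) \<le> 1" by (simp add: power_le_one_iff abs_square_le_1)
  then show ?thesis
    using L2_inner_bound[of f "abs_L2 ?i"] mult_left_mono[of "norm (abs_L2 ?i)" 1 "norm f"]
    unfolding L2_inner_indicator_cube by simp
qed

text \<open>Dominated convergence for the squared distance to the pointwise limit, with a constant
  on a set of finite measure as the dominating function.\<close>

lemma dominated_L2_Cauchy:
  fixes u :: "nat \<Rightarrow> 'a :: euclidean_space \<Rightarrow> complex"
  assumes u: "\<And>n. u n \<in> borel_measurable lebesgue" and W: "W \<in> sets lebesgue" "emeasure lebesgue W < \<infinity>"
    and bd: "\<And>n x. cmod (u n x) \<le> S * indicator W x" and conv: "\<And>x. convergent (\<lambda>n. u n x)"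
  shows "\<And>n. sq_integrable (u n)" "Cauchy (\<lambda>n. abs_L2 (u n))"
proof -
  note [measurable] = u W(1)
  have SW: "sq_integrable (\<lambda>x. complex_of_real S * complex_of_real (indicator W x))"
    by (intro sq_integrable_mult sq_integrable_indicator W)
  have dom: "sq_integrable v" if [measurable]: "v \<in> borel_measurable lebesgue" and le: "\<And>x. cmod (v x) \<le> S * indicator W x" for v
  proof (rule sq_integrable_bound[OF SW])
    show "AE x in lebesgue. cmod (v x) \<le> cmod (complex_of_real S * complex_of_real (indicator W x))"
    proof (intro AE_I2)
      fix x
      show "cmod (v x) \<le> cmod (complex_of_real S * complex_of_real (indicator W x))"
        using le[of x] by (cases "x \<in> W") (auto simp: norm_mult)
    qed
  qed measurable
  show sq: "sq_integrable (u n)" for n by (rule dom[OF u bd])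
  define l where "l = (\<lambda>x. lim (\<lambda>n. u n x))"
  have lim: "(\<lambda>n. u n x) \<longlonglongrightarrow> l x" for x using conv[of x] by (simp add: l_def convergent_LIMSEQ_iff)
  have lm [measurable]: "l \<in> borel_measurable lebesgue" unfolding l_def by measurable
  have lb: "cmod (l x) \<le> S * indicator W x" for x
    by (rule LIMSEQ_le_const2[OF tendsto_norm[OF lim]]) (use bd in auto)
  have sql: "sq_integrable l" by (rule dom[OF lm lb])
  have "(\<lambda>n. LINT x|lebesgue. (cmod (u n x - l x))\<^sup>2) \<longlonglongrightarrow> (LINT (x :: 'a)|lebesgue. (cmod (0 :: complex))\<^sup>2)"
  proof (rule integral_dominated_convergence[where w="\<lambda>x. (2 * S)\<^sup>2 * indicator W x"])
    show "integrable lebesgue (\<lambda>x. (2 * S)\<^sup>2 * indicator W x :: real)"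
      using W by (intro integrable_mult_right integrable_real_indicator)
    show "AE x in lebesgue. (\<lambda>n. (cmod (u n x - l x))\<^sup>2) \<longlonglongrightarrow> (cmod (0 :: complex))\<^sup>2"
    proof (intro AE_I2)
      fix x
      have "(\<lambda>n. u n x - l x) \<longlonglongrightarrow> 0" using lim[of x] by (simp add: LIM_zero_iff)
      then show "(\<lambda>n. (cmod (u n x - l x))\<^sup>2) \<longlonglongrightarrow> (cmod (0 :: complex))\<^sup>2" by (intro tendsto_intros)
    qed
    show "AE x in lebesgue. norm ((cmod (u n x - l x))\<^sup>2) \<le> (2 * S)\<^sup>2 * indicator W x" for n
    proof (intro AE_I2)
      fix x
      have "cmod (u n x - l x) \<le> 2 * S * indicator W x"
        using norm_triangle_ineq4[of "u n x" "l x"] bd[of n x] lb[of x] by linarith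
      then have "(cmod (u n x - l x))\<^sup>2 \<le> (2 * S * indicator W x)\<^sup>2" by (intro power_mono) auto
      also have "\<dots> = (2 * S)\<^sup>2 * indicator W x" by (auto simp: indicator_def)
      finally show "norm ((cmod (u n x - l x))\<^sup>2) \<le> (2 * S)\<^sup>2 * indicator W x" by simp
    qed
  qed measurable
  moreover have "(norm (abs_L2 (u n) - abs_L2 l))\<^sup>2 = (LINT x|lebesgue. (cmod (u n x - l x))\<^sup>2)" for n
    unfolding norm_diff_abs_L2[OF sql]
  proof (rule integral_cong_AE)
    show "AE x in lebesgue. (cmod (rep_L2 (abs_L2 (u n)) x - l x))\<^sup>2 = (cmod (u n x - l x))\<^sup>2"
      using rep_abs_L2[OF sq[of n]] by eventually_elim simp
  qed measurable
  ultimately have "(\<lambda>n. (norm (abs_L2 (u n) - abs_L2 l))\<^sup>2) \<longlonglongrightarrow> 0" by simp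
  from tendsto_real_sqrt[OF this] have "(\<lambda>n. abs_L2 (u n)) \<longlonglongrightarrow> abs_L2 l"
    by (simp add: tendsto_norm_zero_iff LIM_zero_iff)
  then show "Cauchy (\<lambda>n. abs_L2 (u n))" by (rule LIMSEQ_imp_Cauchy)
qed

text \<open>Outside \<open>W\<close> the potential controls the function, since |f|^2 <= V |f|^2 / M
  there; inside, the average is close to \<open>f\<close> by the gradient bound. Both errors depend
  on \<open>f\<close> only through the bound \<open>B\<close>.\<close>

lemma localised_avg_approx:
  fixes f :: "'a :: euclidean_space L2"
  assumes wg: "weak_grad f g" and G: "grad_norm_sq g \<le> B"
    and V: "\<And>x. V x \<ge> 0" "integrable lebesgue (\<lambda>x. V x * (cmod (rep_L2 f x))\<^sup>2)"
      "(LINT x|lebesgue. V x * (cmod (rep_L2 f x))\<^sup>2) \<le> B"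
    and W: "W \<in> sets lebesgue" "\<And>x. x \<notin> W \<Longrightarrow> M \<le> V x" and M: "M > 0"
  shows "(norm (f - abs_L2 (\<lambda>x. indicator W x *\<^sub>R avg k (rep_L2 f) x)))\<^sup>2
    \<le> B / M + (2 * sqrt (poincare_const TYPE('a) * B) * (1/2) ^ k)\<^sup>2"
proof -
  let ?a = "avg k (rep_L2 f)"
  have a: "sq_integrable ?a" by (rule sq_integrable_avg(1)[OF sq_integrable_rep])
  have d: "integrable lebesgue (\<lambda>x. (cmod (rep_L2 f x - ?a x))\<^sup>2)"
    using sq_integrable_diff[OF sq_integrable_rep a] by (simp add: sq_integrable_def)
  have u: "sq_integrable (\<lambda>x. indicator W x *\<^sub>R ?a x)" by (rule sq_integrable_times_indicator[OF W(1) a])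
  have "(norm (f - abs_L2 (\<lambda>x. indicator W x *\<^sub>R ?a x)))\<^sup>2
      = (LINT x|lebesgue. (cmod (rep_L2 f x - indicator W x *\<^sub>R ?a x))\<^sup>2)"
    by (rule norm_diff_abs_L2[OF u])
  also have "\<dots> \<le> (LINT x|lebesgue. (1 / M) * (V x * (cmod (rep_L2 f x))\<^sup>2) + (cmod (rep_L2 f x - ?a x))\<^sup>2)"
  proof (rule integral_mono)
    show "integrable lebesgue (\<lambda>x. (cmod (rep_L2 f x - indicator W x *\<^sub>R ?a x))\<^sup>2)"
      using sq_integrable_diff[OF sq_integrable_rep u] by (simp add: sq_integrable_def)
    show "integrable lebesgue (\<lambda>x. (1 / M) * (V x * (cmod (rep_L2 f x))\<^sup>2) + (cmod (rep_L2 f x - ?a x))\<^sup>2)"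
      by (intro Bochner_Integration.integrable_add integrable_mult_right V(2) d)
    fix x
    show "(cmod (rep_L2 f x - indicator W x *\<^sub>R ?a x))\<^sup>2
        \<le> (1 / M) * (V x * (cmod (rep_L2 f x))\<^sup>2) + (cmod (rep_L2 f x - ?a x))\<^sup>2"
    proof (cases "x \<in> W")
      case True
      then show ?thesis using V(1)[of x] M by simp
    next
      case False
      have "1 * (cmod (rep_L2 f x))\<^sup>2 \<le> (V x / M) * (cmod (rep_L2 f x))\<^sup>2"
        using W(2)[OF False] M by (intro mult_right_mono) auto
      then have "(cmod (rep_L2 f x))\<^sup>2 \<le> (1 / M) * (V x * (cmod (rep_L2 f x))\<^sup>2)" by simp
      then show ?thesis using False by (simp add: add_increasing2)
    qed
  qed
  also have "\<dots> = (1 / M) * (LINT x|lebesgue. V x * (cmod (rep_L2 f x))\<^sup>2) + (LINT x|lebesgue. (cmod (rep_L2 f x - ?a x))\<^sup>2)"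
    using V(2) d by simp
  also have "\<dots> \<le> B / M + (2 * sqrt (poincare_const TYPE('a) * B) * (1/2) ^ k)\<^sup>2"
  proof (rule add_mono)
    show "(1 / M) * (LINT x|lebesgue. V x * (cmod (rep_L2 f x))\<^sup>2) \<le> B / M"
      using V(3) M by (simp add: divide_right_mono)
    have "(LINT x|lebesgue. (cmod (rep_L2 f x - ?a x))\<^sup>2) = (norm (f - cube_avg k f))\<^sup>2"
      unfolding cube_avg_def by (rule norm_diff_abs_L2[OF a, symmetric])
    also have "\<dots> \<le> (2 * sqrt (poincare_const TYPE('a) * grad_norm_sq g) * (1/2) ^ k)\<^sup>2"
      by (intro power_mono cube_avg_converges(2)[OF wg]) auto
    also have "\<dots> \<le> (2 * sqrt (poincare_const TYPE('a) * B) * (1/2) ^ k)\<^sup>2"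
      using G grad_norm_sq_nonneg[of g]
      by (intro power_mono mult_right_mono mult_left_mono real_sqrt_le_mono mult_nonneg_nonneg)
        (auto simp: poincare_const_def)
    finally show "(LINT x|lebesgue. (cmod (rep_L2 f x - ?a x))\<^sup>2) \<le> (2 * sqrt (poincare_const TYPE('a) * B) * (1/2) ^ k)\<^sup>2" .
  qed
  finally show ?thesis .
qed

text \<open>There are countably many dyadic cubes and the integrals over them are bounded, so a
  diagonal subsequence makes all of them converge; then the averages of every level converge at
  every point. Cut off to a large ball they are Cauchy in L2 by domination, and the preceding
  estimate transfers this to the sequence itself.\<close>

theorem compact_embedding:
  fixes F :: "nat \<Rightarrow> 'a :: euclidean_space L2"
  assumes V_nonneg: "\<And>x. V x \<ge> 0" and V_infty: "filterlim V at_top at_infinity"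
    and wg: "\<And>n. weak_grad (F n) (g n)" and N: "\<And>n. (norm (F n))\<^sup>2 \<le> B" and G: "\<And>n. grad_norm_sq (g n) \<le> B"
    and VF: "\<And>n. integrable lebesgue (\<lambda>x. V x * (cmod (rep_L2 (F n) x))\<^sup>2)"
      "\<And>n. (LINT x|lebesgue. V x * (cmod (rep_L2 (F n) x))\<^sup>2) \<le> B"
  shows "\<exists>r. strict_mono (r :: nat \<Rightarrow> nat) \<and> Cauchy (\<lambda>n. F (r n))"
proof -
  have B0: "B \<ge> 0" using N[of 0] by (meson order.trans zero_le_power2)
  have nF: "norm (F n) \<le> sqrt B" for n using N[of n] by (simp add: real_le_rsqrt)
  define ci where "ci = (\<lambda>n Q. LINT y|lebesgue. indicator Q y *\<^sub>R rep_L2 (F n) y)"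
  let ?S = "\<Union>k. range (cube k) :: 'a set set"
  have ci_bound: "norm (ci n Q) \<le> sqrt B" if QS: "Q \<in> ?S" for n Q
  proof -
    obtain k x where Q: "Q = cube k x" using QS by blast
    show ?thesis
      using order.trans[OF cube_integral_bound nF, of n k x] unfolding ci_def Q cube_integral_def .
  qed
  have cS: "countable ?S" using countable_cubes by auto
  have "\<exists>r. strict_mono (r :: nat \<Rightarrow> nat) \<and> (\<forall>Q\<in>?S. \<exists>l. (\<lambda>n. ci (r n) Q) \<longlonglongrightarrow> l)"
  proof (rule function_convergent_subsequence[OF cS ci_bound])
    fix r :: "nat \<Rightarrow> nat"
    assume "strict_mono r" "\<And>Q. Q \<in> ?S \<Longrightarrow> \<exists>l. (\<lambda>n. ci (r n) Q) \<longlonglongrightarrow> l"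
    then show ?thesis by (intro exI[of _ r]) simp
  qed
  then obtain r where r: "strict_mono (r :: nat \<Rightarrow> nat)"
    and lim: "\<And>Q. Q \<in> ?S \<Longrightarrow> \<exists>l. (\<lambda>n. ci (r n) Q) \<longlonglongrightarrow> l" by auto
  have conv: "convergent (\<lambda>n. avg k (rep_L2 (F (r n))) x)" for k x
  proof -
    obtain l where "(\<lambda>n. ci (r n) (cube k x)) \<longlonglongrightarrow> l" using lim[of "cube k x"] by blast
    then have "(\<lambda>n. avg k (rep_L2 (F (r n))) x) \<longlonglongrightarrow> (2 ^ k) ^ DIM('a) *\<^sub>R l"
      unfolding avg_def ci_def by (intro tendsto_intros)
    then show ?thesis by (rule convergentI)
  qed
  have "Cauchy (\<lambda>n. F (r n))"
  proof (rule CauchyI)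
    fix e :: real assume e: "e > 0"
    \<comment> \<open>Two approximation errors of at most 2 e' each and one Cauchy error below e'
      add up to less than 6 e'.\<close>
    define e' where "e' = e / 6"
    have e': "e' > 0" using e by (simp add: e'_def)
    let ?K = "2 * sqrt (poincare_const TYPE('a) * B)"
    have "(\<lambda>k. ?K * (1/2) ^ k) \<longlonglongrightarrow> ?K * 0"
      by (intro tendsto_intros LIMSEQ_realpow_zero) auto
    then have "\<forall>\<^sub>F k in sequentially. ?K * (1/2) ^ k < e'" using e' by (intro order_tendstoD) auto
    then obtain k where k: "?K * (1/2) ^ k < e'" by (auto simp: eventually_sequentially)
    have K0: "?K * (1/2) ^ k \<ge> 0" using B0 by (simp add: poincare_const_def)
    \<comment> \<open>Chosen to give B / M <= e'^2; the summand 1 keeps \<open>M\<close> positive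
      when \<open>B\<close> is 0.\<close>
    define M where "M = B / e'\<^sup>2 + 1"
    have M: "M > 0" using B0 e' by (simp add: M_def add_nonneg_pos)
    have BM: "B / M \<le> e'\<^sup>2"
      using B0 e' M by (simp add: divide_le_eq) (simp add: M_def distrib_left)
    have "\<forall>\<^sub>F x in at_infinity. M \<le> V x" using V_infty by (simp add: filterlim_at_top)
    then obtain R where R: "\<And>x. R \<le> norm x \<Longrightarrow> M \<le> V x" by (auto simp: eventually_at_infinity)
    let ?W = "cball 0 R :: 'a set"
    define u where "u = (\<lambda>n x. indicator ?W x *\<^sub>R avg k (rep_L2 (F (r n))) x)"
    have near: "norm (F (r n) - abs_L2 (u n)) \<le> 2 * e'" for n
    proof (rule power2_le_imp_le)
      have "(norm (F (r n) - abs_L2 (u n)))\<^sup>2 \<le> B / M + (?K * (1/2) ^ k)\<^sup>2"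
        unfolding u_def by (rule localised_avg_approx[OF wg G V_nonneg VF _ _ M]) (auto simp: R)
      also have "\<dots> \<le> e'\<^sup>2 + e'\<^sup>2" using BM k K0 by (intro add_mono power_mono) auto
      also have "\<dots> \<le> (2 * e')\<^sup>2" by (simp add: power_mult_distrib)
      finally show "(norm (F (r n) - abs_L2 (u n)))\<^sup>2 \<le> (2 * e')\<^sup>2" .
    qed (use e' in simp)
    have "Cauchy (\<lambda>n. abs_L2 (u n))"
    proof (rule dominated_L2_Cauchy(2))
      show "u n \<in> borel_measurable lebesgue" for n
        unfolding u_def by (intro borel_measurable_scaleR avg_measurable rep_measurable borel_measurable_indicator) auto
      show "emeasure lebesgue ?W < \<infinity>" using emeasure_compact_finite[of ?W] by simp
      show "cmod (u n x) \<le> ((2 ^ k) ^ DIM('a) * sqrt B) * indicator ?W x" for n x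
      proof -
        have "cmod (avg k (rep_L2 (F (r n))) x) \<le> (2 ^ k) ^ DIM('a) * sqrt B"
          unfolding avg_eq_cube_integral norm_scaleR
          using order.trans[OF cube_integral_bound nF, of "r n" k x] by (simp add: mult_left_mono)
        then show ?thesis by (auto simp: u_def indicator_def)
      qed
      show "convergent (\<lambda>n. u n x)" for x
        unfolding u_def by (cases "x \<in> ?W") (auto simp: conv convergent_const)
    qed auto
    then obtain N where N: "\<And>m n. m \<ge> N \<Longrightarrow> n \<ge> N \<Longrightarrow> norm (abs_L2 (u m) - abs_L2 (u n)) < e'"
      using e' unfolding Cauchy_iff by meson
    have "norm (F (r m) - F (r n)) < e" if "m \<ge> N" "n \<ge> N" for m n
    proof -
      have "F (r m) - F (r n) = (F (r m) - abs_L2 (u m)) + ((abs_L2 (u m) - abs_L2 (u n)) - (F (r n) - abs_L2 (u n)))"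
        by simp
      then have "norm (F (r m) - F (r n)) \<le> norm (F (r m) - abs_L2 (u m))
          + (norm (abs_L2 (u m) - abs_L2 (u n)) + norm (F (r n) - abs_L2 (u n)))"
        using norm_triangle_ineq[of "F (r m) - abs_L2 (u m)" "(abs_L2 (u m) - abs_L2 (u n)) - (F (r n) - abs_L2 (u n))"]
          norm_triangle_ineq4[of "abs_L2 (u m) - abs_L2 (u n)" "F (r n) - abs_L2 (u n)"] by simp
      then show ?thesis using near[of m] near[of n] N[OF that] e' unfolding e'_def by linarith
    qed
    then show "\<exists>N. \<forall>m\<ge>N. \<forall>n\<ge>N. norm (F (r m) - F (r n)) < e" by blast
  qed
  with r show ?thesis by blast
qed

section \<open>Potentials that are form-bounded by the gradient\<close>

abbreviation grad_sq_norm :: "'a :: euclidean_space L2 \<Rightarrow> real" where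
  "grad_sq_norm f \<equiv> grad_norm_sq (\<lambda>b. weak_deriv b f)"

lemma weak_grad_H1: "f \<in> H1 \<Longrightarrow> weak_grad f (\<lambda>b. weak_deriv b f)"
  by (simp add: weak_grad_def weak_deriv)

lemma H1_zero: "0 \<in> H1"
  using is_weak_deriv_zero by (auto simp: H1_def)

lemma H1_add: "f \<in> H1 \<Longrightarrow> g \<in> H1 \<Longrightarrow> f + g \<in> H1"
  unfolding H1_def using is_weak_deriv_add by blast

lemma H1_scaleC: "f \<in> H1 \<Longrightarrow> c *\<^sub>C f \<in> H1"
  unfolding H1_def using is_weak_deriv_scaleC by blast

lemma weak_deriv_add: "b \<in> Basis \<Longrightarrow> f \<in> H1 \<Longrightarrow> g \<in> H1 \<Longrightarrow> weak_deriv b (f + g) = weak_deriv b f + weak_deriv b g"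
  by (intro weak_deriv_eq is_weak_deriv_add weak_deriv)

lemma weak_deriv_scaleC: "b \<in> Basis \<Longrightarrow> f \<in> H1 \<Longrightarrow> weak_deriv b (c *\<^sub>C f) = c *\<^sub>C weak_deriv b f"
  by (intro weak_deriv_eq is_weak_deriv_scaleC weak_deriv)

lemma weak_deriv_diff:
  assumes "b \<in> Basis" "f \<in> H1" "g \<in> H1"
  shows "weak_deriv b (f - g) = weak_deriv b f - weak_deriv b g"
  using weak_deriv_add[OF assms(1,2) H1_scaleC[OF assms(3), of "-1"]] weak_deriv_scaleC[OF assms(1,3), of "-1"]
  by (simp add: scaleC_minus_one)

lemma mult_le_sum_squares:
  fixes p q :: real
  assumes "p \<ge> 0" "q \<ge> 0"
  shows "p * q \<le> p\<^sup>2 + q\<^sup>2"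
proof -
  have "2 * (p * q) \<le> p\<^sup>2 + q\<^sup>2" using zero_le_power2[of "p - q"] by (simp add: power2_diff)
  moreover have "0 \<le> p * q" using assms by simp
  ultimately show ?thesis by linarith
qed

lemma H1_fourth_power:
  fixes f :: "'a :: euclidean_space L2"
  assumes "I4 (rep_L2 f) \<le> ennreal (Q ^ 4)" "Q \<ge> 0"
  shows "sq_integrable (\<lambda>x. complex_of_real ((cmod (rep_L2 f x))\<^sup>2))"
    and "(LINT x|lebesgue. (cmod (complex_of_real ((cmod (rep_L2 f x))\<^sup>2)))\<^sup>2) \<le> Q ^ 4"
proof -
  have e: "(cmod (complex_of_real ((cmod z)\<^sup>2)))\<^sup>2 = (cmod z) ^ 4" for z
    by (simp add: power_mult[symmetric] norm_power)
  have "(\<integral>\<^sup>+x. ennreal ((cmod (rep_L2 f x)) ^ 4) \<partial>lebesgue) < \<infinity>"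
    using assms(1) unfolding I4_def by (simp add: le_less_trans)
  then have i: "integrable lebesgue (\<lambda>x. (cmod (rep_L2 f x)) ^ 4)"
    by (intro integrableI_nonneg) auto
  then show "sq_integrable (\<lambda>x. complex_of_real ((cmod (rep_L2 f x))\<^sup>2))"
    unfolding sq_integrable_def e by (intro conjI i) measurable
  have "ennreal (LINT x|lebesgue. (cmod (rep_L2 f x)) ^ 4) \<le> ennreal (Q ^ 4)"
    using assms(1) i unfolding I4_def by (simp add: nn_integral_eq_integral)
  then show "(LINT x|lebesgue. (cmod (complex_of_real ((cmod (rep_L2 f x))\<^sup>2)))\<^sup>2) \<le> Q ^ 4"
    unfolding e using assms(2) by (simp add: ennreal_le_iff)
qed

text \<open>Cauchy-Schwarz splits off the L2 norm of \<open>w\<close> and leaves the square of the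
  L4 norm of \<open>f\<close>, to which the Sobolev bound with small gradient constant
  applies.\<close>

lemma sq_integrable_potential_bound:
  assumes dim: "DIM('a :: euclidean_space) \<le> 3" and w: "sq_integrable (w :: 'a \<Rightarrow> complex)" and e: "e > 0"
  shows "\<exists>M\<ge>0. \<forall>f\<in>H1. integrable lebesgue (\<lambda>x. cmod (w x) * (cmod (rep_L2 f x))\<^sup>2) \<and>
    (LINT x|lebesgue. cmod (w x) * (cmod (rep_L2 f x))\<^sup>2) \<le> M * (norm f)\<^sup>2 + e * grad_sq_norm f"
proof -
  let ?T = "sqrt (LINT x|lebesgue. (cmod (w x))\<^sup>2)"
  have T0: "?T \<ge> 0" by (simp add: integral_nonneg_AE)
  \<comment> \<open>The gradient ends up with the coefficient 2 ?T d^2, which this choice keeps at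
    most \<open>e\<close>; the summand 1 avoids division by zero when \<open>w\<close>
    vanishes.\<close>
  define d where "d = sqrt (e / (2 * (?T + 1)))"
  have d: "d > 0" "d\<^sup>2 = e / (2 * (?T + 1))" using e T0 by (auto simp: d_def add_nonneg_pos)
  obtain M where M: "M \<ge> 0" "\<And>(f :: 'a L2) g. weak_grad f g \<Longrightarrow>
      I4 (rep_L2 f) \<le> ennreal ((M * norm f + d * sqrt (grad_norm_sq g)) ^ 4)"
    using sobolev_L4[OF dim d(1)] by blast
  have "integrable lebesgue (\<lambda>x. cmod (w x) * (cmod (rep_L2 f x))\<^sup>2) \<and>
    (LINT x|lebesgue. cmod (w x) * (cmod (rep_L2 f x))\<^sup>2) \<le> (2 * ?T * M\<^sup>2) * (norm f)\<^sup>2 + e * grad_sq_norm f"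
    if f: "f \<in> H1" for f :: "'a L2"
  proof -
    let ?v = "\<lambda>x. complex_of_real ((cmod (rep_L2 f x))\<^sup>2)"
    let ?G = "grad_sq_norm f"
    let ?Q = "M * norm f + d * sqrt ?G"
    have G0: "?G \<ge> 0" by (rule grad_norm_sq_nonneg)
    have Q0: "?Q \<ge> 0" using M(1) d(1) G0 by simp
    note v = H1_fourth_power[OF M(2)[OF weak_grad_H1[OF f]] Q0]
    have eq: "cmod (w x * ?v x) = cmod (w x) * (cmod (rep_L2 f x))\<^sup>2" for x by (simp add: norm_mult norm_power)
    have i: "integrable lebesgue (\<lambda>x. cmod (w x) * (cmod (rep_L2 f x))\<^sup>2)"
      using integrable_norm[OF sq_integrable_mult_integrable[OF w v(1)]] unfolding eq .
    have "(LINT x|lebesgue. cmod (w x) * (cmod (rep_L2 f x))\<^sup>2) \<le> ?T * sqrt (LINT x|lebesgue. (cmod (?v x))\<^sup>2)"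
      using sq_integrable_Cauchy_Schwarz[OF w v(1)] by (simp add: norm_power)
    also have "\<dots> \<le> ?T * sqrt (?Q ^ 4)" by (intro mult_left_mono real_sqrt_le_mono v(2) T0)
    also have "sqrt (?Q ^ 4) = ?Q\<^sup>2" by (rule real_sqrt_unique) (simp_all add: power_mult[symmetric])
    also have "?T * ?Q\<^sup>2 \<le> ?T * (2 * (M * norm f)\<^sup>2 + 2 * (d * sqrt ?G)\<^sup>2)"
    proof (rule mult_left_mono[OF _ T0])
      show "?Q\<^sup>2 \<le> 2 * (M * norm f)\<^sup>2 + 2 * (d * sqrt ?G)\<^sup>2"
        using zero_le_power2[of "M * norm f - d * sqrt ?G"] by (simp add: power2_sum power2_diff)
    qed
    also have "\<dots> = (2 * ?T * M\<^sup>2) * (norm f)\<^sup>2 + (2 * ?T * d\<^sup>2) * ?G"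
      using G0 by (simp add: power_mult_distrib algebra_simps)
    also have "\<dots> \<le> (2 * ?T * M\<^sup>2) * (norm f)\<^sup>2 + e * ?G"
    proof (intro add_left_mono mult_right_mono G0)
      have "2 * X * (e / (2 * Y)) = e * (X / Y)" for X Y :: real by simp
      then have "2 * ?T * d\<^sup>2 = e * (?T / (?T + 1))" unfolding d(2) .
      also have "\<dots> \<le> e * 1"
      proof (rule mult_left_mono)
        have "0 < ?T + 1" using T0 by linarith
        then show "?T / (?T + 1) \<le> 1" by (subst divide_le_eq_1_pos) auto
      qed (use e in simp)
      finally show "2 * ?T * d\<^sup>2 \<le> e" by simp
    qed
    finally show ?thesis using i by blast
  qed
  then show ?thesis using T0 by (intro exI[of _ "2 * ?T * M\<^sup>2"]) auto
qed

text \<open>The modulus is at most |\<phi>|^2 + |\<psi>|^2, and both squares lie in L2 by the L4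
  bound. This makes the interaction coefficients square integrable potentials.\<close>

lemma sq_integrable_H1_mult:
  fixes \<phi> \<psi> :: "'a :: euclidean_space L2"
  assumes dim: "DIM('a) \<le> 3" and "\<phi> \<in> H1" "\<psi> \<in> H1"
  shows "sq_integrable (\<lambda>x. rep_L2 \<phi> x * rep_L2 \<psi> x)"
proof -
  obtain M where M: "M \<ge> 0" "\<And>(f :: 'a L2) g. weak_grad f g \<Longrightarrow>
      I4 (rep_L2 f) \<le> ennreal ((M * norm f + 1 * sqrt (grad_norm_sq g)) ^ 4)"
    using sobolev_L4[OF dim, of 1] by auto
  have v: "sq_integrable (\<lambda>x. complex_of_real ((cmod (rep_L2 f x))\<^sup>2))" if "f \<in> H1" for f :: "'a L2"
    by (rule H1_fourth_power(1)[OF M(2)[OF weak_grad_H1[OF that]]])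
      (intro add_nonneg_nonneg mult_nonneg_nonneg M(1) real_sqrt_ge_zero grad_norm_sq_nonneg norm_ge_zero, simp)
  show ?thesis
  proof (rule sq_integrable_bound[OF sq_integrable_add[OF v v]])
    show "\<phi> \<in> H1" "\<psi> \<in> H1" by fact+
    show "AE x in lebesgue. cmod (rep_L2 \<phi> x * rep_L2 \<psi> x)
        \<le> cmod (complex_of_real ((cmod (rep_L2 \<phi> x))\<^sup>2) + complex_of_real ((cmod (rep_L2 \<psi> x))\<^sup>2))"
    proof (intro AE_I2)
      fix x
      let ?p = "cmod (rep_L2 \<phi> x)" and ?q = "cmod (rep_L2 \<psi> x)"
      have "?p * ?q \<le> ?p\<^sup>2 + ?q\<^sup>2" by (intro mult_le_sum_squares) auto
      then show "cmod (rep_L2 \<phi> x * rep_L2 \<psi> x) \<le> cmod (complex_of_real (?p\<^sup>2) + complex_of_real (?q\<^sup>2))"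
        by (simp only: of_real_add[symmetric] norm_of_real norm_mult)
    qed
  qed measurable
qed

text \<open>Constants and square integrable functions together cover the shifts by \<delta> and
  \<mu> and the products of the components. The potential \<open>V\<close> is kept apart and enters
  the form norm itself.\<close>

definition admissible :: "('a :: euclidean_space \<Rightarrow> complex) \<Rightarrow> bool" where
  "admissible P \<longleftrightarrow> (\<exists>c w. sq_integrable w \<and> P = (\<lambda>x. c + w x))"

lemma admissible_measurable: "admissible P \<Longrightarrow> P \<in> borel_measurable lebesgue"
  by (auto simp: admissible_def sq_integrable_def)

lemma admissible_const: "admissible (\<lambda>x. c)"
  unfolding admissible_def using sq_integrable_zero by (intro exI[of _ c] exI[of _ "\<lambda>x. 0"]) simp

lemma admissible_sq: "sq_integrable w \<Longrightarrow> admissible w"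
  unfolding admissible_def by (intro exI[of _ 0] exI[of _ w]) simp

lemma admissible_add: "admissible P \<Longrightarrow> admissible Q \<Longrightarrow> admissible (\<lambda>x. P x + Q x)"
proof -
  assume "admissible P" "admissible Q"
  then obtain c w d v where "sq_integrable w" "P = (\<lambda>x. c + w x)" "sq_integrable v" "Q = (\<lambda>x. d + v x)"
    unfolding admissible_def by blast
  then show ?thesis
    unfolding admissible_def by (intro exI[of _ "c + d"] exI[of _ "\<lambda>x. w x + v x"]) (auto intro: sq_integrable_add)
qed

text \<open>The integral in \<open>mult_form\<close> is 0 by convention when the integrand is not
  integrable, so additivity has to carry this condition.\<close>

definition mult_integrable :: "('a :: euclidean_space \<Rightarrow> complex) \<Rightarrow> 'a L2 \<Rightarrow> 'a L2 \<Rightarrow> bool" where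
  "mult_integrable P f g \<longleftrightarrow> integrable lebesgue (\<lambda>x. P x * rep_L2 f x * cnj (rep_L2 g x))"

lemma mult_form_add_left:
  assumes P: "P \<in> borel_measurable lebesgue" and "mult_integrable P f h" "mult_integrable P g h"
  shows "mult_form P (f + g) h = mult_form P f h + mult_form P g h"
proof -
  note [measurable] = P
  have "mult_form P (f + g) h = (LINT x|lebesgue. P x * rep_L2 f x * cnj (rep_L2 h x) + P x * rep_L2 g x * cnj (rep_L2 h x))"
    unfolding mult_form_def
  proof (rule integral_cong_AE)
    show "AE x in lebesgue. P x * rep_L2 (f + g) x * cnj (rep_L2 h x)
        = P x * rep_L2 f x * cnj (rep_L2 h x) + P x * rep_L2 g x * cnj (rep_L2 h x)"
      using rep_plus[of f g] by eventually_elim (simp add: algebra_simps)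
  qed measurable
  then show ?thesis using assms(2,3) by (simp add: mult_form_def mult_integrable_def)
qed

lemma mult_form_scaleC_left:
  assumes P: "P \<in> borel_measurable lebesgue"
  shows "mult_form P (c *\<^sub>C f) h = c * mult_form P f h"
proof -
  note [measurable] = P
  have "mult_form P (c *\<^sub>C f) h = (LINT x|lebesgue. c * (P x * rep_L2 f x * cnj (rep_L2 h x)))"
    unfolding mult_form_def
  proof (rule integral_cong_AE)
    show "AE x in lebesgue. P x * rep_L2 (c *\<^sub>C f) x * cnj (rep_L2 h x) = c * (P x * rep_L2 f x * cnj (rep_L2 h x))"
      using rep_scaleC[of c f] by eventually_elim (simp add: algebra_simps)
  qed measurable
  then show ?thesis by (simp add: mult_form_def)
qed

lemma mult_form_add_potential:
  assumes "mult_integrable P f g" "mult_integrable Q f g"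
  shows "mult_form (\<lambda>x. P x + Q x) f g = mult_form P f g + mult_form Q f g"
proof -
  have "mult_form (\<lambda>x. P x + Q x) f g = (LINT x|lebesgue. P x * rep_L2 f x * cnj (rep_L2 g x) + Q x * rep_L2 f x * cnj (rep_L2 g x))"
    unfolding mult_form_def by (simp add: distrib_right)
  then show ?thesis using assms by (simp add: mult_form_def mult_integrable_def)
qed

lemma mult_form_commute:
  assumes P: "P \<in> borel_measurable lebesgue" and real: "AE x in lebesgue. P x \<in> \<real>"
  shows "mult_form P g f = cnj (mult_form P f g)"
proof -
  note [measurable] = P
  have "cnj (mult_form P f g) = (LINT x|lebesgue. cnj (P x * rep_L2 f x * cnj (rep_L2 g x)))"
    unfolding mult_form_def by (rule Bochner_Integration.integral_cnj[symmetric])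
  also have "\<dots> = mult_form P g f"
    unfolding mult_form_def
  proof (rule integral_cong_AE)
    show "AE x in lebesgue. cnj (P x * rep_L2 f x * cnj (rep_L2 g x)) = P x * rep_L2 g x * cnj (rep_L2 f x)"
      using real by eventually_elim (simp add: Reals_cnj_iff)
  qed measurable
  finally show ?thesis by simp
qed

text \<open>The inequality |f||g| <= |f|^2 + |g|^2 reduces the mixed form to the diagonal bounds for
  the constant and for \<open>w\<close>.\<close>

lemma admissible_mult_form:
  assumes dim: "DIM('a :: euclidean_space) \<le> 3" and P: "admissible (P :: 'a \<Rightarrow> complex)" and e: "e > 0"
  shows "\<exists>M\<ge>0. \<forall>f\<in>H1. \<forall>g\<in>H1. mult_integrable P f g \<and>
    cmod (mult_form P f g) \<le> M * ((norm f)\<^sup>2 + (norm g)\<^sup>2) + e * (grad_sq_norm f + grad_sq_norm g)"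
proof -
  obtain c w where w: "sq_integrable w" and Pw: "P = (\<lambda>x. c + w x)" using P by (auto simp: admissible_def)
  obtain M where M: "M \<ge> 0" "\<And>f :: 'a L2. f \<in> H1 \<Longrightarrow> integrable lebesgue (\<lambda>x. cmod (w x) * (cmod (rep_L2 f x))\<^sup>2) \<and>
    (LINT x|lebesgue. cmod (w x) * (cmod (rep_L2 f x))\<^sup>2) \<le> M * (norm f)\<^sup>2 + e * grad_sq_norm f"
    using sq_integrable_potential_bound[OF dim w e] by blast
  note [measurable] = admissible_measurable[OF P]
  have "mult_integrable P f g \<and>
    cmod (mult_form P f g) \<le> (cmod c + M) * ((norm f)\<^sup>2 + (norm g)\<^sup>2) + e * (grad_sq_norm f + grad_sq_norm g)"
    if f: "f \<in> H1" and g: "g \<in> H1" for f g :: "'a L2"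
  proof -
    let ?b = "\<lambda>f x. cmod c * (cmod (rep_L2 f x))\<^sup>2 + cmod (w x) * (cmod (rep_L2 f x))\<^sup>2"
    have ib: "integrable lebesgue (?b h)" if "h \<in> H1" for h
      using M(2)[OF that] by (intro Bochner_Integration.integrable_add integrable_mult_right integrable_rep_sq) auto
    have le: "cmod (P x * rep_L2 f x * cnj (rep_L2 g x)) \<le> ?b f x + ?b g x" for x
    proof -
      let ?p = "cmod (rep_L2 f x)" and ?q = "cmod (rep_L2 g x)"
      have pq: "?p * ?q \<le> ?p\<^sup>2 + ?q\<^sup>2" by (intro mult_le_sum_squares) auto
      have "cmod (P x * rep_L2 f x * cnj (rep_L2 g x)) = cmod (P x) * (?p * ?q)" by (simp add: norm_mult)
      also have "\<dots> \<le> (cmod c + cmod (w x)) * (?p\<^sup>2 + ?q\<^sup>2)"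
        by (intro mult_mono pq) (auto simp: Pw norm_triangle_ineq)
      finally show ?thesis by (simp add: algebra_simps)
    qed
    have i: "integrable lebesgue (\<lambda>x. ?b f x + ?b g x)" by (intro Bochner_Integration.integrable_add ib f g)
    have int: "integrable lebesgue (\<lambda>x. P x * rep_L2 f x * cnj (rep_L2 g x))"
    proof (rule Bochner_Integration.integrable_bound[OF i])
      show "AE x in lebesgue. norm (P x * rep_L2 f x * cnj (rep_L2 g x)) \<le> norm (?b f x + ?b g x)"
        using le order.trans[OF le abs_ge_self] by (auto simp del: abs_ge_self)
    qed measurable
    have "cmod (mult_form P f g) \<le> (LINT x|lebesgue. cmod (P x * rep_L2 f x * cnj (rep_L2 g x)))"
      unfolding mult_form_def by (rule integral_norm_bound)
    also have "\<dots> \<le> (LINT x|lebesgue. ?b f x + ?b g x)"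
      by (intro integral_mono integrable_norm int i le)
    also have "\<dots> = (LINT x|lebesgue. ?b f x) + (LINT x|lebesgue. ?b g x)"
      by (rule Bochner_Integration.integral_add[OF ib[OF f] ib[OF g]])
    also have "\<dots> \<le> ((cmod c + M) * (norm f)\<^sup>2 + e * grad_sq_norm f) + ((cmod c + M) * (norm g)\<^sup>2 + e * grad_sq_norm g)"
    proof -
      have "(LINT x|lebesgue. ?b h x) \<le> (cmod c + M) * (norm h)\<^sup>2 + e * grad_sq_norm h" if "h \<in> H1" for h
      proof -
        have "(LINT x|lebesgue. ?b h x) = cmod c * (norm h)\<^sup>2 + (LINT x|lebesgue. cmod (w x) * (cmod (rep_L2 h x))\<^sup>2)"
          unfolding norm_L2_sq using M(2)[OF that] integrable_rep_sq
          by (subst Bochner_Integration.integral_add) auto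
        then show ?thesis using M(2)[OF that] by (simp add: algebra_simps)
      qed
      then show ?thesis using f g by (intro add_mono)
    qed
    finally show ?thesis using int by (simp add: mult_integrable_def algebra_simps)
  qed
  then show ?thesis using M(1) by (intro exI[of _ "cmod c + M"]) auto
qed

section \<open>Coercive forms with a compact form domain\<close>

locale symmetric_form =
  fixes D :: "'e :: real_inner set" and a :: "'e \<Rightarrow> 'e \<Rightarrow> real"
  assumes sub: "subspace D"
    and add: "\<And>f g h. f \<in> D \<Longrightarrow> g \<in> D \<Longrightarrow> h \<in> D \<Longrightarrow> a (f + g) h = a f h + a g h"
    and scale: "\<And>c f h. f \<in> D \<Longrightarrow> h \<in> D \<Longrightarrow> a (c *\<^sub>R f) h = c * a f h"
    and sym: "\<And>f g. f \<in> D \<Longrightarrow> g \<in> D \<Longrightarrow> a f g = a g f"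
begin

lemma D_closed:
  shows "f \<in> D \<Longrightarrow> g \<in> D \<Longrightarrow> f + g \<in> D" "f \<in> D \<Longrightarrow> g \<in> D \<Longrightarrow> f - g \<in> D"
    "f \<in> D \<Longrightarrow> c *\<^sub>R f \<in> D"
  using sub by (auto intro: subspace_add subspace_diff subspace_scale)

lemma add_right: "f \<in> D \<Longrightarrow> g \<in> D \<Longrightarrow> h \<in> D \<Longrightarrow> a h (f + g) = a h f + a h g"
  by (simp add: sym[of h "f + g"] sym[of h f] sym[of h g] add D_closed)

lemma scale_right: "f \<in> D \<Longrightarrow> h \<in> D \<Longrightarrow> a h (c *\<^sub>R f) = c * a h f"
  by (simp add: sym[of h "c *\<^sub>R f"] sym[of h f] scale D_closed)

lemma expand_square:
  assumes "f \<in> D" "g \<in> D"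
  shows "a (f + t *\<^sub>R g) (f + t *\<^sub>R g) = a f f + 2 * t * a f g + t\<^sup>2 * a g g"
proof -
  have tg: "t *\<^sub>R g \<in> D" using assms by (simp add: D_closed)
  have "a (f + t *\<^sub>R g) (f + t *\<^sub>R g) = a f (f + t *\<^sub>R g) + t * a g (f + t *\<^sub>R g)"
    using assms tg by (simp add: add scale D_closed)
  also have "a f (f + t *\<^sub>R g) = a f f + t * a f g"
    using assms tg by (simp add: add_right scale_right)
  also have "a g (f + t *\<^sub>R g) = a f g + t * a g g"
    using assms tg by (simp add: add_right scale_right sym[of g f])
  finally show ?thesis by (simp add: power2_eq_square algebra_simps)
qed

lemma expand_diff:
  assumes "f \<in> D" "g \<in> D"
  shows "a (f - g) (f - g) = a f f - 2 * a f g + a g g"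
  using expand_square[OF assms, of "-1"] by simp

lemma expand_add:
  assumes "f \<in> D" "g \<in> D"
  shows "a (f + g) (f + g) = a f f + 2 * a f g + a g g"
  using expand_square[OF assms, of 1] by simp

end

text \<open>\<open>N\<close> stands for the square of the form norm. Completeness is stated through
  \<open>N\<close> of differences and compactness through the ambient norm, so no second topology is
  put on the type; \<open>Garding\<close> and \<open>bounded\<close> tie \<open>N\<close> to the
  form.\<close>

locale compact_positive_form = symmetric_form D a
  for D :: "'e :: real_inner set" and a +
  fixes N :: "'e \<Rightarrow> real" and c C C' :: real
  assumes pos: "\<And>f. f \<in> D \<Longrightarrow> f \<noteq> 0 \<Longrightarrow> a f f > 0"
    and Garding: "\<And>f. f \<in> D \<Longrightarrow> c * N f \<le> a f f + C * (norm f)\<^sup>2"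
    and c_pos: "c > 0" and C_nonneg: "C \<ge> 0" and C'_nonneg: "C' \<ge> 0"
    and bounded: "\<And>f. f \<in> D \<Longrightarrow> a f f \<le> C' * N f"
    and norm_le: "\<And>f. f \<in> D \<Longrightarrow> (norm f)\<^sup>2 \<le> N f"
    and complete: "\<And>F. (\<And>n::nat. F n \<in> D) \<Longrightarrow>
        (\<And>e. e > 0 \<Longrightarrow> \<exists>M. \<forall>m\<ge>M. \<forall>n\<ge>M. N (F m - F n) < e) \<Longrightarrow>
        \<exists>f\<in>D. (\<lambda>n. N (F n - f)) \<longlonglongrightarrow> 0"
    and compact: "\<And>F B. (\<And>n::nat. F n \<in> D \<and> N (F n) \<le> B) \<Longrightarrow>
        \<exists>r. strict_mono (r :: nat \<Rightarrow> nat) \<and> Cauchy (\<lambda>n. F (r n))"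
begin

lemma a_nonneg: "f \<in> D \<Longrightarrow> a f f \<ge> 0"
  using pos[of f] scale[of f f 0] by (cases "f = 0") (auto simp: less_imp_le)

lemma Cauchy_Schwarz:
  assumes "f \<in> D" "g \<in> D"
  shows "(a f g)\<^sup>2 \<le> a f f * a g g"
proof (cases "g = 0")
  case True
  then show ?thesis using scale[of g f 0] scale[of g g 0] sym[of f g] assms by auto
next
  case False
  then have p: "a g g > 0" using pos assms by blast
  have "0 \<le> a (f + (- a f g / a g g) *\<^sub>R g) (f + (- a f g / a g g) *\<^sub>R g)"
    using assms by (intro a_nonneg) (simp add: D_closed)
  also have "\<dots> = a f f - (a f g)\<^sup>2 / a g g"
    using p by (subst expand_square[OF assms]) (simp add: power2_eq_square field_simps)
  finally show ?thesis using p by (simp add: field_simps)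
qed

lemma tendsto_a_diff:
  assumes "\<And>n. F n \<in> D" "f \<in> D" "(\<lambda>n. N (F n - f)) \<longlonglongrightarrow> 0"
  shows "(\<lambda>n. a (F n - f) (F n - f)) \<longlonglongrightarrow> 0" "F \<longlonglongrightarrow> f"
proof -
  have lim: "(\<lambda>n. C' * N (F n - f)) \<longlonglongrightarrow> 0" using assms(3) by (auto intro!: tendsto_eq_intros)
  show "(\<lambda>n. a (F n - f) (F n - f)) \<longlonglongrightarrow> 0"
    by (rule real_tendsto_sandwich[OF _ _ tendsto_const lim])
      (auto intro!: always_eventually a_nonneg bounded D_closed assms)
  have "(\<lambda>n. (norm (F n - f))\<^sup>2) \<longlonglongrightarrow> 0"
    by (rule real_tendsto_sandwich[OF _ _ tendsto_const assms(3)])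
      (auto intro!: always_eventually norm_le D_closed assms)
  from tendsto_real_sqrt[OF this] show "F \<longlonglongrightarrow> f"
    by (simp add: LIM_zero_iff tendsto_norm_zero_iff)
qed

lemma coercive: "\<exists>m>0. \<forall>f\<in>D. m * (norm f)\<^sup>2 \<le> a f f"
proof (rule ccontr)
  assume neg: "\<not> ?thesis"
  have "\<exists>f\<in>D. norm f = 1 \<and> a f f < 1 / real (Suc n)" for n
  proof -
    have "\<not> (\<forall>f\<in>D. (1 / real (Suc n)) * (norm f)\<^sup>2 \<le> a f f)"
      using neg by (metis of_nat_0_less_iff zero_less_Suc zero_less_divide_1_iff)
    then obtain f where f: "f \<in> D" "a f f < (1 / real (Suc n)) * (norm f)\<^sup>2"
      by (auto simp: not_le)
    then have n0: "norm f > 0" using a_nonneg[of f] by (cases "f = 0") auto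
    define g where "g = (1 / norm f) *\<^sub>R f"
    have gD: "g \<in> D" using f by (simp add: g_def D_closed)
    have "a g g = (1 / norm f)\<^sup>2 * a f f"
      unfolding g_def using f sym[of f "(1 / norm f) *\<^sub>R f"]
      by (simp add: scale D_closed power2_eq_square)
    also have "\<dots> < (1 / norm f)\<^sup>2 * ((1 / real (Suc n)) * (norm f)\<^sup>2)"
      using f n0 by (intro mult_strict_left_mono) auto
    also have "\<dots> = 1 / real (Suc n)" using n0 by (simp add: field_simps)
    finally have "a g g < 1 / real (Suc n)" .
    moreover have "norm g = 1" using n0 by (simp add: g_def)
    ultimately show ?thesis using gD by blast
  qed
  then obtain F where F: "\<And>n. F n \<in> D" "\<And>n. norm (F n) = 1" "\<And>n. a (F n) (F n) < 1 / real (Suc n)"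
    by metis
  have "N (F n) \<le> (1 + C) / c" for n
  proof -
    have "1 / real (Suc n) \<le> 1" by simp
    with F(3)[of n] have "a (F n) (F n) \<le> 1" by linarith
    then have "c * N (F n) \<le> 1 + C" using Garding[OF F(1), of n] F(2)[of n] by simp
    then show ?thesis using c_pos by (simp add: field_simps)
  qed
  with F(1) obtain r where r: "strict_mono (r :: nat \<Rightarrow> nat)" "Cauchy (\<lambda>n. F (r n))"
    using compact[of F] by blast
  have small: "a (F (r n)) (F (r n)) < 1 / real (Suc n)" for n
  proof -
    have "1 / real (Suc (r n)) \<le> 1 / real (Suc n)"
      using seq_suble[OF r(1), of n] by (intro divide_left_mono) auto
    then show ?thesis using F(3)[of "r n"] by linarith
  qed
  have "\<exists>f\<in>D. (\<lambda>n. N (F (r n) - f)) \<longlonglongrightarrow> 0"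
  proof (rule complete)
    fix e :: real assume e: "e > 0"
    \<comment> \<open>The form will contribute 4 e' and the lower-order term of
      \<open>Garding\<close> C e'; the factor 2 leaves room for a strict inequality.\<close>
    define e' where "e' = c * e / (2 * (4 + C))"
    have e': "e' > 0" using e c_pos C_nonneg by (simp add: e'_def)
    obtain M1 where M1: "\<And>m n. m \<ge> M1 \<Longrightarrow> n \<ge> M1 \<Longrightarrow> (norm (F (r m) - F (r n)))\<^sup>2 < e'"
    proof -
      obtain M where "\<And>m n. m \<ge> M \<Longrightarrow> n \<ge> M \<Longrightarrow> norm (F (r m) - F (r n)) < sqrt e'"
        using r(2) e' unfolding Cauchy_iff by (meson real_sqrt_gt_zero)
      then have "(norm (F (r m) - F (r n)))\<^sup>2 < e'" if "m \<ge> M" "n \<ge> M" for m n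
        using that e' by (metis norm_ge_zero real_less_rsqrt real_sqrt_less_iff real_sqrt_abs abs_norm_cancel)
      then show thesis using that by blast
    qed
    obtain M2 :: nat where M2: "1 / real (Suc M2) < e'" using e' by (meson nat_approx_posE)
    have "N (F (r m) - F (r n)) < e" if "m \<ge> max M1 M2" "n \<ge> max M1 M2" for m n
    proof -
      have s: "1 / real (Suc k) < e'" if "k \<ge> M2" for k
      proof -
        have "1 / real (Suc k) \<le> 1 / real (Suc M2)" using that by (intro divide_left_mono) auto
        with M2 show ?thesis by linarith
      qed
      let ?f = "F (r m)" and ?g = "F (r n)"
      have "0 \<le> a (?f + ?g) (?f + ?g)" by (intro a_nonneg D_closed F)
      then have "a (?f - ?g) (?f - ?g) \<le> 2 * a ?f ?f + 2 * a ?g ?g"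
        by (simp add: expand_add expand_diff F)
      also have "\<dots> < 4 * e'" using small[of m] small[of n] s[of m] s[of n] that by simp
      finally have "c * N (?f - ?g) < 4 * e' + C * (norm (?f - ?g))\<^sup>2"
        using Garding[of "?f - ?g"] by (simp add: D_closed F)
      also have "\<dots> \<le> 4 * e' + C * e'"
        using M1[of m n] that C_nonneg by (intro add_left_mono mult_left_mono) auto
      also have "\<dots> = (4 + C) * e'" by (simp add: algebra_simps)
      also have "\<dots> = c * e / 2" using C_nonneg by (simp add: e'_def field_simps)
      also have "\<dots> < c * e" using e c_pos by simp
      finally show ?thesis using c_pos by simp
    qed
    then show "\<exists>M. \<forall>m\<ge>M. \<forall>n\<ge>M. N (F (r m) - F (r n)) < e" by blast
  qed (rule F)
  then obtain f where f: "f \<in> D" "(\<lambda>n. N (F (r n) - f)) \<longlonglongrightarrow> 0" by blast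
  have "\<And>n. F (r n) \<in> D" by (rule F)
  note lim = tendsto_a_diff[OF this f]
  have "norm f = 1" using LIMSEQ_unique[OF tendsto_norm[OF lim(2)], of 1] F(2) by simp
  moreover have "a f f \<le> 0"
  proof (rule LIMSEQ_le_const)
    have "(\<lambda>n. 2 * a (F (r n) - f) (F (r n) - f) + 2 * inverse (real (Suc n))) \<longlonglongrightarrow> 2 * 0 + 2 * 0"
      by (intro tendsto_intros lim(1) LIMSEQ_inverse_real_of_nat)
    then show "(\<lambda>n. 2 * a (F (r n) - f) (F (r n) - f) + 2 * inverse (real (Suc n))) \<longlonglongrightarrow> 0" by simp
    \<comment> \<open>The parallelogram law once more, for \<open>f\<close> written as ?g - (?g -
      f). It takes the place of continuity of the form and gives a(f, f) <= 0 in the limit, although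
      \<open>f\<close> has norm 1.\<close>
    have "a f f \<le> 2 * a (F (r n) - f) (F (r n) - f) + 2 * inverse (real (Suc n))" for n
    proof -
      let ?g = "F (r n)"
      have D: "?g \<in> D" "?g - f \<in> D" using F f D_closed by auto
      have "0 \<le> a (?g + (?g - f)) (?g + (?g - f))" by (rule a_nonneg[OF D_closed(1)[OF D]])
      moreover have "a f f = a ?g ?g - 2 * a ?g (?g - f) + a (?g - f) (?g - f)"
        using expand_diff[OF D] by simp
      ultimately have "a f f \<le> 2 * a ?g ?g + 2 * a (?g - f) (?g - f)"
        using expand_add[OF D] by linarith
      then show ?thesis using small[of n] by (simp add: inverse_eq_divide)
    qed
    then show "\<exists>M. \<forall>n\<ge>M. a f f \<le> 2 * a (F (r n) - f) (F (r n) - f) + 2 * inverse (real (Suc n))"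
      by blast
  qed
  ultimately show False using pos[OF f(1)] by force
qed

lemma representation: "\<exists>f\<in>D. \<forall>g\<in>D. a f g = inner \<Phi> g"
proof -
  obtain m where m: "m > 0" "\<And>f. f \<in> D \<Longrightarrow> m * (norm f)\<^sup>2 \<le> a f f" using coercive by blast
  define J where "J = (\<lambda>f. a f f - 2 * inner \<Phi> f)"
  have J_low: "J f \<ge> - (norm \<Phi>)\<^sup>2 / m" if "f \<in> D" for f
  proof -
    \<comment> \<open>Completing the square weighs the linear term against the coercive quadratic
      one.\<close>
    have "0 \<le> (m * norm f - norm \<Phi>)\<^sup>2" by simp
    then have "2 * (norm \<Phi> * norm f) \<le> m * (norm f)\<^sup>2 + (norm \<Phi>)\<^sup>2 / m"
      using m(1) by (simp add: power2_eq_square field_simps)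
    then show ?thesis using m(2)[OF that] norm_cauchy_schwarz[of \<Phi> f] by (simp add: J_def)
  qed
  define I where "I = Inf (J ` D)"
  have bb: "bdd_below (J ` D)" using J_low by (auto intro!: bdd_belowI2)
  have I_le: "I \<le> J f" if "f \<in> D" for f unfolding I_def using that bb by (intro cInf_lower) auto
  have ne: "D \<noteq> {}" using sub subspace_0 by blast
  have "\<exists>f\<in>D. J f < I + 1 / real (Suc n)" for n
    using cInf_lessD[of "J ` D" "I + 1 / real (Suc n)"] ne by (auto simp: I_def)
  then obtain F where F: "\<And>n. F n \<in> D" "\<And>n. J (F n) < I + 1 / real (Suc n)" by metis
  \<comment> \<open>The midpoint cannot fall below the infimum, so the parallelogram law makes the
    minimising sequence Cauchy with respect to the form.\<close>
  have near: "a (F i - F j) (F i - F j) \<le> 2 / real (Suc i) + 2 / real (Suc j)" for i j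
  proof -
    let ?h = "(1/2) *\<^sub>R (F i + F j)"
    have hD: "?h \<in> D" using F by (simp add: D_closed)
    have "a ?h ?h = (1/4) * a (F i + F j) (F i + F j)"
      using F sym[of "F i + F j" ?h] by (simp add: scale D_closed)
    then have "4 * J ?h = a (F i + F j) (F i + F j) - 4 * inner \<Phi> (F i) - 4 * inner \<Phi> (F j)"
      by (simp add: J_def inner_add_right add_divide_distrib)
    then have "a (F i - F j) (F i - F j) = 2 * J (F i) + 2 * J (F j) - 4 * J ?h"
      using F by (simp add: expand_add expand_diff J_def)
    then show ?thesis using F(2)[of i] F(2)[of j] I_le[OF hD] by simp
  qed
  have "\<exists>f\<in>D. (\<lambda>n. N (F n - f)) \<longlonglongrightarrow> 0"
  proof (rule complete)
    fix e :: real assume e: "e > 0"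
    \<comment> \<open>Coercivity absorbs the lower-order term of \<open>Garding\<close>, so that the
      form alone controls \<open>N\<close>.\<close>
    define K where "K = (1 + C / m) / c"
    have K: "K > 0" using m(1) c_pos C_nonneg by (simp add: K_def add_pos_nonneg)
    have NK: "N f \<le> K * a f f" if "f \<in> D" for f
    proof -
      have "C * (norm f)\<^sup>2 \<le> C * (a f f / m)"
        using m(2)[OF that] m(1) C_nonneg by (intro mult_left_mono) (auto simp: field_simps)
      then have "c * N f \<le> (1 + C / m) * a f f" using Garding[OF that] by (simp add: algebra_simps)
      then show ?thesis using c_pos by (simp add: K_def field_simps)
    qed
    obtain M :: nat where M: "1 / real (Suc M) < e / (4 * K)"
      using e K by (meson nat_approx_posE divide_pos_pos mult_pos_pos zero_less_numeral)
    have "N (F i - F j) < e" if "i \<ge> M" "j \<ge> M" for i j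
    proof -
      have s: "1 / real (Suc k) < e / (4 * K)" if "k \<ge> M" for k
      proof -
        have "1 / real (Suc k) \<le> 1 / real (Suc M)" using that by (intro divide_left_mono) auto
        with M show ?thesis by linarith
      qed
      have "a (F i - F j) (F i - F j) < 4 * (e / (4 * K))"
        using near[of i j] s[of i] s[of j] that by simp
      then have "K * a (F i - F j) (F i - F j) < e" using K by (simp add: field_simps)
      then show ?thesis using NK[of "F i - F j"] F D_closed by force
    qed
    then show "\<exists>M. \<forall>i\<ge>M. \<forall>j\<ge>M. N (F i - F j) < e" by blast
  qed (rule F)
  then obtain f where f: "f \<in> D" "(\<lambda>n. N (F n - f)) \<longlonglongrightarrow> 0" by blast
  have "a f g = inner \<Phi> g" if g: "g \<in> D" for g
  proof -
    have lim: "(\<lambda>n. a (F n) g) \<longlonglongrightarrow> a f g"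
    proof -
      have *: "(\<lambda>n. a (F n - f) (F n - f) * a g g) \<longlonglongrightarrow> 0"
        using tendsto_a_diff(1)[OF F(1) f] by (auto intro!: tendsto_eq_intros)
      have "(\<lambda>n. (a (F n - f) g)\<^sup>2) \<longlonglongrightarrow> 0"
        by (rule real_tendsto_sandwich[OF _ _ tendsto_const *])
          (auto intro!: always_eventually Cauchy_Schwarz D_closed F f g)
      from tendsto_real_sqrt[OF this] have "(\<lambda>n. a (F n - f) g) \<longlonglongrightarrow> 0"
        by (simp add: tendsto_rabs_zero_iff)
      moreover have "a (F n - f) g = a (F n) g - a f g" for n
        using add[of "F n - f" f g] F f g D_closed by simp
      ultimately show ?thesis by (simp add: LIM_zero_iff)
    qed
    \<comment> \<open>\<open>F n\<close> is compared with its variation along \<open>g\<close>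
      before passing to the limit, so the convergence of a(F n, g) suffices and continuity of the
      functional is not invoked.\<close>
    have quad: "0 \<le> 2 * t * (a f g - inner \<Phi> g) + t\<^sup>2 * a g g" for t
    proof (rule LIMSEQ_le_const)
      have "(\<lambda>n. 2 * t * (a (F n) g - inner \<Phi> g) + t\<^sup>2 * a g g + inverse (real (Suc n)))
          \<longlonglongrightarrow> 2 * t * (a f g - inner \<Phi> g) + t\<^sup>2 * a g g + 0"
        by (intro tendsto_intros lim LIMSEQ_inverse_real_of_nat)
      then show "(\<lambda>n. 2 * t * (a (F n) g - inner \<Phi> g) + t\<^sup>2 * a g g + inverse (real (Suc n)))
          \<longlonglongrightarrow> 2 * t * (a f g - inner \<Phi> g) + t\<^sup>2 * a g g" by simp
      have "0 \<le> 2 * t * (a (F n) g - inner \<Phi> g) + t\<^sup>2 * a g g + inverse (real (Suc n))" for n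
      proof -
        have "I \<le> J (F n + t *\<^sub>R g)" using F g by (intro I_le) (simp add: D_closed)
        also have "\<dots> = J (F n) + 2 * t * (a (F n) g - inner \<Phi> g) + t\<^sup>2 * a g g"
          unfolding J_def using F g by (subst expand_square) (auto simp: inner_add_right algebra_simps)
        finally show ?thesis using F(2)[of n] by (simp add: inverse_eq_divide)
      qed
      then show "\<exists>M. \<forall>n\<ge>M. 0 \<le> 2 * t * (a (F n) g - inner \<Phi> g) + t\<^sup>2 * a g g + inverse (real (Suc n))"
        by blast
    qed
    show ?thesis
    proof (rule ccontr)
      assume "a f g \<noteq> inner \<Phi> g"
      define d where "d = a f g - inner \<Phi> g"
      have d: "d \<noteq> 0" using \<open>a f g \<noteq> inner \<Phi> g\<close> by (simp add: d_def)
      have A: "a g g \<ge> 0" using g by (rule a_nonneg)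
      \<comment> \<open>Minus d / a(g, g) would minimise the quadratic; the summand 1 keeps the
        denominator positive and the value still comes out negative.\<close>
      define t where "t = - d / (a g g + 1)"
      have "2 * t * d + t\<^sup>2 * a g g = - (d\<^sup>2 * (a g g + 2)) / (a g g + 1)\<^sup>2"
        using A by (simp add: t_def field_simps power2_eq_square add_nonneg_eq_0_iff)
      also have "\<dots> < 0" using A d by (simp add: divide_neg_pos)
      finally show False using quad[of t] by (simp add: d_def)
    qed
  qed
  with f(1) show ?thesis by blast
qed

end

section \<open>The form domain of a trapping potential\<close>

text \<open>The truncations of \<open>V\<close> to balls are integrable and hence measurable, and
  \<open>V\<close> is their pointwise limit.\<close>

lemma locally_integrable_measurable:
  fixes V :: "'a :: euclidean_space \<Rightarrow> real"
  assumes "locally_integrable V"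
  shows "V \<in> borel_measurable lebesgue"
proof (rule borel_measurable_LIMSEQ_metric)
  show "(\<lambda>x. indicator (cball 0 (real n)) x *\<^sub>R V x) \<in> borel_measurable lebesgue" for n
    using assms[unfolded locally_integrable_def set_integrable_def, rule_format, of "cball 0 (real n)"] by auto
  fix x :: 'a
  obtain N :: nat where "norm x \<le> real N" using real_arch_simple by blast
  then have "\<forall>\<^sub>F n in sequentially. indicator (cball 0 (real n)) x *\<^sub>R V x = V x"
    by (auto simp: eventually_sequentially intro!: exI[of _ N])
  then show "(\<lambda>n. indicator (cball 0 (real n)) x *\<^sub>R V x) \<longlonglongrightarrow> V x" by (rule tendsto_eventually)
qed

lemma L2_inner_scaleC_right: "L2_inner f (c *\<^sub>C g) = cnj c * L2_inner f g"
  using L2_inner_commute[of f "c *\<^sub>C g"] L2_inner_commute[of f g] by (simp add: L2_inner_scaleC_left)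

lemma norm_prod_sq: "(norm p)\<^sup>2 = (norm (fst p))\<^sup>2 + (norm (snd p))\<^sup>2"
  by (simp add: norm_prod_def)

lemma scaleR_eq_scaleC_prod: "r *\<^sub>R p = of_real r *\<^sub>C (p :: 'a :: euclidean_space L2 \<times> 'a L2)"
  by (simp add: prod_eq_iff scaleC_prod_def scaleR_L2_def)

lemma norm_Cauchy_from_sq:
  fixes F :: "nat \<Rightarrow> 'b :: real_normed_vector"
  assumes "\<And>e. e > 0 \<Longrightarrow> \<exists>M. \<forall>m\<ge>M. \<forall>n\<ge>M. (norm (F m - F n))\<^sup>2 < e"
  shows "Cauchy F"
proof (rule CauchyI)
  fix e :: real assume e: "e > 0"
  then obtain M where M: "\<And>m n. m \<ge> M \<Longrightarrow> n \<ge> M \<Longrightarrow> (norm (F m - F n))\<^sup>2 < e\<^sup>2"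
    using assms[of "e\<^sup>2"] by auto
  then have "norm (F m - F n) < e" if "m \<ge> M" "n \<ge> M" for m n
    using that e by (intro power2_less_imp_less[OF M]) auto
  then show "\<exists>M. \<forall>m\<ge>M. \<forall>n\<ge>M. norm (F m - F n) < e" by blast
qed

locale trapping_potential =
  fixes V :: "'a :: euclidean_space \<Rightarrow> real"
  assumes dim: "DIM('a) \<le> 3"
    and V_nonneg: "\<And>x. V x \<ge> 0"
    and V_meas: "V \<in> borel_measurable lebesgue"
    and V_infty: "filterlim V at_top at_infinity"
begin

text \<open>Multiplication by the square root turns the potential energy into a squared L2 norm, so
  that sums, multiples and limits in the form domain are handled by the results on square integrable
  functions.\<close>

definition weighted :: "'a L2 \<Rightarrow> 'a \<Rightarrow> complex" where
  "weighted f x = of_real (sqrt (V x)) * rep_L2 f x"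

lemma weighted_measurable [measurable]: "weighted f \<in> borel_measurable lebesgue"
  unfolding weighted_def[abs_def] using V_meas by measurable

lemma cmod_weighted: "(cmod (weighted f x))\<^sup>2 = V x * (cmod (rep_L2 f x))\<^sup>2"
  using V_nonneg[of x] by (simp add: weighted_def norm_mult power_mult_distrib)

lemma X1_iff: "f \<in> X1 V \<longleftrightarrow> f \<in> H1 \<and> sq_integrable (weighted f)"
  by (simp add: X1_def sq_integrable_def cmod_weighted)

lemma X1_H1: "f \<in> X1 V \<Longrightarrow> f \<in> H1" by (simp add: X1_def)

lemma weighted_add: "AE x in lebesgue. weighted (f + g) x = weighted f x + weighted g x"
  using rep_plus[of f g] by eventually_elim (simp add: weighted_def algebra_simps)

lemma weighted_scaleC: "AE x in lebesgue. weighted (c *\<^sub>C f) x = c * weighted f x"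
  using rep_scaleC[of c f] by eventually_elim (simp add: weighted_def algebra_simps)

lemma X1_add: "f \<in> X1 V \<Longrightarrow> g \<in> X1 V \<Longrightarrow> f + g \<in> X1 V"
proof -
  assume "f \<in> X1 V" "g \<in> X1 V"
  then have fg: "f \<in> H1" "g \<in> H1" "sq_integrable (weighted f)" "sq_integrable (weighted g)"
    by (simp_all add: X1_iff)
  have "sq_integrable (weighted (f + g))"
    by (rule sq_integrable_bound[OF sq_integrable_add[OF fg(3,4)] weighted_measurable])
      (use weighted_add[of f g] in eventually_elim, simp)
  then show ?thesis using fg by (simp add: X1_iff H1_add)
qed

lemma X1_scaleC: "f \<in> X1 V \<Longrightarrow> c *\<^sub>C f \<in> X1 V"
proof -
  assume "f \<in> X1 V"
  then have f: "f \<in> H1" "sq_integrable (weighted f)" by (simp_all add: X1_iff)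
  have "sq_integrable (weighted (c *\<^sub>C f))"
    by (rule sq_integrable_bound[OF sq_integrable_mult[OF f(2), of c] weighted_measurable])
      (use weighted_scaleC[of c f] in eventually_elim, simp)
  then show ?thesis using f by (simp add: X1_iff H1_scaleC)
qed

lemma X1_diff: "f \<in> X1 V \<Longrightarrow> g \<in> X1 V \<Longrightarrow> f - g \<in> X1 V"
  using X1_add[of f "(-1) *\<^sub>C g"] X1_scaleC[of g "-1"] by (simp add: scaleC_minus_one)

lemma X1_zero: "0 \<in> X1 V"
proof -
  have "sq_integrable (weighted 0)"
    by (rule sq_integrable_bound[OF sq_integrable_zero weighted_measurable])
      (use rep_zero in eventually_elim, simp add: weighted_def)
  then show ?thesis by (simp add: X1_iff H1_zero)
qed

definition form_norm :: "'a L2 \<Rightarrow> real" where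
  "form_norm f = (norm f)\<^sup>2 + grad_sq_norm f + (LINT x|lebesgue. (cmod (weighted f x))\<^sup>2)"

lemma weighted_sq_nonneg: "(LINT x|lebesgue. (cmod (weighted f x))\<^sup>2) \<ge> 0"
  by (simp add: integral_nonneg_AE)

lemma form_norm_bounds:
  "(norm f)\<^sup>2 \<le> form_norm f" "grad_sq_norm f \<le> form_norm f"
  "(LINT x|lebesgue. (cmod (weighted f x))\<^sup>2) \<le> form_norm f" "0 \<le> form_norm f"
  using weighted_sq_nonneg[of f] grad_norm_sq_nonneg[of "\<lambda>b. weak_deriv b f"] by (auto simp: form_norm_def)

text \<open>The functions and their derivatives converge in L2, and weak differentiation is closed.
  Multiplication by the square root of \<open>V\<close> is unbounded, so the potential part is
  instead carried to the limit by Fatou's lemma along an almost everywhere convergent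
  subsequence.\<close>

lemma X1_complete:
  fixes F :: "nat \<Rightarrow> 'a L2"
  assumes F: "\<And>n. F n \<in> X1 V"
    and C: "\<And>e. e > 0 \<Longrightarrow> \<exists>M. \<forall>m\<ge>M. \<forall>n\<ge>M. form_norm (F m - F n) < e"
  shows "\<exists>f\<in>X1 V. (\<lambda>n. form_norm (F n - f)) \<longlonglongrightarrow> 0"
proof -
  have FH: "F n \<in> H1" for n using F by (rule X1_H1)
  have "Cauchy F"
    by (rule norm_Cauchy_from_sq) (meson C form_norm_bounds(1) le_less_trans)
  then obtain f where f: "F \<longlonglongrightarrow> f" using Cauchy_convergent_iff convergent_def by blast
  have "\<exists>g. (\<lambda>n. weak_deriv b (F n)) \<longlonglongrightarrow> g" if b: "b \<in> Basis" for b
  proof -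
    have le: "(norm (weak_deriv b (F m) - weak_deriv b (F n)))\<^sup>2 \<le> form_norm (F m - F n)" for m n
    proof -
      have "(norm (weak_deriv b (F m - F n)))\<^sup>2 \<le> grad_sq_norm (F m - F n)"
        unfolding grad_norm_sq_def using b by (intro member_le_sum) auto
      also have "\<dots> \<le> form_norm (F m - F n)" by (rule form_norm_bounds)
      finally show ?thesis by (simp add: weak_deriv_diff[OF b FH FH])
    qed
    have "Cauchy (\<lambda>n. weak_deriv b (F n))"
      by (rule norm_Cauchy_from_sq) (meson C le le_less_trans)
    then show ?thesis using Cauchy_convergent_iff convergent_def by blast
  qed
  then obtain g where g: "\<And>b. b \<in> Basis \<Longrightarrow> (\<lambda>n. weak_deriv b (F n)) \<longlonglongrightarrow> g b" by metis
  have wd: "is_weak_deriv b f (g b)" if "b \<in> Basis" for b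
    by (rule is_weak_deriv_limit[OF that weak_deriv[OF FH that] f g[OF that]])
  then have fH: "f \<in> H1" by (auto simp: H1_def)
  have gb: "weak_deriv b f = g b" if "b \<in> Basis" for b by (rule weak_deriv_eq[OF that wd[OF that]])
  obtain r where r: "strict_mono (r :: nat \<Rightarrow> nat)"
    "AE x in lebesgue. (\<lambda>n. rep_L2 (F (r n)) x) \<longlonglongrightarrow> rep_L2 f x"
    using L2_tendsto_AE_subseq[OF f] .
  have V_part: "sq_integrable (weighted (f - F n)) \<and> (LINT x|lebesgue. (cmod (weighted (f - F n) x))\<^sup>2) \<le> e"
    if M: "\<And>m n. m \<ge> M \<Longrightarrow> n \<ge> M \<Longrightarrow> form_norm (F m - F n) < e" and n: "n \<ge> M" for n M e
  proof -
    have "AE x in lebesgue. \<forall>m. rep_L2 (F (r (m + M)) - F n) x = rep_L2 (F (r (m + M))) x - rep_L2 (F n) x"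
      by (subst AE_all_countable) (auto intro: rep_minus)
    with r(2) rep_minus[of f "F n"]
    have "AE x in lebesgue. (\<lambda>m. weighted (F (r (m + M)) - F n) x) \<longlonglongrightarrow> weighted (f - F n) x"
    proof eventually_elim
      case (elim x)
      have "(\<lambda>m. rep_L2 (F (r (m + M))) x) \<longlonglongrightarrow> rep_L2 f x"
        using elim(1) by (rule LIMSEQ_ignore_initial_segment)
      then show ?case unfolding weighted_def using elim(2,3) by (auto intro!: tendsto_intros)
    qed
    moreover have "sq_integrable (weighted (F (r (m + M)) - F n))" for m
      using X1_diff[OF F F] by (simp add: X1_iff)
    moreover have "(LINT x|lebesgue. (cmod (weighted (F (r (m + M)) - F n) x))\<^sup>2) \<le> e" for m
    proof -
      have "r (m + M) \<ge> M" using seq_suble[OF r(1), of "m + M"] by linarith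
      then show ?thesis using form_norm_bounds(3)[of "F (r (m + M)) - F n"] M[OF _ n, of "r (m + M)"] by linarith
    qed
    ultimately show ?thesis
      using L2_bound_by_Fatou[OF weighted_measurable, of "\<lambda>m. weighted (F (r (m + M)) - F n)" "f - F n" e] by blast
  qed
  have fX: "f \<in> X1 V"
  proof -
    obtain M where M: "\<And>m n. m \<ge> M \<Longrightarrow> n \<ge> M \<Longrightarrow> form_norm (F m - F n) < 1" using C[of 1] by auto
    have "f - F M \<in> X1 V" using V_part[OF M order_refl] H1_add[OF fH H1_scaleC[OF FH, of "-1" M]]
      by (simp add: X1_iff scaleC_minus_one)
    from X1_add[OF this F[of M]] show ?thesis by simp
  qed
  have "(\<lambda>n. LINT x|lebesgue. (cmod (weighted (F n - f) x))\<^sup>2) \<longlonglongrightarrow> 0"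
  proof (rule LIMSEQ_I)
    fix e :: real assume e: "e > 0"
    then obtain M where M: "\<And>m n. m \<ge> M \<Longrightarrow> n \<ge> M \<Longrightarrow> form_norm (F m - F n) < e / 2"
      using C[of "e / 2"] by auto
    have "norm ((LINT x|lebesgue. (cmod (weighted (F n - f) x))\<^sup>2) - 0) < e" if "n \<ge> M" for n
    proof -
      have "(LINT x|lebesgue. (cmod (weighted (F n - f) x))\<^sup>2) = (LINT x|lebesgue. (cmod (weighted (f - F n) x))\<^sup>2)"
      proof (rule integral_cong_AE)
        show "AE x in lebesgue. (cmod (weighted (F n - f) x))\<^sup>2 = (cmod (weighted (f - F n) x))\<^sup>2"
          using rep_minus[of f "F n"] rep_minus[of "F n" f]
          by eventually_elim (simp add: cmod_weighted norm_minus_commute)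
      qed measurable
      then show ?thesis using V_part[OF M that] weighted_sq_nonneg[of "f - F n"] e by simp
    qed
    then show "\<exists>M. \<forall>n\<ge>M. norm ((LINT x|lebesgue. (cmod (weighted (F n - f) x))\<^sup>2) - 0) < e" by blast
  qed
  moreover have "(\<lambda>n. grad_sq_norm (F n - f)) \<longlonglongrightarrow> 0"
  proof -
    have "(\<lambda>n. \<Sum>b\<in>Basis. (norm (weak_deriv b (F n) - g b))\<^sup>2) \<longlonglongrightarrow> (\<Sum>b\<in>(Basis :: 'a set). 0)"
      using g by (intro tendsto_sum) (auto intro!: tendsto_eq_intros tendsto_norm_zero simp: LIM_zero_iff)
    then show ?thesis
      unfolding grad_norm_sq_def by (simp add: weak_deriv_diff[OF _ FH fH] gb)
  qed
  moreover have "(\<lambda>n. (norm (F n - f))\<^sup>2) \<longlonglongrightarrow> 0"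
    using f by (auto intro!: tendsto_eq_intros tendsto_norm_zero simp: LIM_zero_iff)
  ultimately have "(\<lambda>n. form_norm (F n - f)) \<longlonglongrightarrow> 0 + 0 + 0"
    unfolding form_norm_def by (intro tendsto_add)
  with fX show ?thesis by auto
qed

lemma X1_compact:
  assumes F: "\<And>n. F n \<in> X1 V" and B: "\<And>n. form_norm (F n) \<le> B"
  shows "\<exists>r. strict_mono (r :: nat \<Rightarrow> nat) \<and> Cauchy (\<lambda>n. F (r n))"
proof (rule compact_embedding[OF V_nonneg V_infty])
  show "weak_grad (F n) (\<lambda>b. weak_deriv b (F n))" for n by (intro weak_grad_H1 X1_H1 F)
  show "(norm (F n))\<^sup>2 \<le> B" "grad_sq_norm (F n) \<le> B" for n
    using form_norm_bounds[of "F n"] B[of n] by linarith+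
  show "integrable lebesgue (\<lambda>x. V x * (cmod (rep_L2 (F n) x))\<^sup>2)" for n
    using F[of n] by (simp add: X1_def)
  show "(LINT x|lebesgue. V x * (cmod (rep_L2 (F n) x))\<^sup>2) \<le> B" for n
    using form_norm_bounds(3)[of "F n"] B[of n] by (simp add: cmod_weighted)
qed

lemma mult_integrable_V:
  assumes "f \<in> X1 V" "g \<in> X1 V"
  shows "mult_integrable (\<lambda>x. of_real (V x)) f g"
proof -
  have "integrable lebesgue (\<lambda>x. weighted f x * cnj (weighted g x))"
    using assms by (intro sq_integrable_mult_integrable sq_integrable_cnj) (auto simp: X1_iff)
  moreover have "weighted f x * cnj (weighted g x) = of_real (V x) * rep_L2 f x * cnj (rep_L2 g x)" for x
  proof -
    have "complex_of_real (sqrt (V x)) * complex_of_real (sqrt (V x)) = of_real (V x)"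
      using V_nonneg[of x] by (simp flip: of_real_mult)
    then show ?thesis by (simp add: weighted_def algebra_simps)
  qed
  ultimately show ?thesis by (simp add: mult_integrable_def)
qed

text \<open>Contains \<open>V\<close> besides the gradient: together they are the part of the form
  comparable to the form norm, and the remaining terms are treated as a perturbation.\<close>

definition kinetic :: "'a L2 \<Rightarrow> 'a L2 \<Rightarrow> complex" where
  "kinetic f g = 1/2 * (\<Sum>b\<in>Basis. L2_inner (weak_deriv b f) (weak_deriv b g)) + mult_form (\<lambda>x. of_real (V x)) f g"

lemma V_meas_complex: "(\<lambda>x. complex_of_real (V x)) \<in> borel_measurable lebesgue"
  using V_meas by measurable

lemma kinetic_add_left:
  assumes "f \<in> X1 V" "g \<in> X1 V" "h \<in> X1 V"
  shows "kinetic (f + g) h = kinetic f h + kinetic g h"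
  using assms unfolding kinetic_def
  by (simp add: weak_deriv_add X1_H1 L2_inner_add_left sum.distrib
      mult_form_add_left[OF V_meas_complex mult_integrable_V mult_integrable_V] algebra_simps)

lemma kinetic_scaleC_left:
  assumes "f \<in> X1 V"
  shows "kinetic (c *\<^sub>C f) h = c * kinetic f h"
  using assms unfolding kinetic_def
  by (simp add: weak_deriv_scaleC X1_H1 L2_inner_scaleC_left sum_distrib_left
      mult_form_scaleC_left[OF V_meas_complex] algebra_simps)

lemma kinetic_self: "kinetic f f = of_real (1/2 * grad_sq_norm f + (LINT x|lebesgue. (cmod (weighted f x))\<^sup>2))"
proof -
  have "(\<Sum>b\<in>Basis. L2_inner (weak_deriv b f) (weak_deriv b f)) = of_real (grad_sq_norm f)"
    by (simp add: grad_norm_sq_def L2_inner_self norm_L2_sq del: of_real_power)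
  moreover have "mult_form (\<lambda>x. of_real (V x)) f f = of_real (LINT x|lebesgue. (cmod (weighted f x))\<^sup>2)"
  proof -
    have "of_real (V x) * rep_L2 f x * cnj (rep_L2 f x) = complex_of_real ((cmod (weighted f x))\<^sup>2)" for x
      unfolding cmod_weighted of_real_mult using complex_norm_square[of "rep_L2 f x"] by (simp add: mult.assoc)
    then show ?thesis unfolding mult_form_def by (simp del: of_real_power)
  qed
  ultimately show ?thesis by (simp add: kinetic_def)
qed

lemma admissible_integrable:
  "admissible P \<Longrightarrow> f \<in> H1 \<Longrightarrow> g \<in> H1 \<Longrightarrow> mult_integrable P f (g :: 'a L2)"
  using admissible_mult_form[OF dim, of P 1] by auto

lemma schroedinger_form_split:
  assumes "admissible Q" "f \<in> X1 V" "g \<in> X1 V"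
  shows "schroedinger_form (\<lambda>x. of_real (V x) + Q x) f g = kinetic f g + mult_form Q f g"
  unfolding schroedinger_form_def kinetic_def
  using mult_form_add_potential[OF mult_integrable_V[OF assms(2,3)] admissible_integrable[OF assms(1)]] assms
  by (simp add: X1_H1)

section \<open>Forms on the two-component space\<close>

lemma X_add: "f \<in> X V \<Longrightarrow> g \<in> X V \<Longrightarrow> f + g \<in> X V"
  and X_scaleC: "f \<in> X V \<Longrightarrow> c *\<^sub>C f \<in> X V"
  and X_zero: "0 \<in> X V"
  by (auto simp: X_def mem_Times_iff X1_add X1_scaleC X1_zero scaleC_prod_def)

lemma subspace_X: "subspace (X V)"
  unfolding subspace_def using X_add X_scaleC X_zero by (auto simp: scaleR_eq_scaleC_prod)

definition X_norm :: "'a L2 \<times> 'a L2 \<Rightarrow> real" where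
  "X_norm f = form_norm (fst f) + form_norm (snd f)"

definition X_grad :: "'a L2 \<times> 'a L2 \<Rightarrow> real" where
  "X_grad f = grad_sq_norm (fst f) + grad_sq_norm (snd f)"

text \<open>Forms with relative bound 0 with respect to the gradient. Linearity is recorded in the
  first argument; the behaviour in the second comes from the hermiticity of the complete
  form.\<close>

definition perturbation :: "('a L2 \<times> 'a L2 \<Rightarrow> 'a L2 \<times> 'a L2 \<Rightarrow> complex) \<Rightarrow> bool" where
  "perturbation p \<longleftrightarrow>
    (\<forall>f\<in>X V. \<forall>g\<in>X V. \<forall>h\<in>X V. p (f + g) h = p f h + p g h) \<and>
    (\<forall>c. \<forall>f\<in>X V. \<forall>h\<in>X V. p (c *\<^sub>C f) h = c * p f h) \<and>
    (\<forall>e>0. \<exists>M\<ge>0. \<forall>f\<in>X V. cmod (p f f) \<le> M * (norm f)\<^sup>2 + e * X_grad f)"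

lemma perturbation_add:
  assumes p: "perturbation p" and q: "perturbation q"
  shows "perturbation (\<lambda>f g. p f g + q f g)"
  unfolding perturbation_def
proof (intro conjI allI impI)
  show "\<forall>f\<in>X V. \<forall>g\<in>X V. \<forall>h\<in>X V. p (f + g) h + q (f + g) h = p f h + q f h + (p g h + q g h)"
    using p q by (simp add: perturbation_def)
  show "\<forall>f\<in>X V. \<forall>h\<in>X V. p (c *\<^sub>C f) h + q (c *\<^sub>C f) h = c * (p f h + q f h)" for c
    using p q by (simp add: perturbation_def distrib_left)
  fix e :: real assume e: "e > 0"
  then have e2: "e / 2 > 0" by simp
  obtain M where M: "M \<ge> 0" "\<And>f. f \<in> X V \<Longrightarrow> cmod (p f f) \<le> M * (norm f)\<^sup>2 + e / 2 * X_grad f"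
    using p e2 unfolding perturbation_def by blast
  obtain M' where M': "M' \<ge> 0" "\<And>f. f \<in> X V \<Longrightarrow> cmod (q f f) \<le> M' * (norm f)\<^sup>2 + e / 2 * X_grad f"
    using q e2 unfolding perturbation_def by blast
  have "cmod (p f f + q f f) \<le> (M + M') * (norm f)\<^sup>2 + e * X_grad f" if "f \<in> X V" for f
    using norm_triangle_ineq[of "p f f" "q f f"] M(2)[OF that] M'(2)[OF that] by (simp add: distrib_right)
  then show "\<exists>M\<ge>0. \<forall>f\<in>X V. cmod (p f f + q f f) \<le> M * (norm f)\<^sup>2 + e * X_grad f"
    using M(1) M'(1) by (intro exI[of _ "M + M'"]) auto
qed

text \<open>The projections \<open>i\<close> and \<open>j\<close> select components, so that one
  proof serves the diagonal and the off-diagonal entries of the matrix of potentials.\<close>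

lemma perturbation_mult_form:
  assumes P: "admissible P" and i: "i = fst \<or> i = snd" and j: "j = fst \<or> j = snd"
  shows "perturbation (\<lambda>f g. mult_form P (i f) (j g))"
  unfolding perturbation_def
proof (intro conjI allI impI)
  note Pm = admissible_measurable[OF P]
  have H: "i f \<in> H1" "j f \<in> H1" if "f \<in> X V" for f
    using that i j X1_H1 by (auto simp: X_def)
  have lin: "i (f + g) = i f + i g" "i (c *\<^sub>C f) = c *\<^sub>C i f" for f g c
    using i by (auto simp: scaleC_prod_def)
  show "\<forall>f\<in>X V. \<forall>g\<in>X V. \<forall>h\<in>X V. mult_form P (i (f + g)) (j h) = mult_form P (i f) (j h) + mult_form P (i g) (j h)"
    using mult_form_add_left[OF Pm] admissible_integrable[OF P] H by (simp add: lin)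
  show "\<forall>f\<in>X V. \<forall>h\<in>X V. mult_form P (i (c *\<^sub>C f)) (j h) = c * mult_form P (i f) (j h)" for c
    by (simp add: lin mult_form_scaleC_left[OF Pm])
  fix e :: real assume "e > 0"
  then have e2: "e / 2 > 0" by simp
  obtain M where M: "M \<ge> 0" "\<And>f g :: 'a L2. f \<in> H1 \<Longrightarrow> g \<in> H1 \<Longrightarrow>
      cmod (mult_form P f g) \<le> M * ((norm f)\<^sup>2 + (norm g)\<^sup>2) + e / 2 * (grad_sq_norm f + grad_sq_norm g)"
    using admissible_mult_form[OF dim P e2] by blast
  have "cmod (mult_form P (i f) (j f)) \<le> (2 * M) * (norm f)\<^sup>2 + e * X_grad f" if f: "f \<in> X V" for f
  proof -
    have n: "(norm (k f))\<^sup>2 \<le> (norm f)\<^sup>2" "grad_sq_norm (k f) \<le> X_grad f" if "k = fst \<or> k = snd" for k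
      using that grad_norm_sq_nonneg[of "\<lambda>b. weak_deriv b (fst f)"] grad_norm_sq_nonneg[of "\<lambda>b. weak_deriv b (snd f)"]
      by (auto simp: norm_prod_sq X_grad_def)
    have "cmod (mult_form P (i f) (j f)) \<le> M * ((norm (i f))\<^sup>2 + (norm (j f))\<^sup>2) + e / 2 * (grad_sq_norm (i f) + grad_sq_norm (j f))"
      using M(2) H[OF f] by blast
    also have "\<dots> \<le> M * ((norm f)\<^sup>2 + (norm f)\<^sup>2) + e / 2 * (X_grad f + X_grad f)"
      using e2 M(1) n[OF i] n[OF j] by (intro add_mono mult_left_mono) auto
    finally show ?thesis by simp
  qed
  then show "\<exists>M\<ge>0. \<forall>f\<in>X V. cmod (mult_form P (i f) (j f)) \<le> M * (norm f)\<^sup>2 + e * X_grad f"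
    using M(1) by (intro exI[of _ "2 * M"]) auto
qed

definition kinetic2 :: "'a L2 \<times> 'a L2 \<Rightarrow> 'a L2 \<times> 'a L2 \<Rightarrow> complex" where
  "kinetic2 f g = kinetic (fst f) (fst g) + kinetic (snd f) (snd g)"

definition hermitian_on_X :: "('a L2 \<times> 'a L2 \<Rightarrow> 'a L2 \<times> 'a L2 \<Rightarrow> complex) \<Rightarrow> bool" where
  "hermitian_on_X a \<longleftrightarrow> (\<forall>f\<in>X V. \<forall>g\<in>X V. a g f = cnj (a f g))"

lemma hermitian_on_XD: "hermitian_on_X a \<Longrightarrow> f \<in> X V \<Longrightarrow> g \<in> X V \<Longrightarrow> a g f = cnj (a f g)"
  unfolding hermitian_on_X_def by blast

lemma perturbed_form_linear:
  assumes p: "perturbation p" and a: "\<forall>f\<in>X V. \<forall>g\<in>X V. a f g = kinetic2 f g + p f g"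
  shows "f \<in> X V \<Longrightarrow> g \<in> X V \<Longrightarrow> h \<in> X V \<Longrightarrow> a (f + g) h = a f h + a g h"
    and "f \<in> X V \<Longrightarrow> h \<in> X V \<Longrightarrow> a (c *\<^sub>C f) h = c * a f h"
proof -
  assume f: "f \<in> X V" and h: "h \<in> X V"
  have "kinetic2 (c *\<^sub>C f) h = c * kinetic2 f h"
    using f by (auto simp: kinetic2_def scaleC_prod_def kinetic_scaleC_left X_def algebra_simps)
  moreover have "p (c *\<^sub>C f) h = c * p f h" using p f h by (simp add: perturbation_def)
  ultimately show "a (c *\<^sub>C f) h = c * a f h"
    using f h by (simp add: a X_scaleC distrib_left)
  assume g: "g \<in> X V"
  have "kinetic2 (f + g) h = kinetic2 f h + kinetic2 g h"
    using f g h by (auto simp: kinetic2_def kinetic_add_left X_def)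
  moreover have "p (f + g) h = p f h + p g h" using p f g h by (simp add: perturbation_def)
  ultimately show "a (f + g) h = a f h + a g h"
    using f g h by (simp add: a X_add)
qed

theorem form_range:
  assumes p: "perturbation p" and a: "\<forall>f\<in>X V. \<forall>g\<in>X V. a f g = kinetic2 f g + p f g"
    and herm: "hermitian_on_X a" and pos: "positive_definite (X V) a"
  shows "\<exists>f\<in>X V. \<forall>g\<in>X V. a f g = L2_inner2 h g"
proof -
  note lin = perturbed_form_linear[OF p a]
  have sym: "Re (a f g) = Re (a g f)" if "f \<in> X V" "g \<in> X V" for f g
    using arg_cong[OF hermitian_on_XD[OF herm that], of Re] by simp
  have "\<forall>e>0. \<exists>M\<ge>0. \<forall>f\<in>X V. cmod (p f f) \<le> M * (norm f)\<^sup>2 + e * X_grad f"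
    using p unfolding perturbation_def by blast
  \<comment> \<open>The kinetic part has the coefficient 1/2 on the gradient. A perturbation of at
    most 1/4 leaves 1/4, the constant used in the Garding inequality below.\<close>
  from this[rule_format, of "1/4"]
  obtain M where M: "M \<ge> 0" "\<And>f. f \<in> X V \<Longrightarrow> cmod (p f f) \<le> M * (norm f)\<^sup>2 + 1/4 * X_grad f"
    by auto
  define W where "W = (\<lambda>f. (LINT x|lebesgue. (cmod (weighted (fst f) x))\<^sup>2) + (LINT x|lebesgue. (cmod (weighted (snd f) x))\<^sup>2))"
  have W0: "W f \<ge> 0" for f using weighted_sq_nonneg by (simp add: W_def)
  have G0: "X_grad f \<ge> 0" for f by (simp add: X_grad_def grad_norm_sq_nonneg)
  have Xn: "X_norm f = (norm f)\<^sup>2 + X_grad f + W f" for f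
    by (simp add: X_norm_def form_norm_def X_grad_def W_def norm_prod_sq)
  have Re_a: "Re (a f f) = 1/2 * X_grad f + W f + Re (p f f)" if "f \<in> X V" for f
    by (simp add: a[rule_format, OF that that] kinetic2_def kinetic_self X_grad_def W_def)
  have Re_p: "\<bar>Re (p f f)\<bar> \<le> M * (norm f)\<^sup>2 + 1/4 * X_grad f" if "f \<in> X V" for f
    using abs_Re_le_cmod[of "p f f"] M(2)[OF that] by linarith
  interpret compact_positive_form "X V" "\<lambda>f g. Re (a f g)" X_norm "1/4" "M + 1/4" "1 + M"
  proof
    show "subspace (X V)" by (rule subspace_X)
    show "Re (a (f + g) h) = Re (a f h) + Re (a g h)" if "f \<in> X V" "g \<in> X V" "h \<in> X V" for f g h
      using lin(1)[OF that] by simp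
    show "Re (a (c *\<^sub>R f) h) = c * Re (a f h)" if "f \<in> X V" "h \<in> X V" for c f h
      using lin(2)[OF that, of "of_real c"] by (simp add: scaleR_eq_scaleC_prod)
    show "Re (a f g) = Re (a g f)" if "f \<in> X V" "g \<in> X V" for f g by (rule sym[OF that])
    show "0 < Re (a f f)" if "f \<in> X V" "f \<noteq> 0" for f using pos that by (simp add: positive_definite_def)
    show "1/4 * X_norm f \<le> Re (a f f) + (M + 1/4) * (norm f)\<^sup>2" if "f \<in> X V" for f
      using Re_a[OF that] Re_p[OF that] W0[of f] unfolding Xn by (simp add: distrib_right)
    show "Re (a f f) \<le> (1 + M) * X_norm f" if "f \<in> X V" for f
    proof -
      have "M * (norm f)\<^sup>2 \<le> M * X_norm f" unfolding Xn using M(1) W0[of f] G0[of f] by (intro mult_left_mono) auto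
      moreover have "3/4 * X_grad f + W f \<le> X_norm f" unfolding Xn using G0[of f] by simp
      ultimately show ?thesis using Re_a[OF that] Re_p[OF that] by (simp add: distrib_right)
    qed
    show "(norm f)\<^sup>2 \<le> X_norm f" for f unfolding Xn using W0[of f] G0[of f] by simp
    show "\<exists>f\<in>X V. (\<lambda>n. X_norm (F n - f)) \<longlonglongrightarrow> 0"
      if F: "\<And>n::nat. F n \<in> X V" and C: "\<And>e. e > 0 \<Longrightarrow> \<exists>M. \<forall>m\<ge>M. \<forall>n\<ge>M. X_norm (F m - F n) < e" for F
    proof -
      have le: "form_norm (fst (F m) - fst (F n)) \<le> X_norm (F m - F n)"
        "form_norm (snd (F m) - snd (F n)) \<le> X_norm (F m - F n)" for m n
        using form_norm_bounds(4) by (simp_all add: X_norm_def)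
      have FX: "fst (F n) \<in> X1 V" "snd (F n) \<in> X1 V" for n using F[of n] by (auto simp: X_def)
      have C1: "\<exists>M. \<forall>m\<ge>M. \<forall>n\<ge>M. form_norm (fst (F m) - fst (F n)) < e" if "e > 0" for e
        using C[OF that] le(1) by (meson le_less_trans)
      have C2: "\<exists>M. \<forall>m\<ge>M. \<forall>n\<ge>M. form_norm (snd (F m) - snd (F n)) < e" if "e > 0" for e
        using C[OF that] le(2) by (meson le_less_trans)
      obtain f1 where f1: "f1 \<in> X1 V" "(\<lambda>n. form_norm (fst (F n) - f1)) \<longlonglongrightarrow> 0"
        using X1_complete[OF FX(1) C1] by blast
      obtain f2 where f2: "f2 \<in> X1 V" "(\<lambda>n. form_norm (snd (F n) - f2)) \<longlonglongrightarrow> 0"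
        using X1_complete[OF FX(2) C2] by blast
      have "(\<lambda>n. X_norm (F n - (f1, f2))) \<longlonglongrightarrow> 0 + 0"
        unfolding X_norm_def fst_diff snd_diff fst_conv snd_conv by (intro tendsto_add f1 f2)
      then show ?thesis using f1(1) f2(1) by (intro bexI[of _ "(f1, f2)"]) (auto simp: X_def)
    qed
    show "\<exists>r. strict_mono (r :: nat \<Rightarrow> nat) \<and> Cauchy (\<lambda>n. F (r n))"
      if F: "\<And>n::nat. F n \<in> X V \<and> X_norm (F n) \<le> B" for F B
    proof -
      have FX: "fst (F n) \<in> X1 V" "snd (F n) \<in> X1 V" for n using F[of n] by (auto simp: X_def)
      have FB: "form_norm (fst (F n)) \<le> B" "form_norm (snd (F n)) \<le> B" for n
        using F[of n] form_norm_bounds(4)[of "fst (F n)"] form_norm_bounds(4)[of "snd (F n)"] by (auto simp: X_norm_def)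
      obtain r where r: "strict_mono (r :: nat \<Rightarrow> nat)" "Cauchy (\<lambda>n. fst (F (r n)))"
        using X1_compact[of "\<lambda>n. fst (F n)", OF FX(1) FB(1)] by blast
      \<comment> \<open>Compactness is available for each component, so a second subsequence is
        extracted from the first.\<close>
      obtain s where s: "strict_mono (s :: nat \<Rightarrow> nat)" "Cauchy (\<lambda>n. snd (F (r (s n))))"
        using X1_compact[of "\<lambda>n. snd (F (r n))", OF FX(2) FB(2)] by blast
      have "Cauchy (\<lambda>n. fst (F (r (s n))))"
        using Cauchy_subseq_Cauchy[OF r(2) s(1)] by (simp add: o_def)
      then obtain f1 where f1: "(\<lambda>n. fst (F (r (s n)))) \<longlonglongrightarrow> f1" using Cauchy_convergent_iff convergent_def by blast
      obtain f2 where f2: "(\<lambda>n. snd (F (r (s n)))) \<longlonglongrightarrow> f2" using s(2) Cauchy_convergent_iff convergent_def by blast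
      have "(\<lambda>n. F (r (s n))) \<longlonglongrightarrow> (f1, f2)" using tendsto_Pair[OF f1 f2] by simp
      then have "Cauchy (\<lambda>n. F ((r \<circ> s) n))" by (simp add: LIMSEQ_imp_Cauchy)
      moreover have "strict_mono (r \<circ> s)" using r(1) s(1) by (rule strict_mono_o)
      ultimately show ?thesis by blast
    qed
  qed (use M(1) in auto)
  obtain f where f: "f \<in> X V" "\<And>g. g \<in> X V \<Longrightarrow> Re (a f g) = inner h g"
    using representation[of h] by blast
  have ip: "inner h g = Re (L2_inner2 h g)" for g
    by (simp add: inner_prod_def inner_L2_def L2_inner2_def)
  have "a f g = L2_inner2 h g" if g: "g \<in> X V" for g
  proof -
    have ig: "\<i> *\<^sub>C g \<in> X V" using g by (rule X_scaleC)
    \<comment> \<open>Conjugate linearity in the second argument is obtained from hermiticity and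
      linearity in the first.\<close>
    have "a f (\<i> *\<^sub>C g) = cnj (a (\<i> *\<^sub>C g) f)" by (rule hermitian_on_XD[OF herm ig f(1)])
    also have "\<dots> = cnj \<i> * cnj (a g f)" by (simp add: lin(2)[OF g f(1)])
    also have "cnj (a g f) = a f g" by (rule hermitian_on_XD[OF herm g f(1), symmetric])
    finally have 1: "Re (a f (\<i> *\<^sub>C g)) = Im (a f g)" by simp
    have 2: "Re (L2_inner2 h (\<i> *\<^sub>C g)) = Im (L2_inner2 h g)"
      by (simp add: L2_inner2_def scaleC_prod_def L2_inner_scaleC_right)
    show ?thesis using f(2)[OF g] f(2)[OF ig] unfolding ip 1 2 by (rule complex_eqI)
  qed
  with f(1) show ?thesis by blast
qed

end

section \<open>The null spaces\<close>

lemma schroedinger_form_commute: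
  assumes "W \<in> borel_measurable lebesgue" "AE x in lebesgue. W x \<in> \<real>"
  shows "schroedinger_form W g f = cnj (schroedinger_form W f g)"
proof -
  have "L2_inner (weak_deriv b g) (weak_deriv b f) = cnj (L2_inner (weak_deriv b f) (weak_deriv b g))" for b
    by (rule L2_inner_commute)
  with mult_form_commute[OF assms, of g f] show ?thesis
    by (simp add: schroedinger_form_def)
qed

text \<open>Real components make all coefficients real almost everywhere, and the symmetry of
  \<beta> exchanges the two off-diagonal terms.\<close>

lemma forms_hermitian:
  fixes V :: "'a :: euclidean_space \<Rightarrow> real" and \<phi>1 \<phi>2 :: "'a L2"
  assumes V: "V \<in> borel_measurable lebesgue" and sym: "\<beta>$1$2 = \<beta>$2$1"
    and real: "real_valued \<phi>1" "real_valued \<phi>2"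
  shows "form_A V \<delta> \<beta> \<mu>1 \<mu>2 (\<phi>1, \<phi>2) g f = cnj (form_A V \<delta> \<beta> \<mu>1 \<mu>2 (\<phi>1, \<phi>2) f g)"
    and "form_B \<beta> (\<phi>1, \<phi>2) g f = cnj (form_B \<beta> (\<phi>1, \<phi>2) f g)"
proof -
  note [measurable] = V
  have R: "AE x in lebesgue. rep_L2 \<phi>1 x \<in> \<real> \<and> rep_L2 \<phi>2 x \<in> \<real>"
    using real unfolding real_valued_def by eventually_elim simp
  have mult: "mult_form W g f = cnj (mult_form W f g)"
    if "W \<in> borel_measurable lebesgue"
      "\<And>x. rep_L2 \<phi>1 x \<in> \<real> \<and> rep_L2 \<phi>2 x \<in> \<real> \<Longrightarrow> W x \<in> \<real>" for W and f g :: "'a L2"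
  proof (rule mult_form_commute[OF that(1)])
    show "AE x in lebesgue. W x \<in> \<real>" using R by eventually_elim (rule that(2))
  qed
  have schr: "schroedinger_form W g f = cnj (schroedinger_form W f g)"
    if "W \<in> borel_measurable lebesgue"
      "\<And>x. rep_L2 \<phi>1 x \<in> \<real> \<and> rep_L2 \<phi>2 x \<in> \<real> \<Longrightarrow> W x \<in> \<real>" for W and f g :: "'a L2"
  proof (rule schroedinger_form_commute[OF that(1)])
    show "AE x in lebesgue. W x \<in> \<real>" using R by eventually_elim (rule that(2))
  qed
  let ?W1 = "\<lambda>x. of_real (V x + \<delta> / 2) + of_real (2 * \<beta>$1$1) * (rep_L2 \<phi>1 x)\<^sup>2 + of_real (\<beta>$1$2) * (rep_L2 \<phi>2 x)\<^sup>2 - of_real \<mu>1 :: complex"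
  let ?W2 = "\<lambda>x. of_real (V x - \<delta> / 2) + of_real (\<beta>$2$1) * (rep_L2 \<phi>1 x)\<^sup>2 + of_real (2 * \<beta>$2$2) * (rep_L2 \<phi>2 x)\<^sup>2 - of_real \<mu>2 :: complex"
  let ?P = "\<lambda>x. of_real (\<beta>$2$1) * rep_L2 \<phi>1 x * rep_L2 \<phi>2 x :: complex"
  let ?P1 = "\<lambda>x. of_real (\<beta>$1$1) * (rep_L2 \<phi>1 x)\<^sup>2 :: complex"
  let ?P2 = "\<lambda>x. of_real (\<beta>$2$2) * (rep_L2 \<phi>2 x)\<^sup>2 :: complex"
  have W1: "schroedinger_form ?W1 g f = cnj (schroedinger_form ?W1 f g)" for f g
  proof (rule schr)
    show "?W1 \<in> borel_measurable lebesgue" by measurable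
  qed (auto intro!: Reals_add Reals_diff Reals_mult Reals_power)
  have W2: "schroedinger_form ?W2 g f = cnj (schroedinger_form ?W2 f g)" for f g
  proof (rule schr)
    show "?W2 \<in> borel_measurable lebesgue" by measurable
  qed (auto intro!: Reals_add Reals_diff Reals_mult Reals_power)
  have P: "mult_form ?P g f = cnj (mult_form ?P f g)" for f g
  proof (rule mult)
    show "?P \<in> borel_measurable lebesgue" by measurable
  qed (auto intro!: Reals_mult)
  have P1: "mult_form ?P1 g f = cnj (mult_form ?P1 f g)" for f g
  proof (rule mult)
    show "?P1 \<in> borel_measurable lebesgue" by measurable
  qed (auto intro!: Reals_mult Reals_power)
  have P2: "mult_form ?P2 g f = cnj (mult_form ?P2 f g)" for f g
  proof (rule mult)
    show "?P2 \<in> borel_measurable lebesgue" by measurable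
  qed (auto intro!: Reals_mult Reals_power)
  show "form_A V \<delta> \<beta> \<mu>1 \<mu>2 (\<phi>1, \<phi>2) g f = cnj (form_A V \<delta> \<beta> \<mu>1 \<mu>2 (\<phi>1, \<phi>2) f g)"
    using W1[of "fst g" "fst f"] W2[of "snd g" "snd f"] P[of "snd g" "fst f"] P[of "fst g" "snd f"]
    unfolding form_A_def Let_def fst_conv snd_conv sym by simp
  show "form_B \<beta> (\<phi>1, \<phi>2) g f = cnj (form_B \<beta> (\<phi>1, \<phi>2) f g)"
    using P1[of "fst g" "fst f"] P2[of "snd g" "snd f"] P[of "snd g" "fst f"] P[of "fst g" "snd f"]
    unfolding form_B_def Let_def fst_conv snd_conv sym by simp
qed

text \<open>The constants built from \<delta> and \<mu> and the interaction terms are admissible.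
  Apart from the gradient and \<open>V\<close>, the form thus consists of multiplication forms with
  relative bound 0.\<close>

lemma (in trapping_potential) form_plus_perturbed:
  fixes \<phi>1 \<phi>2 :: "'a L2"
  assumes "\<phi>1 \<in> H1" "\<phi>2 \<in> H1"
  obtains p where "perturbation p"
    "\<forall>f\<in>X V. \<forall>g\<in>X V. form_plus V \<delta> \<beta> \<mu>1 \<mu>2 (\<phi>1, \<phi>2) f g = kinetic2 f g + p f g"
proof -
  let ?u = "rep_L2 \<phi>1" and ?v = "rep_L2 \<phi>2"
  let ?Q1 = "\<lambda>x. of_real (\<delta> / 2 - \<mu>1) + (of_real (2 * \<beta>$1$1) * (?u x)\<^sup>2 + of_real (\<beta>$1$2) * (?v x)\<^sup>2) :: complex"
  let ?Q2 = "\<lambda>x. of_real (- \<delta> / 2 - \<mu>2) + (of_real (\<beta>$2$1) * (?u x)\<^sup>2 + of_real (2 * \<beta>$2$2) * (?v x)\<^sup>2) :: complex"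
  let ?P12 = "\<lambda>x. of_real (\<beta>$1$2) * ?u x * ?v x :: complex"
  let ?P21 = "\<lambda>x. of_real (\<beta>$2$1) * ?u x * ?v x :: complex"
  let ?P1 = "\<lambda>x. of_real (\<beta>$1$1) * (?u x)\<^sup>2 :: complex"
  let ?P2 = "\<lambda>x. of_real (\<beta>$2$2) * (?v x)\<^sup>2 :: complex"
  have u2: "admissible (\<lambda>x. c * (?u x)\<^sup>2)" and v2: "admissible (\<lambda>x. c * (?v x)\<^sup>2)"
    and uv: "admissible (\<lambda>x. c * ?u x * ?v x)" for c
    unfolding power2_eq_square mult.assoc
    by (intro admissible_sq sq_integrable_mult sq_integrable_H1_mult[OF dim] assms)+
  have Q: "admissible ?Q1" "admissible ?Q2"
    by (intro admissible_add admissible_const u2 v2)+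
  let ?p = "\<lambda>f g. (mult_form ?Q1 (fst f) (fst g) + mult_form ?P12 (snd f) (fst g)
      + mult_form ?P21 (fst f) (snd g) + mult_form ?Q2 (snd f) (snd g))
    + (mult_form ?P1 (fst f) (fst g) + mult_form ?P12 (snd f) (fst g)
      + mult_form ?P21 (fst f) (snd g) + mult_form ?P2 (snd f) (snd g))"
  have "perturbation ?p"
    by (intro perturbation_add perturbation_mult_form Q u2 v2 uv) auto
  moreover have "form_plus V \<delta> \<beta> \<mu>1 \<mu>2 (\<phi>1, \<phi>2) f g = kinetic2 f g + ?p f g" if "f \<in> X V" "g \<in> X V" for f g
  proof -
    have X1: "fst f \<in> X1 V" "fst g \<in> X1 V" "snd f \<in> X1 V" "snd g \<in> X1 V"
      using that by (auto simp: X_def)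
    have "(\<lambda>x. of_real (V x + \<delta> / 2) + of_real (2 * \<beta>$1$1) * (?u x)\<^sup>2 + of_real (\<beta>$1$2) * (?v x)\<^sup>2 - of_real \<mu>1)
        = (\<lambda>x. of_real (V x) + ?Q1 x)" by (simp add: fun_eq_iff)
    moreover have "(\<lambda>x. of_real (V x - \<delta> / 2) + of_real (\<beta>$2$1) * (?u x)\<^sup>2 + of_real (2 * \<beta>$2$2) * (?v x)\<^sup>2 - of_real \<mu>2)
        = (\<lambda>x. of_real (V x) + ?Q2 x)" by (simp add: fun_eq_iff)
    ultimately have A: "form_A V \<delta> \<beta> \<mu>1 \<mu>2 (\<phi>1, \<phi>2) f g
        = schroedinger_form (\<lambda>x. of_real (V x) + ?Q1 x) (fst f) (fst g) + mult_form ?P12 (snd f) (fst g)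
        + mult_form ?P21 (fst f) (snd g) + schroedinger_form (\<lambda>x. of_real (V x) + ?Q2 x) (snd f) (snd g)"
      unfolding form_A_def Let_def fst_conv snd_conv by (simp only:)
    show ?thesis
      unfolding form_plus_def A form_B_def Let_def fst_conv snd_conv kinetic2_def
        schroedinger_form_split[OF Q(1) X1(1,2)] schroedinger_form_split[OF Q(2) X1(3,4)]
      by (simp only: add_ac)
  qed
  ultimately show thesis by (intro that[of ?p]) auto
qed

section \<open>Linear algebra of the off-diagonal operator\<close>

lemma scaleC_zero_right: "c *\<^sub>C (0 :: 'a :: complex_vector) = 0"
  using scaleC_add_right[of c 0 "0 :: 'a"] by simp

lemma scaleC_zero_left: "0 *\<^sub>C x = (0 :: 'a :: complex_vector)"
  using scaleC_add_left[of 0 0 x] by simp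

lemma cspan_two: "cspan {a, b} = {c *\<^sub>C a + d *\<^sub>C b | c d. True}"
proof -
  interpret vector_space "scaleC :: complex \<Rightarrow> 'a \<Rightarrow> 'a" by (rule vector_space_scaleC)
  have "x \<in> span {a, b} \<longleftrightarrow> (\<exists>c d. x - c *\<^sub>C a = d *\<^sub>C b)" for x
    by (auto simp: span_insert[of a "{b}"] span_singleton image_iff)
  moreover have "(x - c *\<^sub>C a = d *\<^sub>C b) \<longleftrightarrow> (x = c *\<^sub>C a + d *\<^sub>C b)" for x c d
    by (simp only: diff_eq_eq add.commute)
  ultimately show ?thesis unfolding cspan_def by auto
qed

lemma mem_relpow_2: "(x, z) \<in> R ^^ 2 \<longleftrightarrow> (\<exists>y. (x, y) \<in> R \<and> (y, z) \<in> R)"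
  by (auto simp: numeral_2_eq_2)

lemma mem_relpow_3: "(x, w) \<in> R ^^ 3 \<longleftrightarrow> (\<exists>y z. (x, y) \<in> R \<and> (y, z) \<in> R \<and> (z, w) \<in> R)"
  by (auto simp: numeral_3_eq_3)

text \<open>Pure algebra of graphs. The operators enter through linearity and injectivity of
  \<open>Hp\<close>, the null space of \<open>Hm\<close>, solvability for the two vectors, and
  \<open>orth\<close>, which condenses the symmetry of \<open>Hm\<close> and the positivity of
  \<open>Hp\<close> into one implication.\<close>

lemma off_diagonal_null_spaces:
  fixes Hp Hm :: "('v :: complex_vector \<times> 'v) set"
  assumes add: "\<And>f g h k. (f, h) \<in> Hp \<Longrightarrow> (g, k) \<in> Hp \<Longrightarrow> (f + g, h + k) \<in> Hp"
    and scale: "\<And>c f h. (f, h) \<in> Hp \<Longrightarrow> (c *\<^sub>C f, c *\<^sub>C h) \<in> Hp"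
    and zero: "(0, 0) \<in> Hp" and inj: "\<And>f. (f, 0) \<in> Hp \<Longrightarrow> f = 0"
    and null: "op_null Hm = cspan {\<Phi>1, \<Phi>2}"
    and range: "\<exists>f. (f, \<Phi>1) \<in> Hp" "\<exists>f. (f, \<Phi>2) \<in> Hp"
    and orth: "\<And>g u v. (g, u) \<in> Hm \<Longrightarrow> (u, v) \<in> Hp \<Longrightarrow> (v, 0) \<in> Hm \<Longrightarrow> u = 0"
  defines "H \<equiv> off_diagonal Hm Hp"
  shows "op_null (H ^^ 3) = op_null (H ^^ 2)"
    and "is_direct_sum (op_null (H ^^ 2)) (op_null H) (cspan {(op_app (Hp\<inverse>) \<Phi>1, 0), (op_app (Hp\<inverse>) \<Phi>2, 0)})"
    and "op_null H = cspan {(0, \<Phi>1), (0, \<Phi>2)}"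
proof -
  have uniq: "f = g" if "(f, h) \<in> Hp" "(g, h) \<in> Hp" for f g h
  proof -
    have "(f - g, 0) \<in> Hp" using add[OF that(1) scale[OF that(2), of "-1"]] by (simp add: scaleC_minus_one)
    then show ?thesis using inj by fastforce
  qed
  \<comment> \<open>Injectivity makes the inverse graph single-valued, so the definite description
    in \<open>op_app\<close> denotes the solution.\<close>
  have app: "(op_app (Hp\<inverse>) h, h) \<in> Hp" if ex: "\<exists>f. (f, h) \<in> Hp" for h
    unfolding op_app_def converse_iff by (rule theI') (use ex uniq in blast)
  have mem_Hm: "(v, 0) \<in> Hm \<longleftrightarrow> (\<exists>c d. v = c *\<^sub>C \<Phi>1 + d *\<^sub>C \<Phi>2)" for v
    using null unfolding op_null_def cspan_two by (auto simp: set_eq_iff)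
  have "(0, 0) \<in> Hm"
    unfolding mem_Hm by (intro exI[of _ 0]) (simp add: scaleC_zero_left)
  with zero have zH: "((0, 0), (0, 0)) \<in> H"
    by (simp add: H_def off_diagonal_def)
  have H: "((f, g), (u, v)) \<in> H \<longleftrightarrow> (g, u) \<in> Hm \<and> (f, v) \<in> Hp" for f g u v
    by (simp add: H_def off_diagonal_def)
  have N1: "(f, g) \<in> op_null H \<longleftrightarrow> f = 0 \<and> (g, 0) \<in> Hm" for f g
    using zero inj by (auto simp: op_null_def H zero_prod_def)
  have N2: "(f, g) \<in> op_null (H ^^ 2) \<longleftrightarrow> (g, 0) \<in> Hm \<and> (\<exists>v. (f, v) \<in> Hp \<and> (v, 0) \<in> Hm)" for f g
    using zero inj by (auto simp: op_null_def H zero_prod_def mem_relpow_2)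
  have N3: "(f, g) \<in> op_null (H ^^ 3) \<longleftrightarrow> (f, g) \<in> op_null (H ^^ 2)" for f g
  proof
    assume "(f, g) \<in> op_null (H ^^ 3)"
    then obtain u v u' v' where *: "(g, u) \<in> Hm" "(f, v) \<in> Hp" "(v, u') \<in> Hm" "(u, v') \<in> Hp" "(v', 0) \<in> Hm" "(u', 0) \<in> Hp"
      by (auto simp: op_null_def H zero_prod_def mem_relpow_3)
    then show "(f, g) \<in> op_null (H ^^ 2)" using inj[OF *(6)] orth[OF *(1,4,5)] by (auto simp: N2)
  next
    assume "(f, g) \<in> op_null (H ^^ 2)"
    \<comment> \<open>A chain that has arrived at 0 is prolonged by the pair (0, 0).\<close>
    then show "(f, g) \<in> op_null (H ^^ 3)"
      using zH unfolding op_null_def mem_Collect_eq mem_relpow_2 mem_relpow_3 zero_prod_def by blast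
  qed
  then show "op_null (H ^^ 3) = op_null (H ^^ 2)" by auto
  show "op_null H = cspan {(0, \<Phi>1), (0, \<Phi>2)}"
  proof -
    have "(f, g) \<in> cspan {(0, \<Phi>1), (0, \<Phi>2)} \<longleftrightarrow> f = 0 \<and> (\<exists>c d. g = c *\<^sub>C \<Phi>1 + d *\<^sub>C \<Phi>2)" for f g :: 'v
      by (auto simp: cspan_two scaleC_prod_def scaleC_zero_right)
    then show ?thesis by (auto simp: N1 mem_Hm)
  qed
  let ?p = "op_app (Hp\<inverse>) \<Phi>1" and ?q = "op_app (Hp\<inverse>) \<Phi>2"
  have comb: "(c *\<^sub>C ?p + d *\<^sub>C ?q, c *\<^sub>C \<Phi>1 + d *\<^sub>C \<Phi>2) \<in> Hp" for c d
    by (intro add scale app range)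
  have F: "(\<exists>v. (f, v) \<in> Hp \<and> (v, 0) \<in> Hm) \<longleftrightarrow> (\<exists>c d. f = c *\<^sub>C ?p + d *\<^sub>C ?q)" for f
  proof
    assume "\<exists>v. (f, v) \<in> Hp \<and> (v, 0) \<in> Hm"
    then obtain c d where "(f, c *\<^sub>C \<Phi>1 + d *\<^sub>C \<Phi>2) \<in> Hp" unfolding mem_Hm by blast
    from uniq[OF this comb] show "\<exists>c d. f = c *\<^sub>C ?p + d *\<^sub>C ?q" by blast
  next
    assume "\<exists>c d. f = c *\<^sub>C ?p + d *\<^sub>C ?q"
    then show "\<exists>v. (f, v) \<in> Hp \<and> (v, 0) \<in> Hm" using comb unfolding mem_Hm by blast
  qed
  let ?C = "cspan {(?p, 0 :: 'v), (?q, 0)}"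
  show "is_direct_sum (op_null (H ^^ 2)) (op_null H) (?C)"
    unfolding is_direct_sum_def
  proof
    have S: "(f, g) \<in> ?C \<longleftrightarrow> g = 0 \<and> (\<exists>c d. f = c *\<^sub>C ?p + d *\<^sub>C ?q)" for f g :: 'v
      by (auto simp: cspan_two scaleC_prod_def scaleC_zero_right)
    show "op_null H \<inter> ?C = {0}"
    proof -
      have "(0, 0) \<in> op_null H" using zH by (simp add: op_null_def zero_prod_def)
      moreover have "(0, 0 :: 'v) \<in> ?C" 
        unfolding S by (intro conjI refl exI[of _ 0]) (simp add: scaleC_zero_left)
      ultimately have "0 \<in> op_null H \<inter> ?C"
        unfolding zero_prod_def by (rule IntI)
      moreover have "w = 0" if "w \<in> op_null H \<inter> ?C" for w
        using that by (cases w) (simp add: N1 S zero_prod_def)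
      ultimately show ?thesis by blast
    qed
    show "op_null (H ^^ 2) = op_null H + ?C"
    proof (rule set_eqI)
      fix w :: "'v \<times> 'v"
      obtain f g where w: "w = (f, g)" by (cases w)
      \<comment> \<open>The two summands occupy different components, which forces the splitting of
        a pair.\<close>
      have "w \<in> op_null H + ?C \<longleftrightarrow> (0, g) \<in> op_null H \<and> (f, 0) \<in> ?C"
      proof
        assume "w \<in> op_null H + ?C"
        then obtain a b where ab: "w = a + b" "a \<in> op_null H" "b \<in> ?C"
          by (rule set_plus_elim)
        obtain a1 a2 b1 b2 where "a = (a1, a2)" "b = (b1, b2)" by (cases a, cases b)
        with ab w show "(0, g) \<in> op_null H \<and> (f, 0) \<in> ?C" by (simp add: N1 S)
      next
        assume "(0, g) \<in> op_null H \<and> (f, 0) \<in> ?C"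
        then have "(0, g) + (f, 0) \<in> op_null H + ?C" by (intro set_plus_intro) auto
        then show "w \<in> op_null H + ?C" by (simp add: w)
      qed
      then show "w \<in> op_null (H ^^ 2) \<longleftrightarrow> w \<in> op_null H + ?C"
        unfolding w N1 N2 S F by simp
    qed
  qed
qed

lemma L2_inner2_simps:
  "L2_inner2 (f + g) h = L2_inner2 f h + L2_inner2 g h"
  "L2_inner2 (c *\<^sub>C f) h = c * L2_inner2 f h" "L2_inner2 0 h = 0"
  by (simp_all add: L2_inner2_def scaleC_prod_def L2_inner_add_left L2_inner_scaleC_left L2_inner_zero_left distrib_left)

lemma L2_inner2_commute: "L2_inner2 g f = cnj (L2_inner2 f g)"
  using L2_inner_commute[of "fst g" "fst f"] L2_inner_commute[of "snd g" "snd f"] by (simp add: L2_inner2_def)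

theorem theorem7:
  fixes V :: "'a :: euclidean_space \<Rightarrow> real"
    and \<delta> \<alpha> \<mu>1 \<mu>2 :: real
    and \<beta> :: "real^2^2"
    and \<phi>1 \<phi>2 :: "'a L2"
  defines "Hp \<equiv> H_plus V \<delta> \<beta> \<mu>1 \<mu>2 (\<phi>1, \<phi>2)"
    and "Hm \<equiv> H_minus V \<delta> \<beta> \<mu>1 \<mu>2 (\<phi>1, \<phi>2)"
  defines "H \<equiv> off_diagonal Hm Hp"
    and "\<Phi>1 \<equiv> (\<phi>1, \<phi>2)"
    and "\<Phi>2 \<equiv> (- of_real (sqrt ((1 - \<alpha>) / \<alpha>)) *\<^sub>C \<phi>1, of_real (sqrt (\<alpha> / (1 - \<alpha>))) *\<^sub>C \<phi>2)"
  assumes dim: "DIM('a) \<in> {1, 2, 3}"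
    and V_nonneg: "\<And>x. V x \<ge> 0"
    and V_loc: "locally_integrable V"
    and V_infty: "filterlim V at_top at_infinity"
    and \<beta>_sym: "\<beta>$1$2 = \<beta>$2$1"
    and \<alpha>: "0 < \<alpha>" "\<alpha> < 1"
    and ground: "ground_state V \<delta> \<beta> \<alpha> (\<phi>1, \<phi>2)"
    and real: "real_valued \<phi>1" "real_valued \<phi>2"
    and chem: "chemical_potentials V \<delta> \<beta> (\<phi>1, \<phi>2) \<mu>1 \<mu>2"
    and pos: "positive_definite (X V) (form_plus V \<delta> \<beta> \<mu>1 \<mu>2 (\<phi>1, \<phi>2))"
    and null_minus: "op_null Hm = cspan {\<Phi>1, \<Phi>2}"
  shows "op_null (H ^^ 3) = op_null (H ^^ 2)
    \<and> is_direct_sum (op_null (H ^^ 2)) (op_null H)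
        (cspan {(op_app (Hp\<inverse>) \<Phi>1, 0), (op_app (Hp\<inverse>) \<Phi>2, 0)})
    \<and> op_null H = cspan {(0, \<Phi>1), (0, \<Phi>2)}"
proof -
  interpret trapping_potential V
    using dim V_nonneg locally_integrable_measurable[OF V_loc] V_infty by unfold_locales auto
  let ?a = "form_plus V \<delta> \<beta> \<mu>1 \<mu>2 (\<phi>1, \<phi>2)" and ?b = "form_minus V \<delta> \<beta> \<mu>1 \<mu>2 (\<phi>1, \<phi>2)"
  have H1: "\<phi>1 \<in> H1" "\<phi>2 \<in> H1"
    using ground by (auto simp: ground_state_def is_arg_min_def X_def X1_def)
  note AB = forms_hermitian[OF V_meas \<beta>_sym real]
  have herm: "hermitian_on_X ?a"
    unfolding hermitian_on_X_def form_plus_def complex_cnj_add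
    by (intro ballI arg_cong2[where f="(+)"] AB)
  have herm_minus: "?b g f = cnj (?b f g)" for f g
    unfolding form_minus_def complex_cnj_diff by (intro arg_cong2[where f="(-)"] AB)
  obtain p where p: "perturbation p" "\<forall>f\<in>X V. \<forall>g\<in>X V. ?a f g = kinetic2 f g + p f g"
    using form_plus_perturbed[OF H1] .
  have Hp: "(f, h) \<in> Hp \<longleftrightarrow> f \<in> X V \<and> (\<forall>g\<in>X V. ?a f g = L2_inner2 h g)" for f h
    by (simp add: Hp_def H_plus_def associated_operator_def)
  have Hm: "(f, h) \<in> Hm \<longleftrightarrow> f \<in> X V \<and> (\<forall>g\<in>X V. ?b f g = L2_inner2 h g)" for f h
    by (simp add: Hm_def H_minus_def associated_operator_def)
  have a_zero: "f = 0" if "f \<in> X V" "?a f f = 0" for f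
    using pos that by (force simp: positive_definite_def)
  have range: "\<exists>f. (f, h) \<in> Hp" for h
    using form_range[OF p herm pos, of h] by (auto simp: Hp)
  \<comment> \<open>A solution \<open>f\<close> for the right-hand side 0 satisfies a(f, f) = 0, and
    positivity makes it 0.\<close>
  have zero: "(0, 0) \<in> Hp"
    using range[of 0] a_zero by (force simp: Hp L2_inner2_simps)
  have add: "(f + g, h + k) \<in> Hp" if "(f, h) \<in> Hp" "(g, k) \<in> Hp" for f g h k
    using that perturbed_form_linear(1)[OF p] by (auto simp: Hp X_add L2_inner2_simps)
  have scale: "(c *\<^sub>C f, c *\<^sub>C h) \<in> Hp" if "(f, h) \<in> Hp" for c f h
    using that perturbed_form_linear(2)[OF p] by (auto simp: Hp X_scaleC L2_inner2_simps)
  have inj: "f = 0" if "(f, 0) \<in> Hp" for f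
    using that a_zero by (auto simp: Hp L2_inner2_simps)
  have orth: "u = 0" if g: "(g, u) \<in> Hm" and u: "(u, v) \<in> Hp" and v: "(v, 0) \<in> Hm" for g u v
  proof -
    \<comment> \<open>Each of the three vectors is the first entry of a pair in one of the graphs
      and so lies in the form domain; this allows each of them as a test vector in the identities
      below.\<close>
    have X: "g \<in> X V" "u \<in> X V" "v \<in> X V" using g u v by (auto simp: Hp Hm)
    have "?a u u = L2_inner2 v u" using u X by (simp add: Hp)
    also have "\<dots> = cnj (L2_inner2 u v)" by (rule L2_inner2_commute)
    also have "L2_inner2 u v = ?b g v" using g X by (simp add: Hm)
    also have "cnj (?b g v) = ?b v g" by (rule herm_minus[symmetric])
    also have "\<dots> = 0" using v X by (simp add: Hm L2_inner2_simps)
    finally show ?thesis using a_zero X(2) by blast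
  qed
  show ?thesis
    unfolding H_def
    by (intro conjI off_diagonal_null_spaces[OF add scale zero inj null_minus range range orth])
qed

end
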